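(* Let $\mathscr{A}$ be a $C^*$-algebra and $\mathscr{T}(\mathscr{A})$ the collection of all traces on $\mathscr{A}$. For each $\tau\in\mathscr{T}(\mathscr{A})$, denote by $M_\tau$ the von Neumann algebra generated by the GNS representation of $\mathscr{A}$ corresponding to $\tau$. Then $$h(\mathscr{A})=\sup_{\tau\in\mathscr{T}(\mathscr{A})}h(M_\tau).$$
   Context: Conventions: $C^*$-algebras are unital, a trace is a tracial state, and $C^*$-algebras whose entropy is considered are assumed to admit a trace. $M_\tau=\pi_\tau(\mathscr{A})''$ is equipped with its canonical faithful normal trace extending $\tau$. For an index set $I$, $\mathbb{C}^*\langle T_i\mid i\in I\rangle$ is the unital $*$-algebra of noncommutative complex polynomials in free variables $T_i$ and their formal adjoints. For $R>0$, $\Sigma_{R,I}$ is the set of linear functionals $\ell$ on it with $\ell(P^*P)\ge 0$, $\ell(1)=1$, $\ell(PQ)=\ell(QP)$ for all $P,Q$, and $\ell((T_j^*T_j)^k)\le R^{2k}$ for all $k\in\mathbb{N}$, $j\in I$, with the weak-$*$ topology. A tuple $(x_i)_i$ is $R$-bounded if $\|x_i\|\le R$ for all $i$. For an $R$-bounded $A\in M_N(\mathbb{C})^I$ let $\ell_A(P)=\frac1N\mathrm{Tr}(P(A))$. For $\mathcal{O}\subset\Sigma_{R,I}$ open, $\Gamma_R^{(N)}(\mathcal{O})=\{A\in M_N(\mathbb{C})^I: \|A_i\|\le R\ \forall i,\ \ell_A\in\mathcal{O}\}$. On $M_N(\mathbb{C})$ let $\|A\|_2=(\frac1N\mathrm{Tr}(A^*A))^{1/2}$.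 For $\Omega\subset M_N(\mathbb{C})^I$, $F\subset I$ finite, $\epsilon>0$, $K^{\mathrm{orb}}_{F,\epsilon}(\Omega)$ is the minimal cardinality of $\Omega_0\subset\Omega$ such that for each $C\in\Omega$ there are $B\in\Omega_0$ and $U\in U(N)$ with $\|C_i-UB_iU^*\|_2<\epsilon$ for all $i\in F$. For $K\subset\Sigma_{R,I}$ compact convex, $$h(K)=\sup_{F,\epsilon}\inf_{\mathcal{O}\supset K}\limsup_{N\to\infty}\frac1{N^2}\log K^{\mathrm{orb}}_{F,\epsilon}(\Gamma_R^{(N)}(\mathcal{O})),$$ with $F\subset I$ finite, $\epsilon>0$, $\mathcal{O}$ a weak-$*$ open neighborhood of $K$ in $\Sigma_{R,I}$, and $\log 0=-\infty$. For a $C^*$-algebra $\mathscr{A}$, $h(\mathscr{A})$ is the $1$-bounded entropy of its universal tracial completion (its completion, on norm-bounded sets, with respect to $\|x\|_{2}=\sup_{\tau\in\mathscr{T}(\mathscr{A})}\tau(x^*x)^{1/2}$); concretely $h(\mathscr{A})=h(L_a)$, where $a=(a_i)_{i\in I}$ is any $R$-bounded tuple generating $\mathscr{A}$ and $L_a=\{P\mapsto\tau(P(a)):\tau\in\mathscr{T}(\mathscr{A})\}\subset\Sigma_{R,I}$; the value does not depend on the choice of $R$ and $a$. For a tracial von Neumann algebra $(M,\tau)$, $h(M)=h(\{\ell_x\})$, where $x$ is any $R$-bounded tuple generating $M$ as a von Neumann algebra and $\ell_x(P)=\tau(P(x))$; again the value does not depend on the choice of $R$ and $x$. *)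

theory Defs
  imports
    "HOL-Analysis.Function_Topology"
    "HOL-Library.FuncSet"
    "HOL-Library.Liminf_Limsup"
    "HOL-Library.Extended_Real"
    "HOL-Library.Extended_Nat"
    "HOL-Library.Nonpos_Ints"
    "HOL-Library.Poly_Mapping"
    "Jordan_Normal_Form.Schur_Decomposition"
begin

section \<open>Unital C*-algebras and their traces\<close>

class scaleC =
  fixes scaleC :: "complex \<Rightarrow> 'a \<Rightarrow> 'a" (infixr \<open>*\<^sub>C\<close> 75)

class star =
  fixes star :: "'a \<Rightarrow> 'a"

text \<open>The class \<^class>\<open>real_normed_algebra_1\<close> includes a unit of norm one, so the algebras below are
  unital and nonzero; an algebra that admits a tracial state is nonzero.\<close>

class cstar_algebra = real_normed_algebra_1 + banach + scaleC + star +
  assumes scaleR_scaleC: "r *\<^sub>R x = complex_of_real r *\<^sub>C x"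
    and scaleC_add_right: "c *\<^sub>C (x + y) = c *\<^sub>C x + c *\<^sub>C y"
    and scaleC_add_left: "(c + d) *\<^sub>C x = c *\<^sub>C x + d *\<^sub>C x"
    and scaleC_scaleC: "c *\<^sub>C d *\<^sub>C x = (c * d) *\<^sub>C x"
    and mult_scaleC_left: "(c *\<^sub>C x) * y = c *\<^sub>C (x * y)"
    and mult_scaleC_right: "x * (c *\<^sub>C y) = c *\<^sub>C (x * y)"
    and norm_scaleC: "norm (c *\<^sub>C x) = cmod c * norm x"
    and star_star: "star (star x) = x"
    and star_add: "star (x + y) = star x + star y"
    and star_scaleC: "star (c *\<^sub>C x) = cnj c *\<^sub>C star x"
    and star_mult: "star (x * y) = star y * star x"
    and norm_star_mult: "norm (star x * x) = (norm x)\<^sup>2"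

definition is_trace :: "('a::cstar_algebra \<Rightarrow> complex) \<Rightarrow> bool" where
  "is_trace \<tau> \<longleftrightarrow>
     (\<forall>x y. \<tau> (x + y) = \<tau> x + \<tau> y) \<and> (\<forall>c x. \<tau> (c *\<^sub>C x) = c * \<tau> x) \<and>
     (\<forall>x. \<tau> (star x * x) \<in> \<real>\<^sub>\<ge>\<^sub>0) \<and> \<tau> 1 = 1 \<and>
     (\<forall>x y. \<tau> (x * y) = \<tau> (y * x))"

definition traces :: "('a::cstar_algebra \<Rightarrow> complex) set" where
  "traces = {\<tau>. is_trace \<tau>}"

definition star_subalgebra :: "'a::cstar_algebra set \<Rightarrow> bool" where
  "star_subalgebra S \<longleftrightarrow>
     1 \<in> S \<and> (\<forall>x\<in>S. \<forall>y\<in>S. x + y \<in> S \<and> x * y \<in> S) \<and> (\<forall>c. \<forall>x\<in>S. c *\<^sub>C x \<in> S) \<and>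
     (\<forall>x\<in>S. star x \<in> S)"

definition cstar_generating_tuple :: "real \<Rightarrow> ('i \<Rightarrow> 'a::cstar_algebra) \<Rightarrow> bool" where
  "cstar_generating_tuple R a \<longleftrightarrow>
     0 < R \<and> (\<forall>i. norm (a i) \<le> R) \<and>
     (\<forall>S. star_subalgebra S \<and> closed S \<and> range a \<subseteq> S \<longrightarrow> S = UNIV)"


section \<open>Noncommutative *-polynomials and the space of tracial laws\<close>

text \<open>The index set is the type \<open>'i\<close>. The polynomial algebra is the monoid algebra over the complex
  numbers of the free monoid of words in the letters \<open>T\<^sub>i\<close> and \<open>T\<^sub>i\<^sup>*\<close>. The monoid is written
  additively because the multiplication of \<^type>\<open>poly_mapping\<close> is the convolution with respect to
  \<open>+\<close> on the exponents.\<close>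

datatype 'i letter = Gen 'i | GenStar 'i

datatype 'i ncword = Word (letters: "'i letter list")

instantiation ncword :: (type) monoid_add
begin

definition zero_ncword :: "'a ncword" where
  "0 = Word []"

definition plus_ncword :: "'a ncword \<Rightarrow> 'a ncword \<Rightarrow> 'a ncword" where
  "v + w = Word (letters v @ letters w)"

instance
  by standard (simp_all add: zero_ncword_def plus_ncword_def)

end

type_synonym 'i ncpoly = "'i ncword \<Rightarrow>\<^sub>0 complex"

fun letter_star :: "'i letter \<Rightarrow> 'i letter" where
  "letter_star (Gen i) = GenStar i"
| "letter_star (GenStar i) = Gen i"

definition word_star :: "'i ncword \<Rightarrow> 'i ncword" where
  "word_star w = Word (rev (map letter_star (letters w)))"

definition nc_star :: "'i ncpoly \<Rightarrow> 'i ncpoly" where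
  "nc_star P = (\<Sum>w\<in>Poly_Mapping.keys P. Poly_Mapping.single (word_star w) (cnj (Poly_Mapping.lookup P w)))"

definition nc_const :: "complex \<Rightarrow> 'i ncpoly" where
  "nc_const c = Poly_Mapping.single 0 c"

definition nc_var :: "'i \<Rightarrow> 'i ncpoly" where
  "nc_var i = Poly_Mapping.single (Word [Gen i]) 1"

text \<open>The value \<open>\<l>((T\<^sub>j\<^sup>*T\<^sub>j)\<^sup>k)\<close> is real because of the positivity of \<open>\<l>\<close>, so taking real parts
  in the last condition loses nothing.\<close>

definition law_space :: "real \<Rightarrow> ('i ncpoly \<Rightarrow> complex) set" where
  "law_space R = {\<l>.
     (\<forall>P Q. \<l> (P + Q) = \<l> P + \<l> Q) \<and> (\<forall>c P. \<l> (nc_const c * P) = c * \<l> P) \<and>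
     (\<forall>P. \<l> (nc_star P * P) \<in> \<real>\<^sub>\<ge>\<^sub>0) \<and> \<l> 1 = 1 \<and>
     (\<forall>P Q. \<l> (P * Q) = \<l> (Q * P)) \<and>
     (\<forall>k j. Re (\<l> ((nc_star (nc_var j) * nc_var j) ^ k)) \<le> R ^ (2 * k))}"

text \<open>Weak-* topology: the functionals carry the product topology of the function type, that is,
  the topology of pointwise convergence.\<close>

definition law_open :: "real \<Rightarrow> ('i ncpoly \<Rightarrow> complex) set \<Rightarrow> bool" where
  "law_open R V \<longleftrightarrow> openin (top_of_set (law_space R)) V"

text \<open>Tuples live in three different *-algebras below: a C*-algebra, the matrices of a given size, and
  the operators on a Hilbert space. Each is passed as a unit \<open>e\<close>, a product \<open>m\<close> and an involution
  \<open>s\<close>. Since \<open>\<phi>\<close> is always linear, \<open>nc_law \<phi> e m s x P\<close> is \<open>\<phi> (P(x))\<close>, with \<open>P(x)\<close> expanded as the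
  linear combination of the values at \<open>x\<close> of the words in \<open>P\<close>.\<close>

fun word_value :: "'b \<Rightarrow> ('b \<Rightarrow> 'b \<Rightarrow> 'b) \<Rightarrow> ('b \<Rightarrow> 'b) \<Rightarrow> ('i \<Rightarrow> 'b) \<Rightarrow> 'i letter list \<Rightarrow> 'b" where
  "word_value e m s x [] = e"
| "word_value e m s x (Gen i # w) = m (x i) (word_value e m s x w)"
| "word_value e m s x (GenStar i # w) = m (s (x i)) (word_value e m s x w)"

definition nc_law ::
  "('b \<Rightarrow> complex) \<Rightarrow> 'b \<Rightarrow> ('b \<Rightarrow> 'b \<Rightarrow> 'b) \<Rightarrow> ('b \<Rightarrow> 'b) \<Rightarrow> ('i \<Rightarrow> 'b) \<Rightarrow> 'i ncpoly \<Rightarrow> complex" where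
  "nc_law \<phi> e m s x P = (\<Sum>w\<in>Poly_Mapping.keys P. Poly_Mapping.lookup P w * \<phi> (word_value e m s x (letters w)))"


section \<open>Matrix microstates and 1-bounded entropy\<close>

definition mat_tr :: "complex mat \<Rightarrow> complex" where
  "mat_tr A = (\<Sum>i<dim_row A. A $$ (i, i)) / of_nat (dim_row A)"

definition mat_norm2 :: "complex mat \<Rightarrow> real" where
  "mat_norm2 A = sqrt (Re (mat_tr (mat_adjoint A * A)))"

definition vec_norm2 :: "complex vec \<Rightarrow> real" where
  "vec_norm2 v = sqrt (\<Sum>i<dim_vec v. (cmod (vec_index v i))\<^sup>2)"

definition mat_opnorm :: "complex mat \<Rightarrow> real" where
  "mat_opnorm A = (SUP v\<in>{v \<in> carrier_vec (dim_col A). vec_norm2 v \<le> 1}. vec_norm2 (A *\<^sub>v v))"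

definition unitary_mats :: "nat \<Rightarrow> complex mat set" where
  "unitary_mats N = {U \<in> carrier_mat N N. mat_adjoint U * U = 1\<^sub>m N}"

definition mat_law :: "nat \<Rightarrow> ('i \<Rightarrow> complex mat) \<Rightarrow> 'i ncpoly \<Rightarrow> complex" where
  "mat_law N A = nc_law mat_tr (1\<^sub>m N) (*) mat_adjoint A"

definition microstates ::
  "real \<Rightarrow> nat \<Rightarrow> ('i ncpoly \<Rightarrow> complex) set \<Rightarrow> ('i \<Rightarrow> complex mat) set" where
  "microstates R N V =
     {A. (\<forall>i. A i \<in> carrier_mat N N \<and> mat_opnorm (A i) \<le> R) \<and> mat_law N A \<in> V}"

definition orbit_covers ::
  "nat \<Rightarrow> 'i set \<Rightarrow> real \<Rightarrow> ('i \<Rightarrow> complex mat) set \<Rightarrow> ('i \<Rightarrow> complex mat) set \<Rightarrow> bool" where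
  "orbit_covers N F \<epsilon> \<Omega>\<^sub>0 \<Omega> \<longleftrightarrow>
     (\<forall>C\<in>\<Omega>. \<exists>B\<in>\<Omega>\<^sub>0. \<exists>U\<in>unitary_mats N.
        \<forall>i\<in>F. mat_norm2 (C i - U * B i * mat_adjoint U) < \<epsilon>)"

text \<open>The infimum in \<^typ>\<open>enat\<close> is attained whenever a finite covering set exists, and is \<open>\<infinity>\<close>
  otherwise.\<close>

definition K_orb :: "nat \<Rightarrow> 'i set \<Rightarrow> real \<Rightarrow> ('i \<Rightarrow> complex mat) set \<Rightarrow> enat" where
  "K_orb N F \<epsilon> \<Omega> =
     (INF \<Omega>\<^sub>0\<in>{\<Omega>\<^sub>0. \<Omega>\<^sub>0 \<subseteq> \<Omega> \<and> finite \<Omega>\<^sub>0 \<and> orbit_covers N F \<epsilon> \<Omega>\<^sub>0 \<Omega>}. enat (card \<Omega>\<^sub>0))"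

definition log_enat :: "enat \<Rightarrow> ereal" where
  "log_enat k = (case k of enat n \<Rightarrow> (if n = 0 then -\<infinity> else ereal (ln (real n))) | \<infinity> \<Rightarrow> \<infinity>)"

definition entropy1 :: "real \<Rightarrow> ('i ncpoly \<Rightarrow> complex) set \<Rightarrow> ereal" where
  "entropy1 R K =
     (SUP (F, \<epsilon>)\<in>{(F, \<epsilon>). finite F \<and> 0 < \<epsilon>}.
        INF V\<in>{V. law_open R V \<and> K \<subseteq> V}.
          limsup (\<lambda>N. log_enat (K_orb N F \<epsilon> (microstates R N V)) / ereal ((real N)\<^sup>2)))"

definition trace_law :: "('a::cstar_algebra \<Rightarrow> complex) \<Rightarrow> ('i \<Rightarrow> 'a) \<Rightarrow> 'i ncpoly \<Rightarrow> complex" where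
  "trace_law \<tau> a = nc_law \<tau> 1 (*) star a"

definition trace_laws :: "('i \<Rightarrow> 'a::cstar_algebra) \<Rightarrow> ('i ncpoly \<Rightarrow> complex) set" where
  "trace_laws a = (\<lambda>\<tau>. trace_law \<tau> a) ` traces"

text \<open>The entropy of a C*-algebra, computed from an \<open>R\<close>-bounded tuple \<open>a\<close> that generates it.
  The value does not depend on \<open>R\<close> and \<open>a\<close>; they remain arguments so that statements can range over
  all choices instead of fixing one.\<close>

definition cstar_entropy :: "real \<Rightarrow> ('i \<Rightarrow> 'a::cstar_algebra) \<Rightarrow> ereal" where
  "cstar_entropy R a = entropy1 R (trace_laws a)"


section \<open>Operators on a Hilbert space and von Neumann algebras\<close>

text \<open>A Hilbert space given by a carrier set, because the GNS space depends on the trace. The inner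
  product is linear in the first argument. Operators are extensional functions on the carrier, so
  that equality of operators is equality of functions.\<close>

record 'h hilbert =
  hcarrier :: "'h set"
  hadd :: "'h \<Rightarrow> 'h \<Rightarrow> 'h"
  hscale :: "complex \<Rightarrow> 'h \<Rightarrow> 'h"
  hinner :: "'h \<Rightarrow> 'h \<Rightarrow> complex"

definition hnorm :: "'h hilbert \<Rightarrow> 'h \<Rightarrow> real" where
  "hnorm H \<xi> = sqrt (Re (hinner H \<xi> \<xi>))"

definition bounded_ops :: "'h hilbert \<Rightarrow> ('h \<Rightarrow> 'h) set" where
  "bounded_ops H = {T \<in> hcarrier H \<rightarrow>\<^sub>E hcarrier H.
     (\<forall>\<xi>\<in>hcarrier H. \<forall>\<eta>\<in>hcarrier H. T (hadd H \<xi> \<eta>) = hadd H (T \<xi>) (T \<eta>)) \<and>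
     (\<forall>c. \<forall>\<xi>\<in>hcarrier H. T (hscale H c \<xi>) = hscale H c (T \<xi>)) \<and>
     (\<exists>B. \<forall>\<xi>\<in>hcarrier H. hnorm H (T \<xi>) \<le> B * hnorm H \<xi>)}"

definition op_norm :: "'h hilbert \<Rightarrow> ('h \<Rightarrow> 'h) \<Rightarrow> real" where
  "op_norm H T = (SUP \<xi>\<in>{\<xi> \<in> hcarrier H. hnorm H \<xi> \<le> 1}. hnorm H (T \<xi>))"

definition op_adj :: "'h hilbert \<Rightarrow> ('h \<Rightarrow> 'h) \<Rightarrow> 'h \<Rightarrow> 'h" where
  "op_adj H T = (THE S. S \<in> bounded_ops H \<and>
     (\<forall>\<xi>\<in>hcarrier H. \<forall>\<eta>\<in>hcarrier H. hinner H (T \<xi>) \<eta> = hinner H \<xi> (S \<eta>)))"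

definition op_id :: "'h hilbert \<Rightarrow> 'h \<Rightarrow> 'h" where
  "op_id H = (\<lambda>\<xi>\<in>hcarrier H. \<xi>)"

definition op_mult :: "'h hilbert \<Rightarrow> ('h \<Rightarrow> 'h) \<Rightarrow> ('h \<Rightarrow> 'h) \<Rightarrow> 'h \<Rightarrow> 'h" where
  "op_mult H S T = compose (hcarrier H) S T"

definition commutant :: "'h hilbert \<Rightarrow> ('h \<Rightarrow> 'h) set \<Rightarrow> ('h \<Rightarrow> 'h) set" where
  "commutant H X = {T \<in> bounded_ops H. \<forall>S\<in>X. op_mult H T S = op_mult H S T}"

definition vN_generated :: "'h hilbert \<Rightarrow> ('h \<Rightarrow> 'h) set \<Rightarrow> ('h \<Rightarrow> 'h) set" where
  "vN_generated H X = commutant H (commutant H (X \<union> op_adj H ` X))"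

definition vN_generating_tuple ::
  "'h hilbert \<Rightarrow> ('h \<Rightarrow> 'h) set \<Rightarrow> real \<Rightarrow> ('j \<Rightarrow> 'h \<Rightarrow> 'h) \<Rightarrow> bool" where
  "vN_generating_tuple H M R x \<longleftrightarrow>
     0 < R \<and> (\<forall>j. x j \<in> M \<and> op_norm H (x j) \<le> R) \<and> vN_generated H (range x) = M"

definition vN_law ::
  "'h hilbert \<Rightarrow> (('h \<Rightarrow> 'h) \<Rightarrow> complex) \<Rightarrow> ('j \<Rightarrow> 'h \<Rightarrow> 'h) \<Rightarrow> 'j ncpoly \<Rightarrow> complex" where
  "vN_law H tr x = nc_law tr (op_id H) (op_mult H) (op_adj H) x"

text \<open>The entropy of a von Neumann algebra on \<open>H\<close> with faithful normal trace \<open>tr\<close>, computed from an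
  \<open>R\<close>-bounded tuple \<open>x\<close> that generates it; again the value does not depend on \<open>R\<close> and \<open>x\<close>.\<close>

definition vN_entropy ::
  "'h hilbert \<Rightarrow> (('h \<Rightarrow> 'h) \<Rightarrow> complex) \<Rightarrow> real \<Rightarrow> ('j \<Rightarrow> 'h \<Rightarrow> 'h) \<Rightarrow> ereal" where
  "vN_entropy H tr R x = entropy1 R {vN_law H tr x}"


section \<open>The GNS representation of a trace\<close>

definition norm2 :: "('a::cstar_algebra \<Rightarrow> complex) \<Rightarrow> 'a \<Rightarrow> real" where
  "norm2 \<tau> x = sqrt (Re (\<tau> (star x * x)))"

definition Cauchy2 :: "('a::cstar_algebra \<Rightarrow> complex) \<Rightarrow> (nat \<Rightarrow> 'a) \<Rightarrow> bool" where
  "Cauchy2 \<tau> s \<longleftrightarrow> (\<forall>e>0. \<exists>M. \<forall>m\<ge>M. \<forall>n\<ge>M. norm2 \<tau> (s m - s n) < e)"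

text \<open>The GNS space is the completion of \<open>A / {x. \<tau> (x\<^sup>*x) = 0}\<close>: its vectors are the equivalence
  classes of Cauchy sequences for the seminorm \<^term>\<open>norm2 \<tau>\<close>, modulo sequences tending to zero in
  this seminorm. Dividing by the null space and completing are thus done in one step.\<close>

type_synonym 'a gns_vec = "(nat \<Rightarrow> 'a) set"

definition gns_class :: "('a::cstar_algebra \<Rightarrow> complex) \<Rightarrow> (nat \<Rightarrow> 'a) \<Rightarrow> 'a gns_vec" where
  "gns_class \<tau> s = {t. Cauchy2 \<tau> t \<and> (\<lambda>n. norm2 \<tau> (t n - s n)) \<longlonglongrightarrow> 0}"

definition gns_space :: "('a::cstar_algebra \<Rightarrow> complex) \<Rightarrow> 'a gns_vec hilbert" where
  "gns_space \<tau> = \<lparr>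
     hcarrier = gns_class \<tau> ` {s. Cauchy2 \<tau> s},
     hadd = (\<lambda>\<xi> \<eta>. \<Union>s\<in>\<xi>. \<Union>t\<in>\<eta>. gns_class \<tau> (\<lambda>n. s n + t n)),
     hscale = (\<lambda>c \<xi>. \<Union>s\<in>\<xi>. gns_class \<tau> (\<lambda>n. c *\<^sub>C s n)),
     hinner = (\<lambda>\<xi> \<eta>. THE z. \<exists>s\<in>\<xi>. \<exists>t\<in>\<eta>. (\<lambda>n. \<tau> (star (t n) * s n)) \<longlonglongrightarrow> z)\<rparr>"

definition gns_rep :: "('a::cstar_algebra \<Rightarrow> complex) \<Rightarrow> 'a \<Rightarrow> 'a gns_vec \<Rightarrow> 'a gns_vec" where
  "gns_rep \<tau> a = (\<lambda>\<xi>\<in>hcarrier (gns_space \<tau>). \<Union>s\<in>\<xi>. gns_class \<tau> (\<lambda>n. a * s n))"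

definition gns_vacuum :: "('a::cstar_algebra \<Rightarrow> complex) \<Rightarrow> 'a gns_vec" where
  "gns_vacuum \<tau> = gns_class \<tau> (\<lambda>_. 1)"

definition gns_vN :: "('a::cstar_algebra \<Rightarrow> complex) \<Rightarrow> ('a gns_vec \<Rightarrow> 'a gns_vec) set" where
  "gns_vN \<tau> = commutant (gns_space \<tau>) (commutant (gns_space \<tau>) (range (gns_rep \<tau>)))"

text \<open>The canonical faithful normal trace of the von Neumann algebra \<^term>\<open>gns_vN \<tau>\<close> is the vector
  state of the cyclic vector.\<close>

definition gns_trace ::
  "('a::cstar_algebra \<Rightarrow> complex) \<Rightarrow> ('a gns_vec \<Rightarrow> 'a gns_vec) \<Rightarrow> complex" where
  "gns_trace \<tau> T = hinner (gns_space \<tau>) (T (gns_vacuum \<tau>)) (gns_vacuum \<tau>)"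

end

theory Submission
  imports Defs "HOL-Analysis.Elementary_Metric_Spaces"
begin

text \<open>
The theorem combines two facts. The first is that the entropy of a compact set \<open>K\<close> of laws is the
supremum of the entropies of its points. Indeed, if every point of \<open>K\<close> has a neighbourhood with
growth rate below \<open>\<beta>\<close>, then finitely many of these neighbourhoods cover \<open>K\<close>, the covering number
over their union is at most the sum of their covering numbers, and a finite sum of quantities bounded
by \<open>exp (\<beta> N\<^sup>2)\<close> still has growth rate at most \<open>\<beta>\<close> (\<open>entropy1_compact\<close>). The traces of a C*-algebra
form a weak-* compact set, and so do their laws (\<open>compact_trace_laws\<close>). Hence \<open>h(\<A>)\<close> is the
supremum over the traces \<open>\<tau>\<close> of the entropy of the single law of \<open>a\<close> under \<open>\<tau>\<close>.

The second is that this entropy equals \<open>h(M\<^sub>\<tau>)\<close>, computed from any other generating tuple \<open>x\<close> of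
\<open>M\<^sub>\<tau>\<close> (\<open>trace_law_entropy\<close>). Both tuples are seen as the two halves of one tuple, whose law is a
tracial positive functional on the polynomials in all the variables. Each variable of one half is a
limit, in the 2-norm of this functional, of polynomials in the other half: the closure of the vectors
\<open>Q(x)\<Omega>\<close> is invariant under the generated von Neumann algebra, because the orthogonal projection onto
it lies in the commutant (\<open>double_commutant_invariant\<close>, \<open>law_approx\<close>).

From then on only the functional matters (\<open>entropy1_mono_of_approx\<close>). Let \<open>P\<close> be polynomials with
\<open>P(x) \<approx> y\<close> and \<open>Q\<close> polynomials with \<open>Q(y) \<approx> x\<close>. Then \<open>A \<mapsto> P(A)\<close> maps microstates of \<open>x\<close> to
microstates of \<open>y\<close>, and \<open>Q(P(A)) \<approx> A\<close>; polynomials are Lipschitz for the 2-norm on bounded sets and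
commute with unitary conjugation, so an orbit cover for \<open>y\<close> yields one for \<open>x\<close> of no larger
cardinality.

The point that needs care is that \<open>P(A)\<close> has to satisfy the operator norm bound prescribed for the
microstates of \<open>y\<close>, for every bounded tuple \<open>A\<close> of matrices, whereas approximation in the 2-norm gives no
control of operator norms. This is Kaplansky's density theorem, proved here in a form that yields
polynomials (\<open>cutoff_density\<close>): the function \<open>t \<mapsto> 2t / (1 + t\<^sup>2)\<close> takes every element to the unit
ball, is continuous for the 2-norm independently of operator norms, and has an inverse on
the unit ball. Truncating the geometric series for \<open>(1 + z\<^sup>*z)\<^sup>-\<^sup>1\<close> turns it into a polynomial, with a
bound that holds for all positive functionals for which the variables are bounded; applied to vector
states of matrix tuples this is the bound on \<open>P(A)\<close>.

In the GNS space one has to know that the vector state of the cyclic vector is a trace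
on \<open>M\<^sub>\<tau>\<close>. Right multiplications lie in the commutant of the representation, and this gives
\<open>T\<^sup>*\<Omega> = lim s\<^sub>n\<^sup>*\<Omega>\<close> whenever \<open>T\<Omega> = lim s\<^sub>n\<Omega>\<close>, from which the trace property
passes to the limit (\<open>adj_vac\<close>, \<open>gns_trace_comm\<close>).
\<close>

section \<open>Positive functionals on *-algebras\<close>

text \<open>The discriminant estimate behind the Cauchy-Schwarz inequality, where \<open>B\<close> is the squared modulus of
an inner product, the phase being absorbed into the vector. Including \<open>D = 0\<close> makes it
applicable to degenerate forms.\<close>

lemma quadratic_nonneg_bound:
  fixes A B D :: real
  assumes t: "\<And>t. 0 \<le> A - 2 * t * B + t\<^sup>2 * B * D" and D: "0 \<le> D"
  shows "B \<le> A * D"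
proof (cases "D = 0")
  case True
  have "B \<le> 0"
  proof (rule ccontr)
    assume "\<not> B \<le> 0"
    then have "2 * ((A + 1) / (2 * B)) * B = A + 1" by simp
    with t[of "(A + 1) / (2 * B)"] True show False by simp
  qed
  with True show ?thesis by simp
next
  case False
  then have "(1 / D)\<^sup>2 * B * D = B / D" by (simp add: power2_eq_square)
  with t[of "1 / D"] have "B / D \<le> A" by simp
  then show ?thesis using False D by (simp add: divide_le_eq)
qed

text \<open>The scalar \<open>sc c\<close> plays the role of \<open>c \<cdot> 1\<close>. In this form C*-algebras and the algebra of
noncommutative polynomials are instances, so that one theory of positive functionals serves both.\<close>

locale star_algebra =
  fixes st :: "'b::ring_1 \<Rightarrow> 'b" and sc :: "complex \<Rightarrow> 'b"
  assumes st_st [simp]: "st (st x) = x"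
    and st_add: "st (x + y) = st x + st y"
    and st_mult: "st (x * y) = st y * st x"
    and st_sc: "st (sc c) = sc (cnj c)"
    and sc_add: "sc (c + d) = sc c + sc d"
    and sc_mult: "sc (c * d) = sc c * sc d"
    and sc_1 [simp]: "sc 1 = 1"
    and sc_comm: "x * sc c = sc c * x"
begin

lemma st_0 [simp]: "st 0 = 0"
  using st_add[of 0 0] by simp

lemma st_minus: "st (- x) = - st x"
  using st_add[of x "- x"] by (simp add: eq_neg_iff_add_eq_0 add.commute)

lemma st_diff: "st (x - y) = st x - st y"
  using st_add[of x "- y"] by (simp add: st_minus)

lemma st_1 [simp]: "st 1 = 1"
  using st_sc[of 1] by simp

lemma sc_0 [simp]: "sc 0 = 0"
  using sc_add[of 0 0] by simp

lemma sc_minus: "sc (- c) = - sc c"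
  using sc_add[of c "- c"] by (simp add: eq_neg_iff_add_eq_0 add.commute)

lemma sc_diff: "sc (c - d) = sc c - sc d"
  using sc_add[of c "- d"] by (simp add: sc_minus)

lemma sc_left_comm: "x * (sc c * y) = sc c * (x * y)"
  by (metis mult.assoc sc_comm)

end

locale positive_functional = star_algebra st sc
  for st :: "'b::ring_1 \<Rightarrow> 'b" and sc +
  fixes \<phi> :: "'b \<Rightarrow> complex"
  assumes \<phi>_add: "\<phi> (x + y) = \<phi> x + \<phi> y"
    and \<phi>_sc: "\<phi> (sc c * x) = c * \<phi> x"
    and \<phi>_pos: "\<phi> (st x * x) \<in> \<real>\<^sub>\<ge>\<^sub>0"
begin

lemma \<phi>_0 [simp]: "\<phi> 0 = 0"
  using \<phi>_sc[of 0 0] by simp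

lemma \<phi>_minus: "\<phi> (- x) = - \<phi> x"
  using \<phi>_sc[of "-1" x] by (simp add: sc_minus)

lemma \<phi>_diff: "\<phi> (x - y) = \<phi> x - \<phi> y"
  using \<phi>_add[of x "- y"] by (simp add: \<phi>_minus)

definition nrm :: "'b \<Rightarrow> real" where
  "nrm x = sqrt (Re (\<phi> (st x * x)))"

lemma Re_\<phi>_ge0: "0 \<le> Re (\<phi> (st x * x))"
  using \<phi>_pos[of x] complex_nonneg_Reals_iff by blast

lemma Im_\<phi>_pos: "Im (\<phi> (st x * x)) = 0"
  using \<phi>_pos[of x] complex_nonneg_Reals_iff by blast

lemma nrm_ge0 [simp]: "0 \<le> nrm x"
  by (simp add: nrm_def Re_\<phi>_ge0)

lemma nrm_sq: "(nrm x)\<^sup>2 = Re (\<phi> (st x * x))"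
  by (simp add: nrm_def Re_\<phi>_ge0)

lemma \<phi>_sq: "\<phi> (st x * x) = complex_of_real ((nrm x)\<^sup>2)"
  by (simp add: nrm_sq complex_eq_iff Im_\<phi>_pos)

lemma nrm_0 [simp]: "nrm 0 = 0"
  by (simp add: nrm_def)

lemma nrm_1: "nrm 1 = sqrt (Re (\<phi> 1))"
  by (simp add: nrm_def)

lemma \<phi>_sesq_scale: "\<phi> (st (sc c * x) * (sc d * y)) = cnj c * d * \<phi> (st x * y)"
proof -
  have "st (sc c * x) * (sc d * y) = sc (cnj c) * (sc d * (st x * y))"
    by (simp only: st_mult st_sc mult.assoc sc_left_comm[of "st x"])
  then show ?thesis by (simp only: \<phi>_sc mult.assoc)
qed

lemma \<phi>_scale_left: "\<phi> (st (sc c * x) * y) = cnj c * \<phi> (st x * y)"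
  using \<phi>_sesq_scale[of c x 1 y] by simp

lemma \<phi>_scale_right: "\<phi> (st x * (sc c * y)) = c * \<phi> (st x * y)"
  using \<phi>_sesq_scale[of 1 x c y] by simp

lemma nrm_sc: "nrm (sc c * x) = cmod c * nrm x"
proof -
  have "\<phi> (st (sc c * x) * (sc c * x)) = complex_of_real ((cmod c)\<^sup>2) * \<phi> (st x * x)"
    unfolding \<phi>_sesq_scale complex_norm_square by (simp add: mult.commute)
  then have "(nrm (sc c * x))\<^sup>2 = (cmod c * nrm x)\<^sup>2"
    by (simp only: nrm_sq power_mult_distrib) simp
  then show ?thesis
    by (metis abs_of_nonneg nrm_ge0 power2_eq_iff_nonneg mult_nonneg_nonneg norm_ge_zero)
qed

lemma nrm_minus: "nrm (- x) = nrm x"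
  by (simp add: nrm_def st_minus)

lemma nrm_minus_commute: "nrm (x - y) = nrm (y - x)"
  using nrm_minus[of "x - y"] by simp

text \<open>Polarization: a form whose diagonal is real is hermitian.\<close>

lemma \<phi>_hermitian: "\<phi> (st y * x) = cnj (\<phi> (st x * y))"
proof -
  have e: "\<phi> (st (sc c * x + y) * (sc c * x + y)) =
      \<phi> (st (sc c * x) * (sc c * x)) + cnj c * \<phi> (st x * y) + c * \<phi> (st y * x) + \<phi> (st y * y)" for c
    by (simp add: st_add algebra_simps \<phi>_add \<phi>_scale_left \<phi>_scale_right)
  have "Im (cnj c * \<phi> (st x * y) + c * \<phi> (st y * x)) = 0" for c
    using arg_cong[OF e[of c], of Im] by (simp add: Im_\<phi>_pos)
  from this[of 1] this[of \<i>] show ?thesis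
    by (simp add: complex_eq_iff)
qed

lemma Cauchy_Schwarz: "cmod (\<phi> (st y * x)) \<le> nrm x * nrm y"
proof -
  define b where "b = \<phi> (st y * x)"
  have exp: "(nrm (x + sc (- (t * b)) * y))\<^sup>2 = (nrm x)\<^sup>2 - 2 * t * (cmod b)\<^sup>2 + t\<^sup>2 * (cmod b)\<^sup>2 * (nrm y)\<^sup>2"
    for t :: real
  proof -
    let ?c = "- (complex_of_real t * b)"
    have xy: "\<phi> (st x * y) = cnj b"
      unfolding b_def by (simp add: \<phi>_hermitian[of y x])
    have "\<phi> (st (x + sc ?c * y) * (x + sc ?c * y))
        = \<phi> (st x * x) + ?c * \<phi> (st x * y) + cnj ?c * \<phi> (st y * x) + cnj ?c * ?c * \<phi> (st y * y)"
      by (simp add: st_add algebra_simps \<phi>_add \<phi>_scale_left \<phi>_scale_right \<phi>_sesq_scale)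
    also have "\<dots> = complex_of_real ((nrm x)\<^sup>2 - 2 * t * (cmod b)\<^sup>2 + t\<^sup>2 * (cmod b)\<^sup>2 * (nrm y)\<^sup>2)"
      unfolding xy b_def[symmetric] \<phi>_sq of_real_add of_real_diff of_real_mult complex_norm_square[of b]
      by (simp add: algebra_simps power2_eq_square)
    finally show ?thesis by (simp only: nrm_sq Re_complex_of_real)
  qed
  have "(cmod b)\<^sup>2 \<le> (nrm x)\<^sup>2 * (nrm y)\<^sup>2"
    by (rule quadratic_nonneg_bound) (simp_all flip: exp)
  then show ?thesis
    unfolding b_def by (metis power_mult_distrib power2_le_imp_le mult_nonneg_nonneg nrm_ge0)
qed

lemma nrm_add_sq: "(nrm (x + y))\<^sup>2 = (nrm x)\<^sup>2 + (nrm y)\<^sup>2 + 2 * Re (\<phi> (st x * y))"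
  unfolding nrm_sq st_add distrib_left distrib_right \<phi>_add
  by (simp add: \<phi>_hermitian[of y x])

lemma nrm_diff_sq: "(nrm (x - y))\<^sup>2 = (nrm x)\<^sup>2 + (nrm y)\<^sup>2 - 2 * Re (\<phi> (st x * y))"
  using nrm_add_sq[of x "- y"] by (simp add: nrm_minus \<phi>_minus)

lemma nrm_triangle: "nrm (x + y) \<le> nrm x + nrm y"
proof -
  have "(nrm (x + y))\<^sup>2 \<le> (nrm x)\<^sup>2 + (nrm y)\<^sup>2 + 2 * (nrm x * nrm y)"
    using Cauchy_Schwarz[of x y] complex_Re_le_cmod[of "\<phi> (st x * y)"]
    unfolding nrm_add_sq by (simp add: mult.commute)
  also have "\<dots> = (nrm x + nrm y)\<^sup>2"
    by (simp add: power2_eq_square algebra_simps)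
  finally show ?thesis by (meson add_nonneg_nonneg nrm_ge0 power2_le_imp_le)
qed

lemma nrm_triangle_diff: "nrm (x - y) \<le> nrm x + nrm y"
  using nrm_triangle[of x "- y"] by (simp add: nrm_minus)

lemma nrm_triangle_sub: "nrm (x - z) \<le> nrm (x - y) + nrm (y - z)"
  using nrm_triangle[of "x - y" "y - z"] by simp

lemma abs_nrm_diff: "\<bar>nrm x - nrm y\<bar> \<le> nrm (x - y)"
  using nrm_triangle[of "x - y" y] nrm_triangle[of "y - x" x] nrm_minus_commute[of x y] by auto

text \<open>The smallest such \<open>C\<close> is the operator norm of \<open>x\<close> in the GNS representation of the functional,
computed on the dense image of the algebra.\<close>

definition bdd :: "real \<Rightarrow> 'b \<Rightarrow> bool" where
  "bdd C x \<longleftrightarrow> 0 \<le> C \<and> (\<forall>q. nrm (x * q) \<le> C * nrm q)"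

lemma bddI: "0 \<le> C \<Longrightarrow> (\<And>q. nrm (x * q) \<le> C * nrm q) \<Longrightarrow> bdd C x"
  by (simp add: bdd_def)

lemma bdd_ge0: "bdd C x \<Longrightarrow> 0 \<le> C"
  by (simp add: bdd_def)

lemma bddD: "bdd C x \<Longrightarrow> nrm (x * q) \<le> C * nrm q"
  by (simp add: bdd_def)

lemma bdd_mono: "bdd C x \<Longrightarrow> C \<le> D \<Longrightarrow> bdd D x"
  unfolding bdd_def by (meson mult_right_mono nrm_ge0 order_trans)

lemma bdd_add: "bdd C x \<Longrightarrow> bdd D y \<Longrightarrow> bdd (C + D) (x + y)"
  unfolding bdd_def distrib_right
  by (auto intro!: add_nonneg_nonneg order_trans[OF nrm_triangle] add_mono)

lemma bdd_minus: "bdd C x \<Longrightarrow> bdd C (- x)"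
  by (simp add: bdd_def nrm_minus)

lemma bdd_diff: "bdd C x \<Longrightarrow> bdd D y \<Longrightarrow> bdd (C + D) (x - y)"
  using bdd_add[of C x D "- y"] by (simp add: bdd_minus)

lemma bdd_mult:
  assumes x: "bdd C x" and y: "bdd D y"
  shows "bdd (C * D) (x * y)"
proof (rule bddI)
  show "0 \<le> C * D" using bdd_ge0[OF x] bdd_ge0[OF y] by simp
  fix q
  have "nrm (x * y * q) \<le> C * nrm (y * q)" using bddD[OF x] by (simp add: mult.assoc)
  also have "\<dots> \<le> C * (D * nrm q)" by (intro mult_left_mono bddD[OF y] bdd_ge0[OF x])
  finally show "nrm (x * y * q) \<le> C * D * nrm q" by (simp add: mult.assoc)
qed

lemma bdd_sc: "bdd (cmod c) (sc c)"
  by (simp add: bdd_def nrm_sc)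

lemma bdd_sc_mult: "bdd C x \<Longrightarrow> bdd (cmod c * C) (sc c * x)"
  by (rule bdd_mult[OF bdd_sc])

lemma bdd_0: "bdd 0 0"
  by (simp add: bdd_def)

lemma bdd_1: "bdd 1 1"
  by (simp add: bdd_def)

lemma bdd_power: "bdd C x \<Longrightarrow> bdd (C ^ n) (x ^ n)"
  by (induction n) (auto intro: bdd_1 bdd_mult)

lemma bdd_sum:
  "(\<And>i. i \<in> A \<Longrightarrow> bdd (C i) (f i)) \<Longrightarrow> bdd (\<Sum>i\<in>A. C i) (\<Sum>i\<in>A. f i)"
  by (induction A rule: infinite_finite_induct) (auto intro: bdd_0 bdd_add)

lemma bdd_nrm: "bdd C x \<Longrightarrow> nrm x \<le> C * nrm 1"
  using bddD[of C x 1] by simp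

text \<open>Moving \<open>st x\<close> to the other side of the inner product gives \<open>\<parallel>x\<^sup>*q\<parallel>\<^sup>2 \<le> \<parallel>x(x\<^sup>*q)\<parallel> \<parallel>q\<parallel>\<close>, and one factor
\<open>\<parallel>x\<^sup>*q\<parallel>\<close> cancels.\<close>

lemma bdd_st:
  assumes "bdd C x"
  shows "bdd C (st x)"
proof (rule bddI)
  show "0 \<le> C" using assms by (rule bdd_ge0)
  fix q
  have "(nrm (st x * q))\<^sup>2 = Re (\<phi> (st q * (x * (st x * q))))"
    unfolding nrm_sq by (simp add: st_mult mult.assoc)
  also have "\<dots> \<le> nrm (x * (st x * q)) * nrm q"
    using Cauchy_Schwarz[of q "x * (st x * q)"] complex_Re_le_cmod order_trans by blast
  also have "\<dots> \<le> (C * nrm (st x * q)) * nrm q"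
    by (intro mult_right_mono bddD assms) simp
  finally have "nrm (st x * q) * nrm (st x * q) \<le> nrm (st x * q) * (C * nrm q)"
    by (simp add: power2_eq_square algebra_simps)
  then show "nrm (st x * q) \<le> C * nrm q"
    using nrm_ge0[of "st x * q"] bdd_ge0[OF assms] nrm_ge0[of q]
    by (metis mult_le_cancel_left_pos mult_nonneg_nonneg order_le_less)
qed

end

section \<open>A polynomial cutoff\<close>

context star_algebra
begin

text \<open>The element \<open>2z(1 + z\<^sup>*z)\<^sup>-\<^sup>1\<close> has norm at most \<open>1\<close>. If \<open>z\<close> has norm at most \<open>C\<close>, then
\<open>u = (C\<^sup>2 - z\<^sup>*z) / (1 + C\<^sup>2)\<close> has norm at most \<open>C\<^sup>2 / (1 + C\<^sup>2) < 1\<close>, and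
\<open>1 + z\<^sup>*z = (1 + C\<^sup>2)(1 - u)\<close> is inverted by a geometric series in \<open>u\<close>. Its partial sum
\<open>cut_inv C k z\<close> gives the polynomial \<open>cutoff C k z\<close> in \<open>z\<close> and \<open>z\<^sup>*\<close>, which is close to
\<open>2z(1 + z\<^sup>*z)\<^sup>-\<^sup>1\<close> for large \<open>k\<close>.\<close>

definition cut_rem :: "real \<Rightarrow> 'b \<Rightarrow> 'b" where
  "cut_rem C z = sc (complex_of_real (1 / (1 + C\<^sup>2))) * (sc (complex_of_real (C\<^sup>2)) - st z * z)"

definition cut_inv :: "real \<Rightarrow> nat \<Rightarrow> 'b \<Rightarrow> 'b" where
  "cut_inv C k z = sc (complex_of_real (1 / (1 + C\<^sup>2))) * (\<Sum>i<k. cut_rem C z ^ i)"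

definition cutoff :: "real \<Rightarrow> nat \<Rightarrow> 'b \<Rightarrow> 'b" where
  "cutoff C k z = sc 2 * (z * cut_inv C k z)"

lemma one_minus_mult_geometric: "(1 - u) * (\<Sum>i<k. u ^ i) = 1 - (u::'b) ^ k"
proof (induction k)
  case (Suc k)
  show ?case unfolding sum.lessThan_Suc distrib_left Suc by (simp add: left_diff_distrib)
qed simp

lemma geometric_mult_one_minus: "(\<Sum>i<k. u ^ i) * (1 - u) = 1 - (u::'b) ^ k"
proof (induction k)
  case (Suc k)
  show ?case unfolding sum.lessThan_Suc distrib_right Suc by (simp add: right_diff_distrib power_commutes)
qed simp

lemma one_plus_sq_nz: "complex_of_real (1 + C\<^sup>2) \<noteq> 0"
proof -
  have "1 + C\<^sup>2 \<noteq> 0" using zero_le_power2[of C] by linarith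
  then show ?thesis by (simp only: of_real_eq_0_iff not_False_eq_True)
qed

lemma one_plus_sq: "1 + st z * z = sc (complex_of_real (1 + C\<^sup>2)) * (1 - cut_rem C z)"
proof -
  note nz = one_plus_sq_nz[of C]
  have "sc (complex_of_real (1 + C\<^sup>2)) * cut_rem C z
      = sc (complex_of_real (1 + C\<^sup>2) * complex_of_real (1 / (1 + C\<^sup>2))) * (sc (complex_of_real (C\<^sup>2)) - st z * z)"
    unfolding cut_rem_def sc_mult mult.assoc by simp
  also have "complex_of_real (1 + C\<^sup>2) * complex_of_real (1 / (1 + C\<^sup>2)) = 1"
    using nz by simp
  finally show ?thesis
    by (simp add: right_diff_distrib sc_add)
qed

lemma sc_cancel: "sc (complex_of_real (1 + C\<^sup>2)) * sc (complex_of_real (1 / (1 + C\<^sup>2))) = 1"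
proof -
  note nz = one_plus_sq_nz[of C]
  then show ?thesis unfolding sc_mult[symmetric] by simp
qed

lemma one_plus_sq_cut_inv: "(1 + st z * z) * cut_inv C k z = 1 - cut_rem C z ^ k"
proof -
  have "(1 + st z * z) * cut_inv C k z
      = (sc (complex_of_real (1 + C\<^sup>2)) * sc (complex_of_real (1 / (1 + C\<^sup>2)))) *
        ((1 - cut_rem C z) * (\<Sum>i<k. cut_rem C z ^ i))"
    unfolding one_plus_sq[of z C] cut_inv_def by (simp only: mult.assoc sc_left_comm[of "1 - cut_rem C z"])
  then show ?thesis by (simp only: sc_cancel one_minus_mult_geometric mult_1)
qed

lemma cut_inv_one_plus_sq: "cut_inv C k z * (1 + st z * z) = 1 - cut_rem C z ^ k"
proof -
  have "cut_inv C k z * (1 + st z * z)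
      = (sc (complex_of_real (1 + C\<^sup>2)) * sc (complex_of_real (1 / (1 + C\<^sup>2)))) *
        ((\<Sum>i<k. cut_rem C z ^ i) * (1 - cut_rem C z))"
    unfolding one_plus_sq[of z C] cut_inv_def
    by (simp only: mult.assoc sc_left_comm[of "\<Sum>i<k. cut_rem C z ^ i"]) (metis sc_left_comm)
  then show ?thesis by (simp only: sc_cancel geometric_mult_one_minus mult_1)
qed

lemma cut_inv_rem_commute: "cut_rem C z ^ m * cut_inv C k z = cut_inv C k z * cut_rem C z ^ m"
proof -
  have "cut_rem C z ^ m * (\<Sum>i<k. cut_rem C z ^ i) = (\<Sum>i<k. cut_rem C z ^ i) * cut_rem C z ^ m"
    by (simp add: sum_distrib_left sum_distrib_right power_add[symmetric] add.commute)
  then show ?thesis unfolding cut_inv_def by (simp only: mult.assoc sc_left_comm[of "cut_rem C z ^ m"])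
qed

end

context positive_functional
begin

text \<open>For \<open>t = C\<^sup>2 - z\<^sup>*z\<close> one has \<open>\<parallel>tq\<parallel>\<^sup>2 = C\<^sup>4\<parallel>q\<parallel>\<^sup>2 - 2C\<^sup>2\<parallel>zq\<parallel>\<^sup>2 + \<parallel>z\<^sup>*zq\<parallel>\<^sup>2\<close>, and the last term is at
most \<open>C\<^sup>2\<parallel>zq\<parallel>\<^sup>2\<close>.\<close>

lemma bdd_cut_rem:
  assumes "bdd C z"
  shows "bdd (C\<^sup>2 / (1 + C\<^sup>2)) (cut_rem C z)"
proof -
  have C: "0 \<le> C" using assms by (rule bdd_ge0)
  let ?t = "sc (complex_of_real (C\<^sup>2)) - st z * z"
  have "bdd (C\<^sup>2) ?t"
  proof (rule bddI)
    show "0 \<le> C\<^sup>2" by simp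
    fix q
    let ?s = "sc (complex_of_real (C\<^sup>2)) * q"
    have tq: "?t * q = ?s - st z * (z * q)" by (simp add: algebra_simps)
    have cr: "Re (\<phi> (st ?s * (st z * (z * q)))) = C\<^sup>2 * (nrm (z * q))\<^sup>2"
      unfolding \<phi>_scale_left nrm_sq by (simp add: st_mult mult.assoc)
    have "(nrm (?t * q))\<^sup>2 = (nrm ?s)\<^sup>2 - 2 * Re (\<phi> (st ?s * (st z * (z * q)))) + (nrm (st z * (z * q)))\<^sup>2"
      unfolding tq nrm_diff_sq by simp
    also have "\<dots> = C^4 * (nrm q)\<^sup>2 - 2 * C\<^sup>2 * (nrm (z * q))\<^sup>2 + (nrm (st z * (z * q)))\<^sup>2"
      unfolding cr nrm_sc by (simp add: power_mult_distrib norm_power)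
    also have "\<dots> \<le> C^4 * (nrm q)\<^sup>2 - 2 * C\<^sup>2 * (nrm (z * q))\<^sup>2 + (C * nrm (z * q))\<^sup>2"
      using bddD[OF bdd_st[OF assms], of "z * q"] by (simp add: power_mono)
    also have "\<dots> \<le> (C\<^sup>2 * nrm q)\<^sup>2"
      by (simp add: power_mult_distrib flip: power_mult)
    finally show "nrm (?t * q) \<le> C\<^sup>2 * nrm q"
      by (rule power2_le_imp_le) simp
  qed
  from bdd_sc_mult[OF this, of "complex_of_real (1 / (1 + C\<^sup>2))"]
  show ?thesis
    unfolding cut_rem_def norm_of_real by (simp add: add_nonneg_nonneg)
qed

lemma nrm_one_plus_sq: "(nrm ((1 + st z * z) * q))\<^sup>2 = (nrm q)\<^sup>2 + 2 * (nrm (z * q))\<^sup>2 + (nrm (st z * (z * q)))\<^sup>2"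
proof -
  have "(1 + st z * z) * q = q + st z * (z * q)" by (simp add: algebra_simps)
  moreover have "\<phi> (st q * (st z * (z * q))) = complex_of_real ((nrm (z * q))\<^sup>2)"
    using \<phi>_sq[of "z * q"] by (simp only: st_mult mult.assoc)
  ultimately show ?thesis by (simp add: nrm_add_sq)
qed

lemma bdd_one_minus_rem_power:
  assumes "bdd C z"
  shows "bdd (1 + (C\<^sup>2 / (1 + C\<^sup>2)) ^ k) (1 - cut_rem C z ^ k)"
  by (intro bdd_diff bdd_1 bdd_power bdd_cut_rem assms)

text \<open>Since \<open>\<parallel>(1 + z\<^sup>*z)r\<parallel> \<ge> \<parallel>r\<parallel>\<close>, an approximate right inverse of \<open>1 + z\<^sup>*z\<close> is bounded.\<close>

lemma bdd_cut_inv: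
  assumes "bdd C z"
  shows "bdd (1 + (C\<^sup>2 / (1 + C\<^sup>2)) ^ k) (cut_inv C k z)"
proof (rule bddI)
  show "0 \<le> 1 + (C\<^sup>2 / (1 + C\<^sup>2)) ^ k" by simp
  fix q
  have "(nrm (cut_inv C k z * q))\<^sup>2 \<le> (nrm ((1 + st z * z) * (cut_inv C k z * q)))\<^sup>2"
    unfolding nrm_one_plus_sq by simp
  then have "nrm (cut_inv C k z * q) \<le> nrm ((1 + st z * z) * (cut_inv C k z * q))"
    by (rule power2_le_imp_le) simp
  also have "\<dots> = nrm ((1 - cut_rem C z ^ k) * q)"
    by (simp add: mult.assoc[symmetric] one_plus_sq_cut_inv)
  also have "\<dots> \<le> (1 + (C\<^sup>2 / (1 + C\<^sup>2)) ^ k) * nrm q"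
    by (rule bddD[OF bdd_one_minus_rem_power[OF assms]])
  finally show "nrm (cut_inv C k z * q) \<le> (1 + (C\<^sup>2 / (1 + C\<^sup>2)) ^ k) * nrm q" .
qed

text \<open>The inequality \<open>4t\<^sup>2 \<le> (1 + t\<^sup>2)\<^sup>2\<close> becomes \<open>4\<parallel>zr\<parallel>\<^sup>2 \<le> \<parallel>(1 + z\<^sup>*z)r\<parallel>\<^sup>2\<close>, the difference being
\<open>\<parallel>(1 - z\<^sup>*z)r\<parallel>\<^sup>2\<close>. Apart from a factor tending to \<open>1\<close> the bound is independent of \<open>C\<close>.\<close>

lemma bdd_cutoff:
  assumes "bdd C z"
  shows "bdd (1 + (C\<^sup>2 / (1 + C\<^sup>2)) ^ k) (cutoff C k z)"
proof (rule bddI)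
  show "0 \<le> 1 + (C\<^sup>2 / (1 + C\<^sup>2)) ^ k" by simp
  fix q
  define r where "r = cut_inv C k z * q"
  have "0 \<le> (nrm (r - st z * (z * r)))\<^sup>2" by simp
  also have "\<dots> = (nrm r)\<^sup>2 - 2 * (nrm (z * r))\<^sup>2 + (nrm (st z * (z * r)))\<^sup>2"
  proof -
    have "\<phi> (st r * (st z * (z * r))) = complex_of_real ((nrm (z * r))\<^sup>2)"
      using \<phi>_sq[of "z * r"] by (simp only: st_mult mult.assoc)
    then show ?thesis unfolding nrm_diff_sq by simp
  qed
  finally have "(nrm (sc 2 * (z * r)))\<^sup>2 \<le> (nrm ((1 + st z * z) * r))\<^sup>2"
    unfolding nrm_one_plus_sq nrm_sc by (simp add: power_mult_distrib)
  then have "nrm (sc 2 * (z * r)) \<le> nrm ((1 + st z * z) * r)"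
    by (rule power2_le_imp_le) simp
  also have "\<dots> = nrm ((1 - cut_rem C z ^ k) * q)"
    by (simp add: r_def mult.assoc[symmetric] one_plus_sq_cut_inv)
  also have "\<dots> \<le> (1 + (C\<^sup>2 / (1 + C\<^sup>2)) ^ k) * nrm q"
    by (rule bddD[OF bdd_one_minus_rem_power[OF assms]])
  finally show "nrm (cutoff C k z * q) \<le> (1 + (C\<^sup>2 / (1 + C\<^sup>2)) ^ k) * nrm q"
    by (simp add: cutoff_def r_def mult.assoc)
qed

end


section \<open>Tracial functionals and a density theorem\<close>

locale tracial_functional = positive_functional +
  assumes \<phi>_comm: "\<phi> (x * y) = \<phi> (y * x)" and \<phi>_1: "\<phi> 1 = 1"
begin

lemma nrm_st: "nrm (st x) = nrm x"
  by (simp add: nrm_def \<phi>_comm[of x])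

lemma nrm_one [simp]: "nrm 1 = 1"
  by (simp add: nrm_1 \<phi>_1)

lemma bdd_nrm_le: "bdd C x \<Longrightarrow> nrm x \<le> C"
  using bdd_nrm by fastforce

text \<open>Under a trace the adjoint is isometric and exchanges left and right multiplication, so a bound for
one is a bound for the other.\<close>

lemma nrm_mult_bdd:
  assumes "bdd C x" shows "nrm (y * x) \<le> C * nrm y"
  using bddD[OF bdd_st[OF assms], of "st y"] nrm_st[of "y * x"] by (simp add: st_mult nrm_st)

lemma \<phi>_le_nrm: "cmod (\<phi> x) \<le> nrm x"
  using Cauchy_Schwarz[of 1 x] by simp

end

definition (in star_algebra) subalgebra :: "'b set \<Rightarrow> bool" where
  "subalgebra D \<longleftrightarrow> 1 \<in> D \<and> (\<forall>x\<in>D. \<forall>y\<in>D. x + y \<in> D \<and> x * y \<in> D) \<and> (\<forall>c. \<forall>x\<in>D. sc c * x \<in> D) \<and>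
     (\<forall>x\<in>D. st x \<in> D)"

definition (in positive_functional) approx :: "'b set \<Rightarrow> 'b \<Rightarrow> bool" where
  "approx D x \<longleftrightarrow> (\<forall>e>0. \<exists>z\<in>D. nrm (x - z) < e)"

context tracial_functional
begin

lemma approx_mem: "x \<in> D \<Longrightarrow> approx D x"
  unfolding approx_def by (metis diff_self nrm_0)

lemma approx_add:
  assumes "subalgebra D" "approx D x" "approx D y"
  shows "approx D (x + y)"
  unfolding approx_def
proof (intro allI impI)
  fix e :: real assume "0 < e"
  then obtain a b where ab: "a \<in> D" "nrm (x - a) < e / 2" "b \<in> D" "nrm (y - b) < e / 2"
    using assms(2,3) unfolding approx_def by (meson half_gt_zero)
  have "nrm (x + y - (a + b)) \<le> nrm (x - a) + nrm (y - b)"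
    using nrm_triangle[of "x - a" "y - b"] by (simp add: algebra_simps)
  with ab have "nrm (x + y - (a + b)) < e" by linarith
  moreover have "a + b \<in> D" using assms(1) ab by (simp add: subalgebra_def)
  ultimately show "\<exists>z\<in>D. nrm (x + y - z) < e" by blast
qed

lemma approx_sc:
  assumes "subalgebra D" "approx D x"
  shows "approx D (sc c * x)"
  unfolding approx_def
proof (intro allI impI)
  fix e :: real assume e: "0 < e"
  then have "0 < e / (cmod c + 1)" by (simp add: add_nonneg_pos)
  then obtain a where a: "a \<in> D" "nrm (x - a) < e / (cmod c + 1)"
    using assms(2) unfolding approx_def by meson
  have "nrm (sc c * x - sc c * a) = cmod c * nrm (x - a)"
    by (simp add: nrm_sc flip: right_diff_distrib)
  also have "\<dots> \<le> (cmod c + 1) * nrm (x - a)"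
    by (rule mult_right_mono) auto
  also have "\<dots> < e" using a(2) by (simp add: pos_less_divide_eq add_nonneg_pos mult.commute)
  finally show "\<exists>z\<in>D. nrm (sc c * x - z) < e"
    using assms(1) a(1) by (auto simp: subalgebra_def)
qed

lemma approx_st:
  assumes "subalgebra D" "approx D x"
  shows "approx D (st x)"
  using assms unfolding approx_def subalgebra_def by (metis nrm_st st_diff)

text \<open>The factors have to be approximated one after the other, since the norm of the approximant of
\<open>y\<close> decides how well \<open>x\<close> has to be approximated.\<close>

lemma approx_mult:
  assumes D: "subalgebra D" and xy: "approx D x" "approx D y"
    and x: "bdd B x" and all: "\<And>z. z \<in> D \<Longrightarrow> \<exists>C. bdd C z"
  shows "approx D (x * y)"
  unfolding approx_def
proof (intro allI impI)
  fix e :: real assume e: "0 < e"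
  have B: "0 \<le> B" using x by (rule bdd_ge0)
  then have "0 < e / (2 * (B + 1))" using e by simp
  then obtain b where b: "b \<in> D" "nrm (y - b) < e / (2 * (B + 1))"
    using xy(2) unfolding approx_def by meson
  obtain C where C: "bdd C b" using all b by blast
  then have C0: "0 \<le> C" by (rule bdd_ge0)
  then have "0 < e / (2 * (C + 1))" using e by simp
  then obtain a where a: "a \<in> D" "nrm (x - a) < e / (2 * (C + 1))"
    using xy(1) unfolding approx_def by meson
  have "nrm (x * y - a * b) \<le> nrm (x * (y - b)) + nrm ((x - a) * b)"
    using nrm_triangle[of "x * (y - b)" "(x - a) * b"] by (simp add: algebra_simps)
  also have "\<dots> \<le> B * nrm (y - b) + C * nrm (x - a)"
    using bddD[OF x] nrm_mult_bdd[OF C] by (meson add_mono)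
  also have "\<dots> \<le> (B + 1) * nrm (y - b) + (C + 1) * nrm (x - a)"
    by (intro add_mono mult_right_mono) auto
  also have "\<dots> < e / 2 + e / 2"
    using a b B C0 by (intro add_strict_mono) (simp_all add: field_simps)
  finally show "\<exists>z\<in>D. nrm (x * y - z) < e"
    using D a b by (auto simp: subalgebra_def)
qed

text \<open>Kaplansky's density theorem. After shrinking \<open>y\<close> slightly to \<open>v\<close>, there is an element \<open>g\<close> in the closure
of \<open>D\<close> with \<open>v\<close> close to \<open>2g(1 + g\<^sup>*g)\<^sup>-\<^sup>1\<close>. For any \<open>z \<in> D\<close> close to \<open>g\<close> in the 2-norm the cutoff \<open>w\<close> of
\<open>z\<close> is then close to \<open>v\<close>, by an estimate that does not involve the norm of \<open>z\<close>: in
\<open>(w - v)(1 + z\<^sup>*z)\<close>, multiplied from the right by the approximate inverse of \<open>1 + z\<^sup>*z\<close>, the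
differences \<open>g - z\<close> stand next to factors of norm at most \<open>2\<close>, and the remaining terms are small. The degree \<open>k\<close> may depend on the norm
of \<open>z\<close>, and the scalar in front of the cutoff normalizes its bound to \<open>1\<close>.\<close>

theorem cutoff_density:
  assumes D: "subalgebra D" and all: "\<And>z. z \<in> D \<Longrightarrow> \<exists>C. bdd C z"
    and y: "approx D y" "bdd 1 y" and e: "0 < e"
  shows "\<exists>z\<in>D. \<forall>C. bdd C z \<longrightarrow>
    (\<exists>k. nrm (y - sc (complex_of_real (1 / (1 + (C\<^sup>2 / (1 + C\<^sup>2)) ^ k))) * cutoff C k z) < e)"
proof -
  define \<theta> where "\<theta> = min (e / 4) (1 / 2)"
  define r where "r = 1 - \<theta>"
  have \<theta>: "0 < \<theta>" "\<theta> \<le> 1 / 2" "\<theta> \<le> e / 4" using e by (auto simp: \<theta>_def)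
  then have r: "0 \<le> r" "r < 1" by (auto simp: r_def)
  define v where "v = sc (complex_of_real r) * y"
  have v: "bdd r v"
    using bdd_sc_mult[OF y(2), of "complex_of_real r"] r by (simp add: v_def)
  have yv: "nrm (y - v) \<le> \<theta>"
  proof -
    have "y - v = sc (complex_of_real \<theta>) * y"
      by (simp add: v_def r_def sc_diff left_diff_distrib)
    then have "nrm (y - v) = \<theta> * nrm y" using \<theta> by (simp add: nrm_sc)
    also have "\<dots> \<le> \<theta> * 1"
      using bdd_nrm_le[OF y(2)] \<theta> by (intro mult_left_mono) auto
    finally show ?thesis by simp
  qed
  \<comment> \<open>The iterates approach a solution of \<open>2g = v(1 + g\<^sup>*g)\<close>, that is, a preimage of \<open>v\<close> under
    \<open>g \<mapsto> 2g(1 + g\<^sup>*g)\<^sup>-\<^sup>1\<close>. The iteration contracts the unit ball by the factor \<open>r = 1 - \<theta>\<close>.\<close>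
  define f where "f = rec_nat (0::'a) (\<lambda>_ g. sc (1 / 2) * (v * (1 + st g * g)))"
  have f0: "f 0 = 0" and fS: "f (Suc n) = sc (1 / 2) * (v * (1 + st (f n) * f n))" for n
    by (simp_all add: f_def)
  have f1: "bdd 1 (f n)" for n
  proof (induction n)
    case 0
    show ?case unfolding f0 by (rule bdd_mono[OF bdd_0]) simp
  next
    case (Suc n)
    have "bdd (cmod (1 / 2) * (r * (1 + 1 * 1))) (f (Suc n))"
      unfolding fS by (intro bdd_sc_mult bdd_mult bdd_add bdd_1 bdd_st v Suc)
    then show ?case by (rule bdd_mono) (use r in simp)
  qed
  have fd: "bdd (r ^ n) (f (Suc n) - f n)" for n
  proof (induction n)
    case 0
    have "bdd (cmod (1 / 2) * (r * (1 + 0 * 0))) (f (Suc 0))"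
      unfolding fS f0 by (intro bdd_sc_mult bdd_mult bdd_add bdd_1 bdd_st v bdd_0)
    then have "bdd 1 (f (Suc 0))" by (rule bdd_mono) (use r in simp)
    then show ?case by (simp add: f0)
  next
    case (Suc n)
    let ?a = "f (Suc n)" and ?b = "f n"
    have "f (Suc (Suc n)) - ?a = sc (1 / 2) * (v * (1 + st ?a * ?a)) - sc (1 / 2) * (v * (1 + st ?b * ?b))"
      by (simp only: fS[of "Suc n"] fS[of n])
    also have "\<dots> = sc (1 / 2) * (v * (st ?a * (?a - ?b) + st (?a - ?b) * ?b))"
      by (simp add: algebra_simps st_diff)
    finally have eq: "f (Suc (Suc n)) - ?a = sc (1 / 2) * (v * (st ?a * (?a - ?b) + st (?a - ?b) * ?b))" .
    have "bdd (cmod (1 / 2) * (r * (1 * r ^ n + r ^ n * 1))) (f (Suc (Suc n)) - ?a)"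
      unfolding eq by (intro bdd_sc_mult bdd_mult bdd_add bdd_st v Suc f1)
    then show ?case by (rule bdd_mono) simp
  qed
  have v_apx: "approx D v" unfolding v_def by (intro approx_sc D y)
  have "approx D 1" using D by (simp add: approx_mem subalgebra_def)
  have f_apx: "approx D (f n)" for n
  proof (induction n)
    case 0
    have "sc 0 * 1 \<in> D" using D unfolding subalgebra_def by blast
    then show ?case unfolding f0 by (simp add: approx_mem)
  next
    case (Suc n)
    have "approx D (st (f n) * f n)"
      by (rule approx_mult[OF D _ Suc bdd_st[OF f1[of n]] all]) (intro approx_st D Suc)
    then have "approx D (1 + st (f n) * f n)"
      using \<open>approx D 1\<close> D by (intro approx_add)
    then have "approx D (v * (1 + st (f n) * f n))"
      by (rule approx_mult[OF D v_apx _ v all])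
    then show ?case unfolding fS by (rule approx_sc[OF D])
  qed
  obtain n where n: "r ^ n < e / 32"
    using real_arch_pow_inv[of "e / 32" r] e r by auto
  define g where "g = f n"
  have "0 < e / 56" using e by simp
  then obtain z where z: "z \<in> D" "nrm (g - z) < e / 56"
    using f_apx[of n] unfolding approx_def g_def by meson
  show ?thesis
  proof (intro bexI[of _ z] allI impI z(1))
    fix C assume C: "bdd C z"
    define \<rho> where "\<rho> = C\<^sup>2 / (1 + C\<^sup>2)"
    have \<rho>: "0 \<le> \<rho>" "\<rho> < 1"
      by (simp_all add: \<rho>_def add_pos_nonneg)
    obtain k where k: "\<rho> ^ k < e / 56"
      using real_arch_pow_inv[of "e / 56" \<rho>] e \<rho> by auto
    have k1: "0 \<le> \<rho> ^ k" "\<rho> ^ k \<le> 1" using \<rho> by (auto intro: power_le_one)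
    define q where "q = cut_inv C k z"
    define w where "w = cutoff C k z"
    define u where "u = cut_rem C z ^ k"
    have u: "bdd (\<rho> ^ k) u"
      unfolding u_def \<rho>_def by (intro bdd_power bdd_cut_rem C)
    have q: "bdd 2 q" unfolding q_def
      by (rule bdd_mono[OF bdd_cut_inv[OF C]]) (use k1 in \<open>simp add: \<rho>_def\<close>)
    have w: "bdd 2 w" unfolding w_def
      by (rule bdd_mono[OF bdd_cutoff[OF C]]) (use k1 in \<open>simp add: \<rho>_def\<close>)
    have wq: "w = sc 2 * (z * q)" by (simp add: w_def q_def cutoff_def)
    have zq: "bdd 1 (z * q)"
    proof -
      have "sc (1 / 2) * w = (sc (1 / 2) * sc 2) * (z * q)" by (simp add: wq mult.assoc)
      also have "sc (1 / 2) * sc 2 = 1" by (simp flip: sc_mult)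
      finally show ?thesis using bdd_sc_mult[OF w, of "1 / 2"] by simp
    qed
    have qh: "q * (1 + st z * z) = 1 - u" and hq: "(1 + st z * z) * q = 1 - u" and uq: "u * q = q * u"
      unfolding q_def u_def
      by (rule cut_inv_one_plus_sq one_plus_sq_cut_inv cut_inv_rem_commute)+
    have gf: "v * (1 + st g * g) = sc 2 * f (Suc n)"
    proof -
      have "sc 2 * f (Suc n) = (sc 2 * sc (1 / 2)) * (v * (1 + st g * g))"
        by (simp only: fS g_def mult.assoc)
      also have "sc 2 * sc (1 / 2) = 1" by (simp flip: sc_mult)
      finally show ?thesis by simp
    qed
    have wh: "w * (1 + st z * z) = sc 2 * z - sc 2 * (z * u)"
      unfolding wq mult.assoc qh by (simp add: right_diff_distrib)
    \<comment> \<open>\<open>u\<close> is small and \<open>(1 + z\<^sup>*z)q = 1 - u\<close>; the second summand is expanded so that \<open>z\<close> occurs only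
      in \<open>zq\<close>, which is bounded, or in a difference with \<open>g\<close>.\<close>
    have "w - v = (w - v) * u + (w - v) * ((1 + st z * z) * q)"
      unfolding hq by (simp add: algebra_simps)
    also have "(w - v) * ((1 + st z * z) * q) = ((w - v) * (1 + st z * z)) * q"
      by (simp only: mult.assoc)
    also have "(w - v) * (1 + st z * z) =
        sc 2 * z - sc 2 * (z * u) - v * (1 + st z * z)"
      unfolding left_diff_distrib wh ..
    also have "\<dots> = sc 2 * (z - g) - sc 2 * (z * u) + sc 2 * (g - f (Suc n))
        + v * (st g * (g - z)) + v * (st (g - z) * z)"
      unfolding right_diff_distrib[of "sc 2"] gf[symmetric] by (simp add: algebra_simps st_diff)
    also have "(\<dots>) * q = sc 2 * ((z - g) * q) - w * u + sc 2 * ((g - f (Suc n)) * q)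
        + v * (st g * ((g - z) * q)) + v * (st (g - z) * (z * q))"
    proof -
      have "sc 2 * (z * u) * q = w * u" unfolding wq by (simp add: mult.assoc uq)
      then show ?thesis by (simp add: distrib_right left_diff_distrib mult.assoc)
    qed
    finally have eq: "w - v = (w - v) * u + (sc 2 * ((z - g) * q) - w * u + sc 2 * ((g - f (Suc n)) * q)
        + v * (st g * ((g - z) * q)) + v * (st (g - z) * (z * q)))" .
    let ?d = "nrm (g - z)"
    have v1: "bdd 1 v" by (rule bdd_mono[OF v]) (use r in simp)
    have t0: "nrm ((w - v) * u) \<le> 3 * \<rho> ^ k"
    proof -
      have "nrm (w - v) \<le> 3"
        using bdd_nrm_le[OF bdd_diff[OF w v1]] by simp
      then have "\<rho> ^ k * nrm (w - v) \<le> \<rho> ^ k * 3" using k1 by (intro mult_left_mono)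
      with nrm_mult_bdd[OF u, of "w - v"] show ?thesis by (simp add: mult.commute)
    qed
    have t1: "nrm (sc 2 * ((z - g) * q)) \<le> 4 * ?d"
      using nrm_mult_bdd[OF q, of "z - g"] nrm_minus_commute[of z g] by (simp add: nrm_sc)
    have t2: "nrm (w * u) \<le> 2 * \<rho> ^ k"
      using nrm_mult_bdd[OF u, of w] mult_left_mono[OF bdd_nrm_le[OF w] k1(1)] by simp
    have t3: "nrm (sc 2 * ((g - f (Suc n)) * q)) \<le> 4 * r ^ n"
    proof -
      have "nrm (g - f (Suc n)) \<le> r ^ n"
        using bdd_nrm_le[OF fd[of n]] nrm_minus_commute[of g "f (Suc n)"] by (simp add: g_def)
      with nrm_mult_bdd[OF q, of "g - f (Suc n)"] show ?thesis by (simp add: nrm_sc)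
    qed
    have t4: "nrm (v * (st g * ((g - z) * q))) \<le> 2 * ?d"
    proof -
      have "nrm (v * (st g * ((g - z) * q))) \<le> 1 * nrm (st g * ((g - z) * q))" by (rule bddD[OF v1])
      also have "nrm (st g * ((g - z) * q)) \<le> 1 * nrm ((g - z) * q)"
        by (rule bddD[OF bdd_st]) (simp add: g_def f1)
      also have "nrm ((g - z) * q) \<le> 2 * ?d" by (rule nrm_mult_bdd[OF q])
      finally show ?thesis by simp
    qed
    have t5: "nrm (v * (st (g - z) * (z * q))) \<le> ?d"
    proof -
      have "nrm (v * (st (g - z) * (z * q))) \<le> 1 * nrm (st (g - z) * (z * q))" by (rule bddD[OF v1])
      also have "nrm (st (g - z) * (z * q)) \<le> 1 * nrm (st (g - z))" by (rule nrm_mult_bdd[OF zq])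
      finally show ?thesis by (simp add: nrm_st)
    qed
    have "nrm (w - v) \<le> nrm ((w - v) * u) + (nrm (sc 2 * ((z - g) * q)) + nrm (w * u)
        + nrm (sc 2 * ((g - f (Suc n)) * q)) + nrm (v * (st g * ((g - z) * q)))
        + nrm (v * (st (g - z) * (z * q))))"
      by (subst eq) (intro order_trans[OF nrm_triangle] add_mono order_refl nrm_triangle_diff)
    also have "\<dots> \<le> 3 * \<rho> ^ k + (4 * ?d + 2 * \<rho> ^ k + 4 * r ^ n + 2 * ?d + ?d)"
      by (intro add_mono t0 t1 t2 t3 t4 t5)
    finally have wv: "nrm (w - v) \<le> 5 * \<rho> ^ k + 7 * ?d + 4 * r ^ n" by simp
    define s where "s = 1 / (1 + \<rho> ^ k)"
    have s: "0 \<le> 1 - s" "1 - s \<le> \<rho> ^ k"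
    proof -
      have "1 - s = \<rho> ^ k / (1 + \<rho> ^ k)"
        using k1 by (simp add: s_def diff_divide_eq_iff)
      moreover have "\<rho> ^ k / (1 + \<rho> ^ k) \<le> \<rho> ^ k"
        using k1 by (simp add: divide_le_eq distrib_left)
      ultimately show "0 \<le> 1 - s" "1 - s \<le> \<rho> ^ k" using k1 by auto
    qed
    have "nrm (w - sc (complex_of_real s) * w) \<le> 2 * \<rho> ^ k"
    proof -
      have "w - sc (complex_of_real s) * w = sc (complex_of_real (1 - s)) * w"
        by (simp add: sc_diff left_diff_distrib)
      then have "nrm (w - sc (complex_of_real s) * w) = (1 - s) * nrm w"
        using s by (simp only: nrm_sc norm_of_real abs_of_nonneg)
      also have "\<dots> \<le> \<rho> ^ k * 2"
        using s k1 bdd_nrm_le[OF w] by (intro mult_mono) auto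
      finally show ?thesis by simp
    qed
    moreover have "nrm (y - sc (complex_of_real s) * w)
        \<le> nrm (y - v) + (nrm (v - w) + nrm (w - sc (complex_of_real s) * w))"
      by (meson add_left_mono nrm_triangle_sub order_trans)
    ultimately have "nrm (y - sc (complex_of_real s) * w) < e"
      using yv wv z(2) k n \<theta> nrm_minus_commute[of v w] by linarith
    then show "\<exists>k. nrm (y - sc (complex_of_real (1 / (1 + (C\<^sup>2 / (1 + C\<^sup>2)) ^ k))) * cutoff C k z) < e"
      unfolding s_def w_def \<rho>_def by blast
  qed
qed

end


section \<open>The algebra of noncommutative *-polynomials\<close>

lemma ncpoly_eq_sum:
  "P = (\<Sum>w\<in>Poly_Mapping.keys P. Poly_Mapping.single w (Poly_Mapping.lookup P w))"
proof (rule poly_mapping_eqI)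
  fix k
  show "Poly_Mapping.lookup P k =
    Poly_Mapping.lookup (\<Sum>w\<in>Poly_Mapping.keys P. Poly_Mapping.single w (Poly_Mapping.lookup P w)) k"
    by (cases "k \<in> Poly_Mapping.keys P")
      (auto simp: lookup_sum lookup_single when_def sum.delta in_keys_iff)
qed

lemma ncpoly_induct [case_names single add]:
  fixes P :: "'i ncpoly"
  assumes single: "\<And>w c. Q (Poly_Mapping.single w c)"
    and add: "\<And>A B. Q A \<Longrightarrow> Q B \<Longrightarrow> Q (A + B)"
  shows "Q P"
proof -
  have 0: "Q 0" using single[of 0 0] by simp
  have "Q (\<Sum>w\<in>K. Poly_Mapping.single w (Poly_Mapping.lookup P w))" if "finite K" for K
    using that by (induction K) (auto intro: 0 single add)
  from this[OF finite_keys, of P] show ?thesis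
    using ncpoly_eq_sum[of P] by simp
qed

lemma letter_star_letter_star [simp]: "letter_star (letter_star l) = l"
  by (cases l) simp_all

lemma word_star_word_star [simp]: "word_star (word_star w) = w"
  by (cases w) (simp add: word_star_def rev_map comp_def)

lemma word_star_plus: "word_star (v + w) = word_star w + word_star v"
  by (simp add: word_star_def plus_ncword_def)

lemma word_star_0 [simp]: "word_star 0 = 0"
  by (simp add: word_star_def zero_ncword_def)

lemma nc_star_single [simp]:
  "nc_star (Poly_Mapping.single w c) = Poly_Mapping.single (word_star w) (cnj c)"
  by (cases "c = 0") (simp_all add: nc_star_def)

lemma nc_star_add: "nc_star (P + Q) = nc_star P + nc_star Q"
  unfolding nc_star_def
  by (rule setsum_keys_plus_distrib) (simp_all add: single_add)

lemma nc_star_mult: "nc_star (P * Q) = nc_star Q * nc_star P"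
proof (induction P rule: ncpoly_induct)
  case (single v c)
  show ?case
  proof (induction Q rule: ncpoly_induct)
    case (single w d)
    then show ?case by (simp add: mult_single word_star_plus mult.commute)
  qed (simp_all add: distrib_left distrib_right nc_star_add)
qed (simp_all add: distrib_left distrib_right nc_star_add)

lemma nc_const_mult_single: "nc_const c * Poly_Mapping.single w d = Poly_Mapping.single w (c * d)"
  by (simp add: nc_const_def mult_single)

interpretation nc: star_algebra nc_star nc_const
proof
  show "nc_star (nc_star P) = P" for P :: "'i ncpoly"
    by (induction P rule: ncpoly_induct) (simp_all add: nc_star_add)
  show "P * nc_const c = nc_const c * P" for c and P :: "'i ncpoly"
    by (induction P rule: ncpoly_induct)
      (simp_all add: nc_const_def mult_single mult.commute distrib_left distrib_right)
qed (simp_all add: nc_star_add nc_star_mult nc_const_def single_add mult_single)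

lemma sum_keys_single:
  assumes "F w 0 = 0"
  shows "(\<Sum>v\<in>Poly_Mapping.keys (Poly_Mapping.single w c). F v (Poly_Mapping.lookup (Poly_Mapping.single w c) v)) = F w c"
  using assms by (cases "c = 0") simp_all

lemma nc_law_single [simp]: "nc_law \<phi> e m s x (Poly_Mapping.single w c) = c * \<phi> (word_value e m s x (letters w))"
  unfolding nc_law_def using sum_keys_single[of "\<lambda>w c. c * \<phi> (word_value e m s x (letters w))"] by simp

lemma nc_law_add: "nc_law \<phi> e m s x (P + Q) = nc_law \<phi> e m s x P + nc_law \<phi> e m s x Q"
  unfolding nc_law_def by (rule setsum_keys_plus_distrib) (simp_all add: algebra_simps)

lemma nc_law_const_mult: "nc_law \<phi> e m s x (nc_const c * P) = c * nc_law \<phi> e m s x P"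
  by (induction P rule: ncpoly_induct) (simp_all add: nc_const_mult_single distrib_left nc_law_add)


abbreviation nc_word :: "('i \<Rightarrow> 'k ncpoly) \<Rightarrow> 'i letter list \<Rightarrow> 'k ncpoly" where
  "nc_word \<equiv> word_value 1 (*) nc_star"

definition nc_subst :: "('i \<Rightarrow> 'k ncpoly) \<Rightarrow> 'i ncpoly \<Rightarrow> 'k ncpoly" where
  "nc_subst f P = (\<Sum>w\<in>Poly_Mapping.keys P. nc_const (Poly_Mapping.lookup P w) * nc_word f (letters w))"

lemma nc_word_append: "nc_word f (v @ w) = nc_word f v * nc_word f w"
proof (induction v)
  case (Cons l v)
  then show ?case by (cases l) (simp_all add: mult.assoc)
qed simp

lemma nc_word_star: "nc_word f (rev (map letter_star w)) = nc_star (nc_word f w)"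
proof (induction w)
  case (Cons l w)
  then show ?case by (cases l) (simp_all add: nc_word_append nc_star_mult)
qed simp

lemma nc_subst_single [simp]: "nc_subst f (Poly_Mapping.single w c) = nc_const c * nc_word f (letters w)"
  unfolding nc_subst_def using sum_keys_single[of "\<lambda>w c. nc_const c * nc_word f (letters w)"] by simp

lemma nc_subst_add: "nc_subst f (P + Q) = nc_subst f P + nc_subst f Q"
  unfolding nc_subst_def by (rule setsum_keys_plus_distrib) (simp_all add: nc.sc_add algebra_simps)

lemma nc_subst_const [simp]: "nc_subst f (nc_const c) = nc_const c"
  unfolding nc_const_def by (simp add: zero_ncword_def nc_const_def)

lemma nc_subst_1 [simp]: "nc_subst f 1 = 1"
  using nc_subst_const[of f 1] by simp

lemma nc_subst_0 [simp]: "nc_subst f 0 = 0"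
  by (simp add: nc_subst_def)

lemma nc_subst_mult: "nc_subst f (P * Q) = nc_subst f P * nc_subst f Q"
proof (induction P rule: ncpoly_induct)
  case (single v c)
  show ?case
  proof (induction Q rule: ncpoly_induct)
    case (single w d)
    show ?case
      by (simp add: mult_single plus_ncword_def nc_word_append nc.sc_mult mult.assoc
          nc.sc_left_comm[of "nc_word f (letters v)"])
  qed (simp_all add: distrib_left distrib_right nc_subst_add)
qed (simp_all add: distrib_left distrib_right nc_subst_add)

lemma nc_subst_minus: "nc_subst f (- P) = - nc_subst f P"
  using nc_subst_add[of f P "- P"] by (simp add: eq_neg_iff_add_eq_0 add.commute)

lemma nc_subst_diff: "nc_subst f (P - Q) = nc_subst f P - nc_subst f Q"
  using nc_subst_add[of f P "- Q"] by (simp add: nc_subst_minus)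

lemma nc_subst_sum: "nc_subst f (\<Sum>i\<in>A. g i) = (\<Sum>i\<in>A. nc_subst f (g i))"
  by (induction A rule: infinite_finite_induct) (simp_all add: nc_subst_add)

lemma nc_subst_power: "nc_subst f (P ^ n) = nc_subst f P ^ n"
  by (induction n) (simp_all add: nc_subst_mult)

lemma nc_subst_star: "nc_subst f (nc_star P) = nc_star (nc_subst f P)"
proof (induction P rule: ncpoly_induct)
  case (single w c)
  show ?case
    by (simp add: nc_star_mult nc.st_sc nc.sc_comm word_star_def nc_word_star)
qed (simp_all add: nc_subst_add nc_star_add)

lemma nc_subst_var [simp]: "nc_subst f (nc_var i) = f i"
  by (simp add: nc_var_def)

lemma nc_subst_nc_word: "nc_subst f (nc_word g w) = nc_word (\<lambda>i. nc_subst f (g i)) w"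
proof (induction w)
  case (Cons l w)
  then show ?case by (cases l) (simp_all add: nc_subst_mult nc_subst_star)
qed simp

lemma nc_subst_subst: "nc_subst f (nc_subst g P) = nc_subst (\<lambda>i. nc_subst f (g i)) P"
  by (induction P rule: ncpoly_induct) (simp_all add: nc_subst_add nc_subst_mult nc_subst_nc_word)

lemma nc_subst_cutoff: "nc_subst f (nc.cutoff C k P) = nc.cutoff C k (nc_subst f P)"
  by (simp add: nc.cutoff_def nc.cut_inv_def nc.cut_rem_def nc_subst_mult nc_subst_sum nc_subst_power
      nc_subst_diff nc_subst_star)

lemma nc_word_var: "nc_word (\<lambda>i. nc_var (p i)) w = Poly_Mapping.single (Word (map (map_letter p) w)) 1"
proof (induction w)
  case Nil
  then show ?case by (simp flip: zero_ncword_def)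
next
  case (Cons l w)
  then show ?case
    by (cases l) (simp_all add: nc_var_def mult_single plus_ncword_def word_star_def)
qed

lemma word_value_map: "word_value e m s x (map (map_letter p) w) = word_value e m s (\<lambda>i. x (p i)) w"
proof (induction w)
  case (Cons l w)
  then show ?case by (cases l) simp_all
qed simp

lemma nc_law_rename: "nc_law \<phi> e m s x (nc_subst (\<lambda>i. nc_var (p i)) P) = nc_law \<phi> e m s (\<lambda>i. x (p i)) P"
  by (induction P rule: ncpoly_induct)
    (simp_all add: nc_subst_add nc_law_add nc_word_var nc_const_mult_single word_value_map)

lemma nc_subst_nc_var [simp]: "nc_subst nc_var P = P"
proof (induction P rule: ncpoly_induct)
  case (single w c)
  have "map (map_letter (\<lambda>i. i)) u = u" for u :: "'a letter list"
    by (simp add: map_idI letter.map_ident)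
  then show ?case using nc_word_var[of "\<lambda>i. i" "letters w"]
    by (simp add: nc_const_mult_single)
qed (simp_all add: nc_subst_add)


section \<open>Bounds for polynomials in bounded elements\<close>

text \<open>A norm bound for \<open>P\<close> at tuples of norm at most \<open>R\<close>, and a Lipschitz constant of \<open>P\<close> for the 2-norm on
tuples of norm at most \<open>M\<close>. Neither depends on the algebra in which the tuples live, in particular not
on the size of matrices.\<close>

definition nc_bound :: "real \<Rightarrow> 'i ncpoly \<Rightarrow> real" where
  "nc_bound R P = (\<Sum>w\<in>Poly_Mapping.keys P. cmod (Poly_Mapping.lookup P w) * R ^ length (letters w))"

definition nc_lip :: "real \<Rightarrow> 'i ncpoly \<Rightarrow> real" where
  "nc_lip M P = (\<Sum>w\<in>Poly_Mapping.keys P. cmod (Poly_Mapping.lookup P w) *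
     (real (length (letters w)) * M ^ length (letters w)))"

definition nc_indets :: "'i ncpoly \<Rightarrow> 'i set" where
  "nc_indets P = (\<Union>w\<in>Poly_Mapping.keys P. set_ncword w)"

lemma finite_nc_indets: "finite (nc_indets P)"
proof -
  have "finite (set_letter l)" for l :: "'i letter" by (cases l) simp_all
  then have "finite (set_ncword w)" for w :: "'i ncword" by (cases w) simp
  then show ?thesis by (simp add: nc_indets_def)
qed

lemma nc_lip_ge0: "0 \<le> M \<Longrightarrow> 0 \<le> nc_lip M P"
  by (simp add: nc_lip_def sum_nonneg)

locale positive_nc_functional = positive_functional nc_star nc_const \<phi> for \<phi> :: "'k ncpoly \<Rightarrow> complex"
begin

lemma bdd_nc_word:
  assumes "\<And>i. bdd R (f i)"
  shows "bdd (R ^ length w) (nc_word f w)"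
proof (induction w)
  case (Cons l w)
  then show ?case by (cases l) (auto intro: bdd_mult bdd_st assms)
qed (simp add: bdd_1)

lemma bdd_nc_subst:
  assumes "\<And>i. bdd R (f i)"
  shows "bdd (nc_bound R P) (nc_subst f P)"
  unfolding nc_subst_def nc_bound_def
  by (intro bdd_sum bdd_sc_mult bdd_nc_word assms)

lemma bdd_nc_bound:
  assumes "\<And>i. bdd R (nc_var i)"
  shows "bdd (nc_bound R P) P"
  using bdd_nc_subst[of R nc_var P] assms by simp

end

locale tracial_nc_functional = tracial_functional nc_star nc_const \<phi> for \<phi> :: "'k ncpoly \<Rightarrow> complex"
begin

sublocale positive_nc_functional ..

text \<open>One letter is exchanged at a time. The letters to the right of the exchanged one act by right
multiplication, so their boundedness is used through the trace.\<close>

lemma nc_word_lipschitz: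
  assumes f: "\<And>i. bdd M (f i)" and g: "\<And>i. bdd M (g i)" and M: "1 \<le> M"
    and \<delta>: "\<And>i. i \<in> \<Union> (set_letter ` set w) \<Longrightarrow> nrm (f i - g i) \<le> \<delta>" and \<delta>0: "0 \<le> \<delta>"
  shows "nrm (nc_word f w - nc_word g w) \<le> real (length w) * M ^ length w * \<delta>"
  using \<delta>
proof (induction w)
  case (Cons l w)
  define n where "n = length w"
  let ?f = "nc_word f w" and ?g = "nc_word g w"
  have IH: "nrm (?f - ?g) \<le> real n * M ^ n * \<delta>"
    unfolding n_def using Cons by simp
  have step: "nrm (a * ?f - b * ?g) \<le> real (Suc n) * M ^ Suc n * \<delta>"
    if "bdd M a" "nrm (a - b) \<le> \<delta>" for a b
  proof -
    have "a * ?f - b * ?g = a * (?f - ?g) + (a - b) * ?g" by (simp add: algebra_simps)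
    then have "nrm (a * ?f - b * ?g) \<le> nrm (a * (?f - ?g)) + nrm ((a - b) * ?g)"
      using nrm_triangle by simp
    also have "\<dots> \<le> M * (real n * M ^ n * \<delta>) + M ^ n * \<delta>"
    proof (rule add_mono)
      show "nrm (a * (?f - ?g)) \<le> M * (real n * M ^ n * \<delta>)"
        using bddD[OF that(1), of "?f - ?g"] mult_left_mono[OF IH, of M] M by linarith
      have "nrm ((a - b) * ?g) \<le> M ^ n * nrm (a - b)"
        unfolding n_def by (rule nrm_mult_bdd[OF bdd_nc_word[OF g]])
      also have "\<dots> \<le> M ^ n * \<delta>" using M that(2) by (intro mult_left_mono) auto
      finally show "nrm ((a - b) * ?g) \<le> M ^ n * \<delta>" .
    qed
    also have "M ^ n * \<delta> \<le> M * M ^ n * \<delta>"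
      using M \<delta>0 by (intro mult_right_mono) (simp_all add: mult_le_cancel_right1)
    finally show ?thesis by (simp add: algebra_simps)
  qed
  show ?case
  proof (cases l)
    case (Gen i)
    then show ?thesis using step[of "f i" "g i"] f Cons.prems[of i] by (simp add: n_def)
  next
    case (GenStar i)
    have "nrm (nc_star (f i) - nc_star (g i)) \<le> \<delta>"
      using Cons.prems[of i] GenStar nrm_st[of "f i - g i"] by (simp add: nc.st_diff)
    with GenStar show ?thesis using step[of "nc_star (f i)" "nc_star (g i)"] bdd_st[OF f[of i]]
      by (simp add: n_def)
  qed
qed simp

lemma nc_subst_lipschitz:
  assumes f: "\<And>i. bdd M (f i)" and g: "\<And>i. bdd M (g i)" and M: "1 \<le> M"
    and \<delta>: "\<And>i. i \<in> nc_indets P \<Longrightarrow> nrm (f i - g i) \<le> \<delta>" and \<delta>0: "0 \<le> \<delta>"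
  shows "nrm (nc_subst f P - nc_subst g P) \<le> nc_lip M P * \<delta>"
proof -
  have nrm_sum: "nrm (\<Sum>w\<in>K. h w) \<le> (\<Sum>w\<in>K. nrm (h w))" for h and K :: "'c set"
  proof (induction K rule: infinite_finite_induct)
    case (insert w K)
    then show ?case using nrm_triangle[of "h w" "\<Sum>w\<in>K. h w"] by simp
  qed simp_all
  have "nc_subst f P - nc_subst g P = (\<Sum>w\<in>Poly_Mapping.keys P. nc_const (Poly_Mapping.lookup P w) *
      (nc_word f (letters w) - nc_word g (letters w)))"
    by (simp add: nc_subst_def sum_subtractf right_diff_distrib)
  then have "nrm (nc_subst f P - nc_subst g P) \<le> (\<Sum>w\<in>Poly_Mapping.keys P. cmod (Poly_Mapping.lookup P w) *
      nrm (nc_word f (letters w) - nc_word g (letters w)))"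
    using nrm_sum by (simp add: nrm_sc[symmetric])
  also have "\<dots> \<le> (\<Sum>w\<in>Poly_Mapping.keys P. cmod (Poly_Mapping.lookup P w) *
      (real (length (letters w)) * M ^ length (letters w) * \<delta>))"
  proof (intro sum_mono mult_left_mono nc_word_lipschitz f g M \<delta>0)
    fix w i assume "w \<in> Poly_Mapping.keys P" "i \<in> \<Union> (set_letter ` set (letters w))"
    then show "nrm (f i - g i) \<le> \<delta>"
      by (intro \<delta>) (cases w, auto simp: nc_indets_def intro!: bexI[of _ w])
  qed simp
  also have "\<dots> = nc_lip M P * \<delta>"
    by (simp add: nc_lip_def sum_distrib_right mult.assoc)
  finally show ?thesis .
qed

text \<open>The moment condition of the law space holds because the trace of an element of norm at most
\<open>S\<^bsup>2k\<^esup>\<close> is at most \<open>S\<^bsup>2k\<^esup>\<close>.\<close>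

lemma subst_in_law_space:
  assumes "\<And>j. bdd S (f j)"
  shows "(\<lambda>P. \<phi> (nc_subst f P)) \<in> law_space S"
proof -
  have S: "0 \<le> S" using bdd_ge0[OF assms] .
  have "Re (\<phi> ((nc_star (f j) * f j) ^ k)) \<le> S ^ (2 * k)" for k j
  proof -
    have "bdd ((S * S) ^ k) ((nc_star (f j) * f j) ^ k)"
      by (intro bdd_power bdd_mult bdd_st assms)
    then have "nrm ((nc_star (f j) * f j) ^ k) \<le> S ^ (2 * k)"
      using bdd_nrm_le by (simp add: power_mult power2_eq_square)
    then show ?thesis
      using \<phi>_le_nrm[of "(nc_star (f j) * f j) ^ k"] complex_Re_le_cmod[of "\<phi> ((nc_star (f j) * f j) ^ k)"]
      by linarith
  qed
  then have "Re (\<phi> (nc_subst f ((nc_star (nc_var j) * nc_var j) ^ k))) \<le> S ^ (2 * k)" for k j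
    by (simp only: nc_subst_power nc_subst_mult nc_subst_star nc_subst_var)
  moreover have "\<phi> (nc_subst f (P * Q)) = \<phi> (nc_subst f (Q * P))" for P Q
    unfolding nc_subst_mult by (rule \<phi>_comm)
  moreover have "\<phi> (nc_subst f (nc_star P * P)) \<in> \<real>\<^sub>\<ge>\<^sub>0" for P
    unfolding nc_subst_mult nc_subst_star by (rule \<phi>_pos)
  moreover have "\<phi> (nc_subst f (nc_const c * P)) = c * \<phi> (nc_subst f P)" for c P
    unfolding nc_subst_mult nc_subst_const by (rule \<phi>_sc)
  moreover have "\<phi> (nc_subst f (P + Q)) = \<phi> (nc_subst f P) + \<phi> (nc_subst f Q)" for P Q
    unfolding nc_subst_add by (rule \<phi>_add)
  moreover have "\<phi> (nc_subst f 1) = 1"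
    unfolding nc_subst_1 by (rule \<phi>_1)
  ultimately show ?thesis
    unfolding law_space_def mem_Collect_eq by blast
qed

end


section \<open>Matrix tuples\<close>

lemma mat_adjoint_dim [simp]: "dim_row (mat_adjoint A) = dim_col A" "dim_col (mat_adjoint A) = dim_row A"
  for A :: "complex mat"
  by (simp_all add: mat_adjoint_def mat_of_rows_def)

lemma mat_adjoint_index:
  fixes A :: "complex mat"
  assumes "i < dim_col A" "j < dim_row A"
  shows "mat_adjoint A $$ (i, j) = cnj (A $$ (j, i))"
  using assms by (simp add: mat_adjoint_def mat_of_rows_def conjugate_complex_def)

lemma mat_adjoint_carrier [simp]:
  "mat_adjoint A \<in> carrier_mat m n \<longleftrightarrow> (A :: complex mat) \<in> carrier_mat n m"
  unfolding carrier_mat_def mem_Collect_eq mat_adjoint_dim by (rule conj_commute)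

lemma mat_adjoint_adjoint [simp]: "mat_adjoint (mat_adjoint A) = (A :: complex mat)"
  by (rule eq_matI) (simp_all add: mat_adjoint_index)

lemma mat_mult_index:
  fixes A B :: "complex mat"
  assumes "A \<in> carrier_mat n m" "B \<in> carrier_mat m k" "i < n" "j < k"
  shows "(A * B) $$ (i, j) = (\<Sum>l<m. A $$ (i, l) * B $$ (l, j))"
  using carrier_matD[OF assms(1)] carrier_matD[OF assms(2)] assms(3,4)
  by (simp add: scalar_prod_def atLeast0LessThan)

lemma mat_vec_index:
  fixes A :: "complex mat"
  assumes "A \<in> carrier_mat n m" "v \<in> carrier_vec m" "i < n"
  shows "(A *\<^sub>v v) $ i = (\<Sum>l<m. A $$ (i, l) * v $ l)"
  using carrier_matD[OF assms(1)] carrier_vecD[OF assms(2)] assms(3)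
  by (simp add: scalar_prod_def atLeast0LessThan)

lemma mat_adjoint_mult:
  fixes A B :: "complex mat"
  assumes "A \<in> carrier_mat n m" "B \<in> carrier_mat m k"
  shows "mat_adjoint (A * B) = mat_adjoint B * mat_adjoint A"
proof (rule eq_matI)
  fix i j assume "i < dim_row (mat_adjoint B * mat_adjoint A)" "j < dim_col (mat_adjoint B * mat_adjoint A)"
  then have ij: "i < k" "j < n" using assms by auto
  have "mat_adjoint (A * B) $$ (i, j) = cnj (\<Sum>l<m. A $$ (j, l) * B $$ (l, i))"
    using assms ij by (subst mat_adjoint_index) (auto simp del: index_mult_mat(1) simp: mat_mult_index[OF assms])
  also have "\<dots> = (\<Sum>l<m. mat_adjoint B $$ (i, l) * mat_adjoint A $$ (l, j))"
    using assms ij by (auto simp: mat_adjoint_index mult.commute intro!: sum.cong)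
  also have "\<dots> = (mat_adjoint B * mat_adjoint A) $$ (i, j)"
    using assms ij by (subst mat_mult_index[of _ k m _ n]) auto
  finally show "mat_adjoint (A * B) $$ (i, j) = (mat_adjoint B * mat_adjoint A) $$ (i, j)" .
qed (use assms in auto)

lemma mat_adjoint_add:
  fixes A B :: "complex mat"
  assumes "A \<in> carrier_mat n m" "B \<in> carrier_mat n m"
  shows "mat_adjoint (A + B) = mat_adjoint A + mat_adjoint B"
  using assms by (intro eq_matI) (auto simp: mat_adjoint_index)

lemma mat_adjoint_smult: "mat_adjoint (c \<cdot>\<^sub>m A) = cnj c \<cdot>\<^sub>m mat_adjoint (A :: complex mat)"
  by (intro eq_matI) (auto simp: mat_adjoint_index)

lemma smult_one: "1 \<cdot>\<^sub>m A = (A :: complex mat)"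
  by (rule eq_matI) simp_all

lemma mat_adjoint_one [simp]: "mat_adjoint (1\<^sub>m n) = (1\<^sub>m n :: complex mat)"
  by (intro eq_matI) (auto simp: mat_adjoint_index)

definition cip :: "complex vec \<Rightarrow> complex vec \<Rightarrow> complex" where
  "cip u v = (\<Sum>i<dim_vec v. u $ i * cnj (v $ i))"

lemma cip_self: "cip v v = complex_of_real ((vec_norm2 v)\<^sup>2)"
  by (simp add: cip_def vec_norm2_def sum_nonneg complex_norm_square del: of_real_power)

lemma cip_adjoint:
  assumes A: "A \<in> carrier_mat n m" and u: "u \<in> carrier_vec m" and v: "v \<in> carrier_vec n"
  shows "cip (A *\<^sub>v u) v = cip u (mat_adjoint A *\<^sub>v v)"
proof -
  have "cip (A *\<^sub>v u) v = (\<Sum>i<n. \<Sum>j<m. A $$ (i, j) * u $ j * cnj (v $ i))"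
    using v by (auto simp: cip_def mat_vec_index[OF A u] sum_distrib_right simp del: index_mult_mat_vec)
  also have "\<dots> = (\<Sum>j<m. \<Sum>i<n. A $$ (i, j) * u $ j * cnj (v $ i))"
    by (rule sum.swap)
  also have "\<dots> = cip u (mat_adjoint A *\<^sub>v v)"
    unfolding cip_def
  proof (rule sum.cong)
    show "{..<m} = {..<dim_vec (mat_adjoint A *\<^sub>v v)}" using A by auto
    fix j assume "j \<in> {..<dim_vec (mat_adjoint A *\<^sub>v v)}"
    then have j: "j < m" using A by auto
    have "(mat_adjoint A *\<^sub>v v) $ j = (\<Sum>i<n. mat_adjoint A $$ (j, i) * v $ i)"
      by (rule mat_vec_index[of _ m]) (use A v j in auto)
    also have "\<dots> = (\<Sum>i<n. cnj (A $$ (i, j)) * v $ i)"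
      using A j by (auto simp: mat_adjoint_index intro!: sum.cong)
    finally show "(\<Sum>i<n. A $$ (i, j) * u $ j * cnj (v $ i)) = u $ j * cnj ((mat_adjoint A *\<^sub>v v) $ j)"
      by (simp add: sum_distrib_left mult.commute mult.left_commute)
  qed
  finally show ?thesis .
qed

lemma cip_add:
  "u \<in> carrier_vec n \<Longrightarrow> v \<in> carrier_vec n \<Longrightarrow> w \<in> carrier_vec n \<Longrightarrow> cip (u + v) w = cip u w + cip v w"
  by (auto simp: cip_def sum.distrib algebra_simps)

lemma cip_smult_mat:
  assumes A: "A \<in> carrier_mat n m" and u: "u \<in> carrier_vec m" and v: "v \<in> carrier_vec n"
  shows "cip ((c \<cdot>\<^sub>m A) *\<^sub>v u) v = c * cip (A *\<^sub>v u) v"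
proof -
  have "((c \<cdot>\<^sub>m A) *\<^sub>v u) $ i = c * (A *\<^sub>v u) $ i" if "i < n" for i
    using that A u by (subst (1 2) mat_vec_index[of _ n m])
      (auto simp: sum_distrib_left mult.assoc intro!: sum.cong)
  then show ?thesis using v by (auto simp: cip_def sum_distrib_left mult.assoc intro!: sum.cong)
qed

lemma vec_norm2_ge0 [simp]: "0 \<le> vec_norm2 v"
  by (simp add: vec_norm2_def sum_nonneg)

lemma vec_norm2_smult: "vec_norm2 (c \<cdot>\<^sub>v v) = cmod c * vec_norm2 v"
  by (simp add: vec_norm2_def norm_mult power_mult_distrib real_sqrt_mult flip: sum_distrib_left)

lemma vec_norm2_eq_0_iff: "vec_norm2 v = 0 \<longleftrightarrow> v = 0\<^sub>v (dim_vec v)"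
  by (auto simp: vec_norm2_def sum_nonneg_eq_0_iff intro: eq_vecI) (metis index_zero_vec(1))

lemma cmod_index_le_vec_norm2: "i < dim_vec v \<Longrightarrow> cmod (v $ i) \<le> vec_norm2 v"
  unfolding vec_norm2_def
  by (rule real_le_rsqrt) (rule member_le_sum[of i "{..<dim_vec v}" "\<lambda>i. (cmod (v $ i))\<^sup>2"], auto)


subsection \<open>The operator norm\<close>

lemma bdd_above_mat_opnorm:
  fixes A :: "complex mat"
  shows "bdd_above ((\<lambda>v. vec_norm2 (A *\<^sub>v v)) ` {v \<in> carrier_vec (dim_col A). vec_norm2 v \<le> 1})"
proof (rule bdd_aboveI2)
  fix v assume v: "v \<in> {v \<in> carrier_vec (dim_col A). vec_norm2 v \<le> 1}"
  have "cmod ((A *\<^sub>v v) $ i) \<le> (\<Sum>j<dim_col A. cmod (A $$ (i, j)))" if "i < dim_row A" for i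
  proof -
    have "(A *\<^sub>v v) $ i = (\<Sum>j<dim_col A. A $$ (i, j) * v $ j)"
      using v that by (intro mat_vec_index[of _ "dim_row A"]) auto
    also have "cmod \<dots> \<le> (\<Sum>j<dim_col A. cmod (A $$ (i, j)) * cmod (v $ j))"
      by (rule order_trans[OF norm_sum]) (simp add: norm_mult)
    also have "\<dots> \<le> (\<Sum>j<dim_col A. cmod (A $$ (i, j)) * 1)"
    proof (intro sum_mono mult_left_mono)
      fix j assume "j \<in> {..<dim_col A}"
      then show "cmod (v $ j) \<le> 1"
        using v cmod_index_le_vec_norm2[of j v] by auto
    qed simp
    finally show ?thesis by simp
  qed
  then show "vec_norm2 (A *\<^sub>v v) \<le> sqrt (\<Sum>i<dim_row A. (\<Sum>j<dim_col A. cmod (A $$ (i, j)))\<^sup>2)"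
    unfolding vec_norm2_def by (intro real_sqrt_le_mono sum_mono2 sum_mono power_mono) (auto intro!: sum_mono power_mono)
qed

lemma vec_norm2_mult_le:
  fixes A :: "complex mat"
  assumes A: "A \<in> carrier_mat n m" and v: "v \<in> carrier_vec m"
  shows "vec_norm2 (A *\<^sub>v v) \<le> mat_opnorm A * vec_norm2 v"
proof (cases "vec_norm2 v = 0")
  case True
  then have "v = 0\<^sub>v m" using v by (auto simp: vec_norm2_eq_0_iff)
  then have "A *\<^sub>v v = 0\<^sub>v n"
    using A by (intro eq_vecI) auto
  then have "vec_norm2 (A *\<^sub>v v) = 0" by (simp add: vec_norm2_def)
  with True show ?thesis by simp
next
  case False
  define c where "c = complex_of_real (1 / vec_norm2 v)"
  have pos: "0 < vec_norm2 v" using False by (simp add: less_le)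
  have "vec_norm2 (A *\<^sub>v (c \<cdot>\<^sub>v v)) \<le> mat_opnorm A"
    unfolding mat_opnorm_def
    by (rule cSUP_upper[OF _ bdd_above_mat_opnorm])
      (use A v pos in \<open>auto simp: vec_norm2_smult c_def norm_divide\<close>)
  also have "A *\<^sub>v (c \<cdot>\<^sub>v v) = c \<cdot>\<^sub>v (A *\<^sub>v v)" by (rule mult_mat_vec[OF A v])
  finally show ?thesis
    using pos by (simp add: vec_norm2_smult c_def norm_divide field_simps)
qed

lemma mat_opnorm_le:
  fixes A :: "complex mat"
  assumes "0 \<le> C" "\<And>v. v \<in> carrier_vec (dim_col A) \<Longrightarrow> vec_norm2 (A *\<^sub>v v) \<le> C * vec_norm2 v"
  shows "mat_opnorm A \<le> C"
  unfolding mat_opnorm_def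
proof (rule cSUP_least)
  show "{v \<in> carrier_vec (dim_col A). vec_norm2 v \<le> 1} \<noteq> {}"
    by (auto intro!: exI[of _ "0\<^sub>v (dim_col A)"] simp: vec_norm2_def)
  fix v assume v: "v \<in> {v \<in> carrier_vec (dim_col A). vec_norm2 v \<le> 1}"
  then have "C * vec_norm2 v \<le> C * 1" using assms(1) by (intro mult_left_mono) auto
  then show "vec_norm2 (A *\<^sub>v v) \<le> C" using assms(2)[of v] v by auto
qed


subsection \<open>Evaluation of polynomials at matrix tuples\<close>

abbreviation mat_word :: "nat \<Rightarrow> ('i \<Rightarrow> complex mat) \<Rightarrow> 'i letter list \<Rightarrow> complex mat" where
  "mat_word N \<equiv> word_value (1\<^sub>m N) (*) mat_adjoint"

text \<open>The matrix is assembled from its entries, because matrices of all sizes share one type and sums over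
the words of \<open>P\<close> would need a zero matrix of the right size.\<close>

definition mat_eval :: "nat \<Rightarrow> ('i \<Rightarrow> complex mat) \<Rightarrow> 'i ncpoly \<Rightarrow> complex mat" where
  "mat_eval N A P = mat N N (\<lambda>rc. nc_law (\<lambda>M. M $$ rc) (1\<^sub>m N) (*) mat_adjoint A P)"

lemma mat_eval_carrier [simp]: "mat_eval N A P \<in> carrier_mat N N"
  by (simp add: mat_eval_def)

lemma mat_eval_dim [simp]: "dim_row (mat_eval N A P) = N" "dim_col (mat_eval N A P) = N"
  by (simp_all add: mat_eval_def)

lemma mat_eval_add: "mat_eval N A (P + Q) = mat_eval N A P + mat_eval N A Q"
  by (rule eq_matI) (simp_all add: mat_eval_def nc_law_add)

lemma mat_eval_const_mult: "mat_eval N A (nc_const c * P) = c \<cdot>\<^sub>m mat_eval N A P"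
  by (rule eq_matI) (simp_all add: mat_eval_def nc_law_const_mult)

lemma mat_eval_diff: "mat_eval N A (P - Q) = mat_eval N A P - mat_eval N A Q"
proof -
  have "mat_eval N A P = mat_eval N A (P - Q) + mat_eval N A Q"
    by (simp flip: mat_eval_add)
  then show ?thesis by (intro eq_matI) auto
qed

lemma mat_eval_rename: "mat_eval N A (nc_subst (\<lambda>i. nc_var (p i)) P) = mat_eval N (\<lambda>i. A (p i)) P"
  by (simp add: mat_eval_def nc_law_rename)

context
  fixes N :: nat and A :: "'i \<Rightarrow> complex mat"
  assumes A: "\<And>i. A i \<in> carrier_mat N N"
begin

lemma mat_word_carrier [simp]: "mat_word N A w \<in> carrier_mat N N"
proof (induction w)
  case (Cons l w)
  then show ?case using A by (cases l) (auto intro!: mult_carrier_mat[of _ N N])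
qed simp

lemma mat_word_dim [simp]: "dim_row (mat_word N A w) = N" "dim_col (mat_word N A w) = N"
  using mat_word_carrier[of w] by (simp_all only: carrier_matD)

lemma mat_eval_single: "mat_eval N A (Poly_Mapping.single w c) = c \<cdot>\<^sub>m mat_word N A (letters w)"
  by (rule eq_matI) (simp_all add: mat_eval_def)

lemma mat_word_append: "mat_word N A (v @ w) = mat_word N A v * mat_word N A w"
proof (induction v)
  case Nil
  show ?case using left_mult_one_mat[OF mat_word_carrier] by simp
next
  case (Cons l v)
  then show ?case
    using A assoc_mult_mat[OF _ mat_word_carrier mat_word_carrier, of _ N v w] by (cases l) simp_all
qed

lemma mat_word_star: "mat_word N A (rev (map letter_star w)) = mat_adjoint (mat_word N A w)"
proof (induction w)
  case (Cons l w)
  have e: "mat_word N A [letter_star l] = mat_adjoint (mat_word N A [l])"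
    using A right_mult_one_mat[of "A _" N N] right_mult_one_mat[of "mat_adjoint (A _)" N N] by (cases l) simp_all
  have "mat_word N A (l # w) = mat_word N A [l] * mat_word N A w"
    using mat_word_append[of "[l]" w] by simp
  then show ?case
    using Cons e by (simp add: mat_word_append mat_adjoint_mult[OF mat_word_carrier mat_word_carrier])
qed simp

lemma mat_eval_mult: "mat_eval N A (P * Q) = mat_eval N A P * mat_eval N A Q"
proof (induction P rule: ncpoly_induct)
  case (single v c)
  show ?case
  proof (induction Q rule: ncpoly_induct)
    case (single w d)
    have "(c \<cdot>\<^sub>m mat_word N A (letters v)) * (d \<cdot>\<^sub>m mat_word N A (letters w)) =
        (c * d) \<cdot>\<^sub>m (mat_word N A (letters v) * mat_word N A (letters w))"
      using mult_smult_assoc_mat[OF mat_word_carrier smult_carrier_mat[OF mat_word_carrier]]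
        mult_smult_distrib[OF mat_word_carrier mat_word_carrier]
      by (intro eq_matI) (auto simp: mult.assoc)
    then show ?case
      by (simp add: mult_single mat_eval_single plus_ncword_def mat_word_append)
  next
    case (add Q1 Q2)
    then show ?case
      by (simp add: distrib_left mat_eval_add mult_add_distrib_mat[OF mat_eval_carrier mat_eval_carrier mat_eval_carrier])
  qed
next
  case (add P1 P2)
  then show ?case
    by (simp add: distrib_right mat_eval_add add_mult_distrib_mat[OF mat_eval_carrier mat_eval_carrier mat_eval_carrier])
qed

lemma mat_eval_star: "mat_eval N A (nc_star P) = mat_adjoint (mat_eval N A P)"
proof (induction P rule: ncpoly_induct)
  case (single w c)
  show ?case
    by (simp add: mat_eval_single mat_adjoint_smult word_star_def mat_word_star)
next
  case (add P Q)
  then show ?case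
    by (simp add: nc_star_add mat_eval_add mat_adjoint_add[OF mat_eval_carrier mat_eval_carrier])
qed

lemma mat_eval_1: "mat_eval N A 1 = 1\<^sub>m N"
  using mat_eval_single[of 0 1] by (simp add: zero_ncword_def[symmetric] smult_one) (simp add: zero_ncword_def)

lemma mat_eval_var: "mat_eval N A (nc_var i) = A i"
  using A[of i] right_mult_one_mat[OF A[of i]] by (simp add: nc_var_def mat_eval_single smult_one)

lemma mat_tr_eq: "M \<in> carrier_mat N N \<Longrightarrow> mat_tr M = (\<Sum>i<N. M $$ (i, i)) / of_nat N"
  by (auto simp: mat_tr_def)

lemma mat_law_eq: "mat_law N A P = mat_tr (mat_eval N A P)"
proof (induction P rule: ncpoly_induct)
  case (single w c)
  show ?case
    using mat_word_carrier[of "letters w"]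
    by (simp add: mat_law_def mat_eval_single mat_tr_eq sum_distrib_left)
next
  case (add P Q)
  then show ?case
    unfolding mat_law_def nc_law_add
    by (simp add: mat_eval_add mat_tr_eq sum.distrib add_divide_distrib)
qed

end

lemma mat_word_mat_eval:
  assumes "\<And>i. A i \<in> carrier_mat N N"
  shows "mat_word N (\<lambda>j. mat_eval N A (f j)) w = mat_eval N A (nc_word f w)"
proof (induction w)
  case (Cons l w)
  then show ?case
    by (cases l) (simp_all add: mat_eval_mult[OF assms] mat_eval_star[OF assms])
qed (simp add: mat_eval_1[OF assms])

text \<open>Taking traces, the law of the tuple \<open>f(A)\<close> is the law of \<open>A\<close> composed with the substitution \<open>f\<close>.\<close>

lemma mat_eval_subst:
  assumes "\<And>i. A i \<in> carrier_mat N N"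
  shows "mat_eval N A (nc_subst f P) = mat_eval N (\<lambda>j. mat_eval N A (f j)) P"
proof (induction P rule: ncpoly_induct)
  case (single w c)
  then show ?case
    by (simp add: mat_eval_const_mult mat_eval_single mat_word_mat_eval[OF assms])
qed (simp add: nc_subst_add mat_eval_add)


subsection \<open>Positivity of vector states and of the trace\<close>

text \<open>Vector states see the operator norm of \<open>P(A)\<close>, the trace sees its 2-norm. Both are positive
functionals on the polynomials, so the bounds of the previous sections apply to either.\<close>

definition vec_state :: "nat \<Rightarrow> ('i \<Rightarrow> complex mat) \<Rightarrow> complex vec \<Rightarrow> 'i ncpoly \<Rightarrow> complex" where
  "vec_state N A v P = cip (mat_eval N A P *\<^sub>v v) v"

lemma vec_state_sq:
  assumes A: "\<And>i. A i \<in> carrier_mat N N" and v: "v \<in> carrier_vec N"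
  shows "vec_state N A v (nc_star P * P) = complex_of_real ((vec_norm2 (mat_eval N A P *\<^sub>v v))\<^sup>2)"
proof -
  let ?X = "mat_eval N A P"
  have "vec_state N A v (nc_star P * P) = cip (mat_adjoint ?X *\<^sub>v (?X *\<^sub>v v)) v"
    unfolding vec_state_def mat_eval_mult[OF A] mat_eval_star[OF A]
    using v by (subst assoc_mult_mat_vec[of _ N N _ N]) auto
  also have "\<dots> = cip (?X *\<^sub>v v) (?X *\<^sub>v v)"
    using cip_adjoint[OF _ mult_mat_vec_carrier[OF mat_eval_carrier v] v, of "mat_adjoint ?X" A P] by simp
  finally show ?thesis by (simp only: cip_self)
qed

lemma positive_vec_state:
  assumes A: "\<And>i. A i \<in> carrier_mat N N" and v: "v \<in> carrier_vec N"
  shows "positive_nc_functional (vec_state N A v)"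
proof unfold_locales
  fix P Q :: "'a ncpoly" and c
  show "vec_state N A v (P + Q) = vec_state N A v P + vec_state N A v Q"
    unfolding vec_state_def mat_eval_add
    using add_mult_distrib_mat_vec[OF mat_eval_carrier mat_eval_carrier v, of A P A Q]
      cip_add[OF mult_mat_vec_carrier[OF mat_eval_carrier v] mult_mat_vec_carrier[OF mat_eval_carrier v] v]
    by simp
  show "vec_state N A v (nc_const c * P) = c * vec_state N A v P"
    unfolding vec_state_def mat_eval_const_mult by (rule cip_smult_mat[OF mat_eval_carrier v v])
  show "vec_state N A v (nc_star P * P) \<in> \<real>\<^sub>\<ge>\<^sub>0"
    unfolding vec_state_sq[OF A v] by simp
qed

lemma vec_state_nrm:
  assumes A: "\<And>i. A i \<in> carrier_mat N N" and v: "v \<in> carrier_vec N"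
  shows "positive_functional.nrm nc_star (vec_state N A v) P = vec_norm2 (mat_eval N A P *\<^sub>v v)"
proof -
  interpret positive_nc_functional "vec_state N A v" by (rule positive_vec_state[OF A v])
  show ?thesis unfolding nrm_def vec_state_sq[OF A v] by simp
qed

lemma mult_unit_vec:
  assumes "(X :: complex mat) \<in> carrier_mat N N" "r < N"
  shows "X *\<^sub>v unit_vec N r = col X r"
proof (rule eq_vecI)
  fix i assume "i < dim_vec (col X r)"
  then have i: "i < N" using assms by auto
  have "(X *\<^sub>v unit_vec N r) $ i = (\<Sum>l<N. X $$ (i, l) * (if l = r then 1 else 0))"
    using assms i by (subst mat_vec_index[of _ N N]) (auto simp: unit_vec_def intro!: sum.cong)
  also have "\<dots> = (\<Sum>l<N. if l = r then X $$ (i, l) else 0)" by (intro sum.cong) auto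
  also have "\<dots> = X $$ (i, r)" using assms by simp
  finally show "(X *\<^sub>v unit_vec N r) $ i = col X r $ i" using assms i by auto
qed (use assms in auto)

lemma mat_law_vec_state:
  assumes A: "\<And>i. A i \<in> carrier_mat N N"
  shows "mat_law N A P = (\<Sum>r<N. vec_state N A (unit_vec N r) P) / of_nat N"
proof -
  have "cip (X *\<^sub>v unit_vec N r) (unit_vec N r) = X $$ (r, r)"
    if "X \<in> carrier_mat N N" "r < N" for X r
  proof -
    have "cip (col X r) (unit_vec N r) = (\<Sum>i<N. if i = r then X $$ (i, r) else 0)"
      unfolding cip_def using that by (intro sum.cong) (auto simp: unit_vec_def)
    then show ?thesis using that by (simp add: mult_unit_vec)
  qed
  then show ?thesis
    by (simp add: mat_law_eq[OF A] mat_tr_eq[OF A] vec_state_def)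
qed

lemma tracial_mat_law:
  assumes A: "\<And>i. A i \<in> carrier_mat N N" and N: "0 < N"
  shows "tracial_nc_functional (mat_law N A)"
proof unfold_locales
  fix P Q :: "'a ncpoly" and c
  show "mat_law N A (P + Q) = mat_law N A P + mat_law N A Q"
    "mat_law N A (nc_const c * P) = c * mat_law N A P"
    by (simp_all add: mat_law_def nc_law_add nc_law_const_mult)
  show "mat_law N A (nc_star P * P) \<in> \<real>\<^sub>\<ge>\<^sub>0"
  proof -
    have "mat_law N A (nc_star P * P) =
        complex_of_real ((\<Sum>r<N. (vec_norm2 (mat_eval N A P *\<^sub>v unit_vec N r))\<^sup>2) / real N)"
      unfolding mat_law_vec_state[OF A] by (simp add: vec_state_sq[OF A])
    then show ?thesis by (simp add: sum_nonneg del: of_real_divide)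
  qed
  show "mat_law N A (P * Q) = mat_law N A (Q * P)"
  proof -
    let ?X = "mat_eval N A P" and ?Y = "mat_eval N A Q"
    have XY: "?X \<in> carrier_mat N N" "?Y \<in> carrier_mat N N" by simp_all
    have "(\<Sum>i<N. (?X * ?Y) $$ (i, i)) = (\<Sum>i<N. \<Sum>l<N. ?X $$ (i, l) * ?Y $$ (l, i))"
      by (intro sum.cong refl) (simp only: lessThan_iff mat_mult_index[OF XY])
    also have "\<dots> = (\<Sum>l<N. \<Sum>i<N. ?X $$ (i, l) * ?Y $$ (l, i))" by (rule sum.swap)
    also have "\<dots> = (\<Sum>l<N. (?Y * ?X) $$ (l, l))"
      by (intro sum.cong refl) (simp only: lessThan_iff mat_mult_index[OF XY(2,1)] mult.commute)
    finally show ?thesis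
      by (simp add: mat_law_eq[OF A] mat_eval_mult[OF A] mat_tr_eq[OF A] mult_carrier_mat[OF XY] mult_carrier_mat[OF XY(2,1)]
          del: index_mult_mat)
  qed
  show "mat_law N A 1 = 1"
    using N by (simp add: mat_law_eq[OF A] mat_eval_1[OF A] mat_tr_eq[OF A])
qed

lemma mat_law_nrm:
  assumes A: "\<And>i. A i \<in> carrier_mat N N" and N: "0 < N"
  shows "positive_functional.nrm nc_star (mat_law N A) P = mat_norm2 (mat_eval N A P)"
proof -
  interpret tracial_nc_functional "mat_law N A" by (rule tracial_mat_law[OF A N])
  show ?thesis unfolding nrm_def mat_norm2_def mat_law_eq[OF A] mat_eval_mult[OF A] mat_eval_star[OF A] ..
qed


lemma bdd_vec_state:
  assumes A: "\<And>i. A i \<in> carrier_mat N N" and v: "v \<in> carrier_vec N"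
    and R: "0 \<le> R" "\<And>i u. u \<in> carrier_vec N \<Longrightarrow> vec_norm2 (A i *\<^sub>v u) \<le> R * vec_norm2 u"
  shows "positive_functional.bdd nc_star (vec_state N A v) R (nc_var i)"
proof -
  interpret positive_nc_functional "vec_state N A v" by (rule positive_vec_state[OF A v])
  show ?thesis
  proof (rule bddI)
    fix Q
    have "mat_eval N A (nc_var i * Q) *\<^sub>v v = A i *\<^sub>v (mat_eval N A Q *\<^sub>v v)"
      unfolding mat_eval_mult[OF A] mat_eval_var[OF A]
      by (rule assoc_mult_mat_vec[OF A mat_eval_carrier v])
    then show "nrm (nc_var i * Q) \<le> R * nrm Q"
      unfolding vec_state_nrm[OF A v]
      using R(2)[OF mult_mat_vec_carrier[OF mat_eval_carrier v]] by simp
  qed (rule R)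
qed

lemma mat_norm2_sq_mult_unit_vec:
  assumes A: "\<And>i. A i \<in> carrier_mat N N" and N: "0 < N"
  shows "(positive_functional.nrm nc_star (mat_law N A) P)\<^sup>2 =
    (\<Sum>r<N. (vec_norm2 (mat_eval N A P *\<^sub>v unit_vec N r))\<^sup>2) / real N"
proof -
  interpret tracial_nc_functional "mat_law N A" by (rule tracial_mat_law[OF A N])
  have "mat_law N A (nc_star P * P) =
      complex_of_real ((\<Sum>r<N. (vec_norm2 (mat_eval N A P *\<^sub>v unit_vec N r))\<^sup>2) / real N)"
    unfolding mat_law_vec_state[OF A] by (simp add: vec_state_sq[OF A])
  then show ?thesis unfolding nrm_sq by (simp only: Re_complex_of_real)
qed

lemma bdd_mat_law:
  assumes A: "\<And>i. A i \<in> carrier_mat N N" and N: "0 < N"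
    and R: "0 \<le> R" "\<And>i u. u \<in> carrier_vec N \<Longrightarrow> vec_norm2 (A i *\<^sub>v u) \<le> R * vec_norm2 u"
  shows "positive_functional.bdd nc_star (mat_law N A) R (nc_var i)"
proof -
  interpret tracial_nc_functional "mat_law N A" by (rule tracial_mat_law[OF A N])
  show ?thesis
  proof (rule bddI)
    fix Q
    have "(vec_norm2 (mat_eval N A (nc_var i * Q) *\<^sub>v unit_vec N r))\<^sup>2
        \<le> R\<^sup>2 * (vec_norm2 (mat_eval N A Q *\<^sub>v unit_vec N r))\<^sup>2" for r
    proof -
      have "mat_eval N A (nc_var i * Q) *\<^sub>v unit_vec N r = A i *\<^sub>v (mat_eval N A Q *\<^sub>v unit_vec N r)"
        unfolding mat_eval_mult[OF A] mat_eval_var[OF A]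
        by (rule assoc_mult_mat_vec[OF A mat_eval_carrier]) simp
      then show ?thesis
        using R(2)[of "mat_eval N A Q *\<^sub>v unit_vec N r" i]
          mult_mat_vec_carrier[OF mat_eval_carrier[of N A Q] unit_vec_carrier[of N r]]
        by (simp add: power_mono flip: power_mult_distrib)
    qed
    then have "(nrm (nc_var i * Q))\<^sup>2 \<le> (R * nrm Q)\<^sup>2"
      unfolding power_mult_distrib mat_norm2_sq_mult_unit_vec[OF A N] using N
      by (simp add: sum_distrib_left divide_right_mono sum_mono)
    then show "nrm (nc_var i * Q) \<le> R * nrm Q"
      by (rule power2_le_imp_le) (simp add: R)
  qed (rule R)
qed

text \<open>Two tuples with the same indices form one tuple indexed by the sum type, and its law is a single tracial functional
for which the Lipschitz estimate is known. Other norm estimates for several matrices are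
obtained in the same way.\<close>

lemma mat_eval_lipschitz:
  assumes B: "\<And>j. B j \<in> carrier_mat N N" "\<And>j. B' j \<in> carrier_mat N N" and N: "0 < N"
    and M: "1 \<le> M" "\<And>j u. u \<in> carrier_vec N \<Longrightarrow> vec_norm2 (B j *\<^sub>v u) \<le> M * vec_norm2 u"
      "\<And>j u. u \<in> carrier_vec N \<Longrightarrow> vec_norm2 (B' j *\<^sub>v u) \<le> M * vec_norm2 u"
    and \<delta>: "0 \<le> \<delta>" "\<And>j. j \<in> nc_indets Q \<Longrightarrow> mat_norm2 (B j - B' j) \<le> \<delta>"
  shows "mat_norm2 (mat_eval N B Q - mat_eval N B' Q) \<le> nc_lip M Q * \<delta>"
proof -
  define A where "A = case_sum B B'"
  have A: "A i \<in> carrier_mat N N" for i using B by (auto simp: A_def split: sum.split)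
  interpret tracial_nc_functional "mat_law N A" by (rule tracial_mat_law[OF A N])
  have b: "bdd M (nc_var i)" for i
    by (rule bdd_mat_law[OF A N]) (use M in \<open>auto simp: A_def split: sum.split\<close>)
  have "nrm (nc_var (Inl j) - nc_var (Inr j)) \<le> \<delta>" if "j \<in> nc_indets Q" for j
    using \<delta>(2)[OF that] by (simp add: mat_law_nrm[OF A N] mat_eval_diff mat_eval_var[OF A]) (simp add: A_def)
  then have "nrm (nc_subst (\<lambda>j. nc_var (Inl j)) Q - nc_subst (\<lambda>j. nc_var (Inr j)) Q) \<le> nc_lip M Q * \<delta>"
    by (intro nc_subst_lipschitz b M(1) \<delta>(1))
  then show ?thesis
    by (simp add: mat_law_nrm[OF A N] mat_eval_diff mat_eval_rename) (simp add: A_def)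
qed


subsection \<open>The normalized Hilbert-Schmidt norm\<close>

lemma mat_norm2_triangle:
  assumes X: "X \<in> carrier_mat N N" "Y \<in> carrier_mat N N" "Z \<in> carrier_mat N N" and N: "0 < N"
  shows "mat_norm2 (X - Z) \<le> mat_norm2 (X - Y) + mat_norm2 (Y - Z)"
    and "mat_norm2 (X - Y) = mat_norm2 (Y - X)"
proof -
  define A where "A = (\<lambda>k::nat. if k = 0 then X else if k = 1 then Y else Z)"
  have A: "A i \<in> carrier_mat N N" for i using X by (auto simp: A_def)
  interpret tracial_nc_functional "mat_law N A" by (rule tracial_mat_law[OF A N])
  have e: "nrm (nc_var i - nc_var j) = mat_norm2 (A i - A j)" for i j
    by (simp add: mat_law_nrm[OF A N] mat_eval_diff mat_eval_var[OF A])
  show "mat_norm2 (X - Z) \<le> mat_norm2 (X - Y) + mat_norm2 (Y - Z)"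
    using nrm_triangle_sub[of "nc_var 0" "nc_var 2" "nc_var 1"] unfolding e by (simp add: A_def)
  show "mat_norm2 (X - Y) = mat_norm2 (Y - X)"
    using nrm_minus_commute[of "nc_var 0" "nc_var 1"] unfolding e by (simp add: A_def)
qed

lemma unitary_matsD:
  assumes "U \<in> unitary_mats N"
  shows "U \<in> carrier_mat N N" "mat_adjoint U * U = 1\<^sub>m N" "U * mat_adjoint U = 1\<^sub>m N"
    "mat_adjoint U \<in> unitary_mats N"
proof -
  show U: "U \<in> carrier_mat N N" "mat_adjoint U * U = 1\<^sub>m N"
    using assms by (auto simp: unitary_mats_def)
  show "U * mat_adjoint U = 1\<^sub>m N"
    by (rule mat_mult_left_right_inverse[OF _ U(1,2)]) (simp add: U)
  then show "mat_adjoint U \<in> unitary_mats N" using U by (simp add: unitary_mats_def)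
qed

lemma unitary_mats_mult:
  assumes "U \<in> unitary_mats N" "V \<in> unitary_mats N"
  shows "U * V \<in> unitary_mats N"
proof -
  note U = unitary_matsD[OF assms(1)] and V = unitary_matsD[OF assms(2)]
  have Ua: "mat_adjoint U \<in> carrier_mat N N" and Va: "mat_adjoint V \<in> carrier_mat N N"
    using U V by simp_all
  have "mat_adjoint (U * V) * (U * V) = mat_adjoint V * (mat_adjoint U * (U * V))"
    unfolding mat_adjoint_mult[OF U(1) V(1)]
    by (rule assoc_mult_mat[OF Va Ua mult_carrier_mat[OF U(1) V(1)]])
  also have "mat_adjoint U * (U * V) = V"
    using assoc_mult_mat[OF Ua U(1) V(1)] left_mult_one_mat[OF V(1)] by (simp add: U(2))
  finally show ?thesis using V(2) mult_carrier_mat[OF U(1) V(1)] by (simp add: unitary_mats_def)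
qed

definition conj_mat :: "complex mat \<Rightarrow> complex mat \<Rightarrow> complex mat" where
  "conj_mat U X = U * X * mat_adjoint U"

lemma conj_mat_carrier [simp]:
  "U \<in> carrier_mat N N \<Longrightarrow> X \<in> carrier_mat N N \<Longrightarrow> conj_mat U X \<in> carrier_mat N N"
  by (auto simp: conj_mat_def intro!: mult_carrier_mat[of _ N N])

lemma conj_mat_diff:
  assumes U: "U \<in> carrier_mat N N" and X: "X \<in> carrier_mat N N" "Y \<in> carrier_mat N N"
  shows "conj_mat U (X - Y) = conj_mat U X - conj_mat U Y"
  unfolding conj_mat_def mult_minus_distrib_mat[OF U X]
  by (rule minus_mult_distrib_mat[OF mult_carrier_mat[OF U X(1)] mult_carrier_mat[OF U X(2)]
      mat_adjoint_carrier[THEN iffD2, OF U]])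

lemma conj_mat_conj_mat:
  assumes U: "U \<in> carrier_mat N N" "V \<in> carrier_mat N N" and X: "X \<in> carrier_mat N N"
  shows "conj_mat U (conj_mat V X) = conj_mat (U * V) X"
proof -
  have a: "mat_adjoint U \<in> carrier_mat N N" "mat_adjoint V \<in> carrier_mat N N"
    "V * X \<in> carrier_mat N N" "U * V \<in> carrier_mat N N" "U * V * X \<in> carrier_mat N N"
    using U X by (auto intro!: mult_carrier_mat[of _ N N])
  show ?thesis
    unfolding conj_mat_def mat_adjoint_mult[OF U]
    using U X a by (simp add: assoc_mult_mat[of _ N N _ N _ N])
qed

lemma conj_mat_mult:
  assumes U: "U \<in> unitary_mats N" and X: "X \<in> carrier_mat N N" "Y \<in> carrier_mat N N"
  shows "conj_mat U X * conj_mat U Y = conj_mat U (X * Y)"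
proof -
  note U = unitary_matsD[OF U]
  have Ua: "mat_adjoint U \<in> carrier_mat N N" using U by simp
  have c: "Y * mat_adjoint U \<in> carrier_mat N N" "U * (Y * mat_adjoint U) \<in> carrier_mat N N"
    using U X Ua by (auto intro!: mult_carrier_mat[of _ N N])
  have "mat_adjoint U * (U * (Y * mat_adjoint U)) = Y * mat_adjoint U"
    using assoc_mult_mat[OF Ua U(1) c(1)] left_mult_one_mat[OF c(1)] by (simp add: U(2))
  then show ?thesis
    unfolding conj_mat_def using U X Ua c mult_carrier_mat[OF X]
    by (simp add: assoc_mult_mat[of _ N N _ N _ N])
qed

lemma conj_mat_adjoint:
  assumes U: "U \<in> carrier_mat N N" and X: "X \<in> carrier_mat N N"
  shows "mat_adjoint (conj_mat U X) = conj_mat U (mat_adjoint X)"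
  unfolding conj_mat_def
  using U X mult_carrier_mat[OF U X]
  by (simp add: mat_adjoint_mult[of _ N N _ N] assoc_mult_mat[of _ N N _ N _ N])

lemma conj_mat_one: "U \<in> unitary_mats N \<Longrightarrow> conj_mat U (1\<^sub>m N) = 1\<^sub>m N"
  using unitary_matsD[of U N] right_mult_one_mat[of U N N] by (simp add: conj_mat_def)

lemma conj_mat_word:
  assumes U: "U \<in> unitary_mats N" and B: "\<And>j. B j \<in> carrier_mat N N"
  shows "mat_word N (\<lambda>j. conj_mat U (B j)) w = conj_mat U (mat_word N B w)"
proof (induction w)
  case Nil
  show ?case by (simp add: conj_mat_one[OF U])
next
  case (Cons l w)
  then show ?case
    using unitary_matsD(1)[OF U] B mat_word_carrier[of B N w]
    by (cases l) (simp_all add: conj_mat_adjoint[of _ N] conj_mat_mult[OF U])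
qed

lemma conj_mat_add:
  assumes U: "U \<in> carrier_mat N N" and X: "X \<in> carrier_mat N N" "Y \<in> carrier_mat N N"
  shows "conj_mat U (X + Y) = conj_mat U X + conj_mat U Y"
  unfolding conj_mat_def mult_add_distrib_mat[OF U X]
  by (rule add_mult_distrib_mat[OF mult_carrier_mat[OF U X(1)] mult_carrier_mat[OF U X(2)]
      mat_adjoint_carrier[THEN iffD2, OF U]])

lemma conj_mat_smult:
  assumes U: "U \<in> carrier_mat N N" and X: "X \<in> carrier_mat N N"
  shows "conj_mat U (c \<cdot>\<^sub>m X) = c \<cdot>\<^sub>m conj_mat U X"
  unfolding conj_mat_def mult_smult_distrib[OF U X]
  by (rule mult_smult_assoc_mat[OF mult_carrier_mat[OF U X] mat_adjoint_carrier[THEN iffD2, OF U]])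

lemma mat_eval_conj:
  assumes U: "U \<in> unitary_mats N" and B: "\<And>j. B j \<in> carrier_mat N N"
  shows "mat_eval N (\<lambda>j. conj_mat U (B j)) P = conj_mat U (mat_eval N B P)"
proof (induction P rule: ncpoly_induct)
  case (single w c)
  note Uc = unitary_matsD(1)[OF U]
  have c: "conj_mat U (B j) \<in> carrier_mat N N" for j using Uc B by simp
  show ?case
    unfolding mat_eval_single[OF c] mat_eval_single[OF B] conj_mat_word[OF U B]
    by (rule conj_mat_smult[OF Uc mat_word_carrier[OF B], symmetric])
next
  case (add P Q)
  then show ?case
    by (simp add: mat_eval_add conj_mat_add[OF unitary_matsD(1)[OF U] mat_eval_carrier mat_eval_carrier])
qed

lemma mat_tr_comm:
  assumes X: "X \<in> carrier_mat N N" "Y \<in> carrier_mat N N" and N: "0 < N"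
  shows "mat_tr (X * Y) = mat_tr (Y * X)"
proof -
  define A where "A = (\<lambda>b. if b then X else Y)"
  have A: "A i \<in> carrier_mat N N" for i using X by (auto simp: A_def)
  interpret tracial_nc_functional "mat_law N A" by (rule tracial_mat_law[OF A N])
  show ?thesis
    using \<phi>_comm[of "nc_var True" "nc_var False"]
    by (simp add: mat_law_eq[OF A] mat_eval_mult[OF A] mat_eval_var[OF A]) (simp add: A_def)
qed

lemma mat_norm2_conj:
  assumes U: "U \<in> unitary_mats N" and X: "X \<in> carrier_mat N N" and N: "0 < N"
  shows "mat_norm2 (conj_mat U X) = mat_norm2 X"
proof -
  note Uc = unitary_matsD[OF U]
  let ?Y = "mat_adjoint X * X"
  have Y: "?Y \<in> carrier_mat N N" using X by (intro mult_carrier_mat[of _ N N]) auto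
  have "mat_adjoint (conj_mat U X) * conj_mat U X = conj_mat U ?Y"
    using conj_mat_mult[OF U _ X, of "mat_adjoint X"] X by (simp add: conj_mat_adjoint[OF Uc(1) X])
  moreover have "mat_tr (conj_mat U ?Y) = mat_tr (mat_adjoint U * (U * ?Y))"
    unfolding conj_mat_def using mult_carrier_mat[OF Uc(1) Y] Uc(1)
    by (intro mat_tr_comm[OF _ _ N]) auto
  moreover have "mat_adjoint U * (U * ?Y) = ?Y"
    using assoc_mult_mat[of "mat_adjoint U" N N U N ?Y N] left_mult_one_mat[OF Y] Uc Y by simp
  ultimately show ?thesis by (simp add: mat_norm2_def)
qed

lemma vec_norm2_unitary:
  assumes U: "U \<in> unitary_mats N" and v: "v \<in> carrier_vec N"
  shows "vec_norm2 (U *\<^sub>v v) = vec_norm2 v"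
proof -
  note Uc = unitary_matsD[OF U]
  have "cip (U *\<^sub>v v) (U *\<^sub>v v) = cip v (mat_adjoint U *\<^sub>v (U *\<^sub>v v))"
    by (rule cip_adjoint[OF Uc(1) v mult_mat_vec_carrier[OF Uc(1) v]])
  also have "mat_adjoint U *\<^sub>v (U *\<^sub>v v) = v"
    using assoc_mult_mat_vec[of "mat_adjoint U" N N U N v] Uc v by simp
  finally have "(vec_norm2 (U *\<^sub>v v))\<^sup>2 = (vec_norm2 v)\<^sup>2"
    by (simp only: cip_self of_real_eq_iff)
  then show ?thesis by (simp add: power2_eq_iff_nonneg)
qed

lemma vec_norm2_conj_mat:
  assumes U: "U \<in> unitary_mats N" and X: "X \<in> carrier_mat N N"
    and M: "\<And>u. u \<in> carrier_vec N \<Longrightarrow> vec_norm2 (X *\<^sub>v u) \<le> M * vec_norm2 u"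
    and v: "v \<in> carrier_vec N"
  shows "vec_norm2 (conj_mat U X *\<^sub>v v) \<le> M * vec_norm2 v"
proof -
  note Uc = unitary_matsD[OF U]
  have a: "mat_adjoint U *\<^sub>v v \<in> carrier_vec N" "X *\<^sub>v (mat_adjoint U *\<^sub>v v) \<in> carrier_vec N"
    using Uc(1) X v by (auto intro!: mult_mat_vec_carrier)
  have "conj_mat U X *\<^sub>v v = U *\<^sub>v (X *\<^sub>v (mat_adjoint U *\<^sub>v v))"
    unfolding conj_mat_def using Uc(1) X v a
    by (simp add: assoc_mult_mat_vec[of _ N N _ N] mult_carrier_mat[of _ N N])
  then have "vec_norm2 (conj_mat U X *\<^sub>v v) = vec_norm2 (X *\<^sub>v (mat_adjoint U *\<^sub>v v))"
    using vec_norm2_unitary[OF U a(2)] by simp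
  also have "\<dots> \<le> M * vec_norm2 v"
    using M[OF a(1)] vec_norm2_unitary[OF Uc(4) v] by simp
  finally show ?thesis .
qed


section \<open>Orbit covers and entropy\<close>

lemma K_orb_le:
  assumes "\<And>\<Omega>\<^sub>0'. \<Omega>\<^sub>0' \<subseteq> \<Omega>' \<Longrightarrow> finite \<Omega>\<^sub>0' \<Longrightarrow> orbit_covers N G \<eta> \<Omega>\<^sub>0' \<Omega>' \<Longrightarrow>
    \<exists>\<Omega>\<^sub>0. \<Omega>\<^sub>0 \<subseteq> \<Omega> \<and> finite \<Omega>\<^sub>0 \<and> orbit_covers N F \<epsilon> \<Omega>\<^sub>0 \<Omega> \<and> card \<Omega>\<^sub>0 \<le> card \<Omega>\<^sub>0'"
  shows "K_orb N F \<epsilon> \<Omega> \<le> K_orb N G \<eta> \<Omega>'"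
  unfolding K_orb_def
proof (rule INF_mono)
  fix \<Omega>\<^sub>0' assume "\<Omega>\<^sub>0' \<in> {\<Omega>\<^sub>0. \<Omega>\<^sub>0 \<subseteq> \<Omega>' \<and> finite \<Omega>\<^sub>0 \<and> orbit_covers N G \<eta> \<Omega>\<^sub>0 \<Omega>'}"
  then show "\<exists>\<Omega>\<^sub>0\<in>{\<Omega>\<^sub>0. \<Omega>\<^sub>0 \<subseteq> \<Omega> \<and> finite \<Omega>\<^sub>0 \<and> orbit_covers N F \<epsilon> \<Omega>\<^sub>0 \<Omega>}. enat (card \<Omega>\<^sub>0) \<le> enat (card \<Omega>\<^sub>0')"
    using assms[of \<Omega>\<^sub>0'] by auto
qed

lemma log_enat_mono: "k \<le> l \<Longrightarrow> log_enat k \<le> log_enat l"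
  by (cases k; cases l) (auto simp: log_enat_def)

abbreviation growth :: "real \<Rightarrow> 'i set \<Rightarrow> real \<Rightarrow> ('i ncpoly \<Rightarrow> complex) set \<Rightarrow> ereal" where
  "growth R F \<epsilon> V \<equiv> limsup (\<lambda>N. log_enat (K_orb N F \<epsilon> (microstates R N V)) / ereal ((real N)\<^sup>2))"

lemma growth_mono:
  assumes "\<And>N. 0 < N \<Longrightarrow> K_orb N F \<epsilon> (microstates R N V) \<le> K_orb N G \<eta> (microstates S N W)"
  shows "growth R F \<epsilon> V \<le> growth S G \<eta> W"
proof (rule Limsup_mono)
  show "\<forall>\<^sub>F N in sequentially. log_enat (K_orb N F \<epsilon> (microstates R N V)) / ereal ((real N)\<^sup>2)
      \<le> log_enat (K_orb N G \<eta> (microstates S N W)) / ereal ((real N)\<^sup>2)"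
    using eventually_gt_at_top[of "0::nat"]
    by eventually_elim (auto intro!: ereal_divide_right_mono log_enat_mono assms)
qed

lemma law_open_finite_conditions:
  fixes c :: "'i ncpoly \<Rightarrow> complex"
  assumes "finite E"
  shows "law_open R {m \<in> law_space R. \<forall>P\<in>E. cmod (m P - c P) < \<kappa> P}"
proof -
  have "open {m :: 'i ncpoly \<Rightarrow> complex. cmod (m P - c P) < \<kappa> P}" for P
    by (intro open_Collect_less continuous_intros continuous_on_product_coordinates)
  then have "open (\<Inter>P\<in>E. {m :: 'i ncpoly \<Rightarrow> complex. cmod (m P - c P) < \<kappa> P})"
    using assms by (intro open_INT) auto
  moreover have "{m \<in> law_space R. \<forall>P\<in>E. cmod (m P - c P) < \<kappa> P} =
      law_space R \<inter> (\<Inter>P\<in>E. {m. cmod (m P - c P) < \<kappa> P})" by auto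
  ultimately show ?thesis unfolding law_open_def by (auto simp: openin_open)
qed

lemma law_open_contains_finite_conditions:
  assumes V: "law_open R V" and m: "m \<in> V"
  shows "\<exists>E \<kappa>. finite E \<and> 0 < \<kappa> \<and> (\<forall>m'\<in>law_space R. (\<forall>P\<in>E. cmod (m' P - m P) < \<kappa>) \<longrightarrow> m' \<in> V)"
proof -
  obtain T where T: "open T" "V = law_space R \<inter> T"
    using V by (auto simp: law_open_def openin_open)
  then have "m \<in> T" using m by simp
  have "openin (product_topology (\<lambda>_. euclidean) UNIV) T"
    using T(1) by (simp add: open_fun_def)
  from product_topology_open_contains_basis[OF this \<open>m \<in> T\<close>]
  have "\<exists>X. m \<in> Pi\<^sub>E UNIV X \<and> (\<forall>i. open (X i)) \<and> finite {i. X i \<noteq> UNIV} \<and> Pi\<^sub>E UNIV X \<subseteq> T"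
    by simp
  then obtain X where X: "m \<in> Pi\<^sub>E UNIV X" "\<And>i. open (X i)" "finite {i. X i \<noteq> UNIV}" "Pi\<^sub>E UNIV X \<subseteq> T"
    by blast
  define E where "E = {i. X i \<noteq> UNIV}"
  have "\<exists>\<kappa>>0. \<forall>z. dist z (m P) < \<kappa> \<longrightarrow> z \<in> X P" for P
    using X(1,2) by (auto simp: PiE_iff open_dist)
  then obtain \<kappa> where \<kappa>: "\<And>P. 0 < \<kappa> P" "\<And>P z. dist z (m P) < \<kappa> P \<Longrightarrow> z \<in> X P" by metis
  define \<kappa>0 where "\<kappa>0 = Min (insert 1 (\<kappa> ` E))"
  have fE: "finite E" using X(3) by (simp add: E_def)
  have \<kappa>0: "0 < \<kappa>0" "\<And>P. P \<in> E \<Longrightarrow> \<kappa>0 \<le> \<kappa> P"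
    using fE \<kappa>(1) by (auto simp: \<kappa>0_def)
  have "m' \<in> V" if "m' \<in> law_space R" "\<forall>P\<in>E. cmod (m' P - m P) < \<kappa>0" for m'
  proof -
    have "m' P \<in> X P" for P
    proof (cases "P \<in> E")
      case True
      then have "dist (m' P) (m P) < \<kappa> P"
        using that(2) \<kappa>0(2)[OF True] by (auto simp: dist_norm)
      then show ?thesis by (rule \<kappa>(2))
    qed (simp add: E_def)
    then have "m' \<in> Pi\<^sub>E UNIV X" by (simp add: PiE_iff)
    then show ?thesis using X(4) T(2) that(1) by auto
  qed
  then show ?thesis using fE \<kappa>0(1) by blast
qed


section \<open>Entropy does not depend on the generating tuple\<close>


lemma norm_cutoff_scale:
  assumes "0 \<le> r" "0 \<le> S"
  shows "cmod (complex_of_real S) * (cmod (complex_of_real (1 / (1 + r))) * (1 + r)) = S"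
proof -
  have "1 + r \<noteq> 0" using assms by linarith
  then show ?thesis unfolding norm_of_real using assms by simp
qed

text \<open>The constant \<open>C\<close> depends on \<open>Z\<close> and \<open>R\<close> only, and it bounds \<open>Z\<close> in every vector state of every
\<open>R\<close>-bounded matrix tuple. Hence one and the same polynomial has norm at most \<open>S\<close> at all of them.\<close>

lemma mat_opnorm_cutoff_le:
  fixes A :: "'i \<Rightarrow> complex mat" and Z :: "'i ncpoly"
  assumes A: "\<And>i. A i \<in> carrier_mat N N" and R: "0 \<le> R" "\<And>i. mat_opnorm (A i) \<le> R" and S: "0 \<le> S"
  defines "C \<equiv> nc_bound R Z"
  shows "mat_opnorm (mat_eval N A (nc_const (complex_of_real S) *
      (nc_const (complex_of_real (1 / (1 + (C\<^sup>2 / (1 + C\<^sup>2)) ^ k))) * nc.cutoff C k Z))) \<le> S"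
    (is "mat_opnorm (mat_eval N A ?P) \<le> S")
proof (rule mat_opnorm_le[OF S])
  fix v :: "complex vec" assume "v \<in> carrier_vec (dim_col (mat_eval N A ?P))"
  then have v: "v \<in> carrier_vec N" by simp
  interpret positive_nc_functional "vec_state N A v" by (rule positive_vec_state[OF A v])
  let ?r = "(C\<^sup>2 / (1 + C\<^sup>2)) ^ k"
  have r: "0 \<le> ?r" by simp
  have "bdd R (nc_var i)" for i
  proof (rule bdd_vec_state[OF A v R(1)])
    fix i and u :: "complex vec" assume "u \<in> carrier_vec N"
    then show "vec_norm2 (A i *\<^sub>v u) \<le> R * vec_norm2 u"
      using vec_norm2_mult_le[OF A, of u i] mult_right_mono[OF R(2)[of i] vec_norm2_ge0[of u]] by linarith
  qed
  then have "bdd C Z" unfolding C_def by (rule bdd_nc_bound)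
  from bdd_sc_mult[OF bdd_sc_mult[OF bdd_cutoff[OF this]]]
  have "bdd (cmod (complex_of_real S) * (cmod (complex_of_real (1 / (1 + ?r))) * (1 + ?r))) ?P" .
  then have "bdd S ?P" unfolding norm_cutoff_scale[OF r S] .
  from bddD[OF this, of 1]
  show "vec_norm2 (mat_eval N A ?P *\<^sub>v v) \<le> S * vec_norm2 v"
    using one_mult_mat_vec[OF v] by (simp add: vec_state_nrm[OF A v] mat_eval_1[OF A])
qed

text \<open>Given \<open>F\<close> and \<open>\<epsilon>\<close> for the first tuple, the polynomials \<open>Q\<close> that recover its variables determine a
finite set \<open>G\<close> and a radius \<open>\<eta>\<close> for the second tuple. Only afterwards, given a neighbourhood \<open>W\<close> of the
second law, the polynomials \<open>P\<close> are chosen, and with them a neighbourhood \<open>V\<close> of the first law such that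
evaluation of \<open>P\<close> maps the microstates for \<open>V\<close> to those for \<open>W\<close>. This order is that of
the quantifiers in the definition of the entropy.\<close>

theorem entropy1_mono_of_approx:
  fixes \<l> :: "'k ncpoly \<Rightarrow> complex" and p :: "'i \<Rightarrow> 'k" and q :: "'j \<Rightarrow> 'k"
  assumes \<l>: "tracial_nc_functional \<l>"
    and R: "0 \<le> R" and S: "0 < S"
    and p: "\<And>i. positive_functional.bdd nc_star \<l> R (nc_var (p i))"
    and q: "\<And>j. positive_functional.bdd nc_star \<l> S (nc_var (q j))"
    and apx_p: "\<And>i. positive_functional.approx nc_star \<l> (range (nc_subst (\<lambda>j. nc_var (q j)))) (nc_var (p i))"
    and apx_q: "\<And>j. positive_functional.approx nc_star \<l> (range (nc_subst (\<lambda>i. nc_var (p i)))) (nc_var (q j))"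
  shows "entropy1 R {\<lambda>P. \<l> (nc_subst (\<lambda>i. nc_var (p i)) P)} \<le> entropy1 S {\<lambda>P. \<l> (nc_subst (\<lambda>j. nc_var (q j)) P)}"
proof -
  interpret tracial_nc_functional \<l> by fact
  let ?p = "\<lambda>i. nc_var (p i) :: 'k ncpoly" and ?q = "\<lambda>j. nc_var (q j) :: 'k ncpoly"
  let ?lp = "\<lambda>P. \<l> (nc_subst ?p P)" and ?lq = "\<lambda>P. \<l> (nc_subst ?q P)"
  have lp: "?lp \<in> law_space R" by (rule subst_in_law_space[OF p])
  have sub_p: "nc.subalgebra (range (nc_subst ?p))"
    unfolding nc.subalgebra_def
    by (auto simp: nc_subst_add[symmetric] nc_subst_mult[symmetric] nc_subst_star[symmetric])
      (metis nc_subst_1 rangeI, metis nc_subst_const nc_subst_mult rangeI)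
  define M where "M = max 1 S"
  have M: "1 \<le> M" "S \<le> M" by (auto simp: M_def)
  \<comment> \<open>The approximants come from the density theorem for the normalized variable \<open>y / S\<close>.\<close>
  have ex_P: "\<exists>P. (\<forall>N A. (\<forall>i. A i \<in> carrier_mat N N \<and> mat_opnorm (A i) \<le> R) \<longrightarrow> mat_opnorm (mat_eval N A P) \<le> S)
      \<and> bdd S (nc_subst ?p P) \<and> nrm (?q j - nc_subst ?p P) < \<delta>" if \<delta>: "0 < \<delta>" for j \<delta>
  proof -
    let ?y = "nc_const (complex_of_real (1 / S)) * ?q j"
    have y: "approx (range (nc_subst ?p)) ?y" by (rule approx_sc[OF sub_p apx_q])
    have "bdd (cmod (complex_of_real (1 / S)) * S) ?y" by (rule bdd_sc_mult[OF q])
    moreover have "cmod (complex_of_real (1 / S)) * S = 1" unfolding norm_of_real using S by simp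
    ultimately have y1: "bdd 1 ?y" by metis
    have "\<exists>C. bdd C z" if "z \<in> range (nc_subst ?p)" for z
      using that bdd_nc_subst[of R ?p] p by blast
    from cutoff_density[OF sub_p this y y1, of "\<delta> / S"] \<delta> S
    obtain Z where Z: "\<And>C. bdd C (nc_subst ?p Z) \<Longrightarrow>
        \<exists>k. nrm (?y - nc_const (complex_of_real (1 / (1 + (C\<^sup>2 / (1 + C\<^sup>2)) ^ k))) * nc.cutoff C k (nc_subst ?p Z)) < \<delta> / S"
      by fastforce
    define C where "C = nc_bound R Z"
    have C: "bdd C (nc_subst ?p Z)" unfolding C_def by (rule bdd_nc_subst[OF p])
    obtain k where k: "nrm (?y - nc_const (complex_of_real (1 / (1 + (C\<^sup>2 / (1 + C\<^sup>2)) ^ k))) * nc.cutoff C k (nc_subst ?p Z)) < \<delta> / S"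
      using Z[OF C] by blast
    define r where "r = (C\<^sup>2 / (1 + C\<^sup>2)) ^ k"
    have r: "0 \<le> r" by (simp add: r_def)
    define P where "P = nc_const (complex_of_real S) * (nc_const (complex_of_real (1 / (1 + r))) * nc.cutoff C k Z)"
    have PS: "nc_subst ?p P = nc_const (complex_of_real S) *
        (nc_const (complex_of_real (1 / (1 + r))) * nc.cutoff C k (nc_subst ?p Z))"
      by (simp only: P_def nc_subst_mult nc_subst_const nc_subst_cutoff)
    have "mat_opnorm (mat_eval N A P) \<le> S" if "\<forall>i. A i \<in> carrier_mat N N \<and> mat_opnorm (A i) \<le> R" for N A
      using mat_opnorm_cutoff_le[of A N R S Z k] that R S unfolding P_def C_def r_def by simp
    moreover have "bdd S (nc_subst ?p P)"
    proof -
      have "bdd (cmod (complex_of_real S) * (cmod (complex_of_real (1 / (1 + r))) * (1 + r))) (nc_subst ?p P)"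
        unfolding PS r_def by (intro bdd_sc_mult bdd_cutoff C)
      then show ?thesis unfolding norm_cutoff_scale[OF r less_imp_le[OF S]] .
    qed
    moreover have "nrm (?q j - nc_subst ?p P) < \<delta>"
    proof -
      have "nc_const (complex_of_real S) * ?y = (nc_const (complex_of_real S) * nc_const (complex_of_real (1 / S))) * ?q j"
        by (simp only: mult.assoc)
      also have "nc_const (complex_of_real S) * nc_const (complex_of_real (1 / S)) = (1 :: 'k ncpoly)"
        using S by (simp flip: nc.sc_mult)
      finally have "?q j - nc_subst ?p P = nc_const (complex_of_real S) *
          (?y - nc_const (complex_of_real (1 / (1 + r))) * nc.cutoff C k (nc_subst ?p Z))"
        unfolding PS right_diff_distrib by simp
      then have "nrm (?q j - nc_subst ?p P) = S *
          nrm (?y - nc_const (complex_of_real (1 / (1 + r))) * nc.cutoff C k (nc_subst ?p Z))"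
        using S by (simp add: nrm_sc)
      also have "\<dots> < S * (\<delta> / S)" using k S unfolding r_def by (intro mult_strict_left_mono) auto
      finally show ?thesis using S by simp
    qed
    ultimately show ?thesis by blast
  qed
  show ?thesis
    unfolding entropy1_def
  proof (rule SUP_least, clarify)
    fix F :: "'i set" and \<epsilon> :: real
    assume F: "finite F" and \<epsilon>: "0 < \<epsilon>"
    have "\<exists>Q. nrm (?p i - nc_subst ?q Q) < \<epsilon> / 8" for i
    proof -
      have "0 < \<epsilon> / 8" using \<epsilon> by simp
      then show ?thesis using apx_p[of i] unfolding approx_def by blast
    qed
    then obtain Q where Q: "\<And>i. nrm (?p i - nc_subst ?q (Q i)) < \<epsilon> / 8" by metis
    define G where "G = (\<Union>i\<in>F. nc_indets (Q i))"
    have G: "finite G" using F by (simp add: G_def finite_nc_indets)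
    define L where "L = 1 + (\<Sum>i\<in>F. nc_lip M (Q i))"
    have lip0: "0 \<le> nc_lip M P" for P :: "'j ncpoly" using M by (intro nc_lip_ge0) simp
    have L: "1 \<le> L" "\<And>i. i \<in> F \<Longrightarrow> nc_lip M (Q i) \<le> L"
    proof -
      show "1 \<le> L" using lip0 by (simp add: L_def sum_nonneg)
      show "nc_lip M (Q i) \<le> L" if "i \<in> F" for i
        using member_le_sum[of i F "\<lambda>i. nc_lip M (Q i)"] that F lip0 unfolding L_def by simp
    qed
    define \<eta> where "\<eta> = \<epsilon> / (8 * L)"
    have \<eta>: "0 < \<eta>" "L * \<eta> = \<epsilon> / 8" using L \<epsilon> by (auto simp: \<eta>_def)
    have "(INF V\<in>{V. law_open R V \<and> {?lp} \<subseteq> V}. growth R F \<epsilon> V)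
        \<le> (INF W\<in>{W. law_open S W \<and> {?lq} \<subseteq> W}. growth S G \<eta> W)"
    proof (rule INF_mono)
      fix W assume "W \<in> {W. law_open S W \<and> {?lq} \<subseteq> W}"
      then have W: "law_open S W" "?lq \<in> W" by auto
      obtain E \<kappa> where E: "finite E" "0 < \<kappa>"
        and EW: "\<And>m'. m' \<in> law_space S \<Longrightarrow> (\<And>P. P \<in> E \<Longrightarrow> cmod (m' P - ?lq P) < \<kappa>) \<Longrightarrow> m' \<in> W"
        using law_open_contains_finite_conditions[OF W] by metis
      define L' where "L' = L + (\<Sum>P\<in>E. nc_lip M P)"
      have L': "1 \<le> L'" "L \<le> L'" "\<And>P. P \<in> E \<Longrightarrow> nc_lip M P \<le> L'"
      proof -
        show "L \<le> L'" using lip0 by (simp add: L'_def sum_nonneg)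
        then show "1 \<le> L'" using L by simp
        show "nc_lip M P \<le> L'" if "P \<in> E" for P
          using member_le_sum[of P E "nc_lip M"] that E lip0 L unfolding L'_def by simp
      qed
      define \<delta> where "\<delta> = min \<kappa> (\<epsilon> / 4) / (4 * L')"
      have \<delta>: "0 < \<delta>" "L' * \<delta> \<le> \<kappa> / 4" "L' * \<delta> \<le> \<epsilon> / 16"
        using L' \<epsilon> E by (auto simp: \<delta>_def)
      from ex_P[OF \<delta>(1)] obtain P where
        P_opnorm: "\<And>j N A. (\<And>i. A i \<in> carrier_mat N N) \<Longrightarrow> (\<And>i. mat_opnorm (A i) \<le> R) \<Longrightarrow> mat_opnorm (mat_eval N A (P j)) \<le> S"
        and P_bdd: "\<And>j. bdd S (nc_subst ?p (P j))" and P_apx: "\<And>j. nrm (?q j - nc_subst ?p (P j)) < \<delta>"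
        by metis
      have near: "nrm (nc_subst ?q X - nc_subst ?p (nc_subst P X)) \<le> L' * \<delta>" if "nc_lip M X \<le> L'" for X
      proof -
        have "nrm (nc_subst ?q X - nc_subst (\<lambda>j. nc_subst ?p (P j)) X) \<le> nc_lip M X * \<delta>"
          by (rule nc_subst_lipschitz)
            (use M P_apx \<delta> bdd_mono[OF q] bdd_mono[OF P_bdd] in \<open>auto intro: less_imp_le\<close>)
        also have "\<dots> \<le> L' * \<delta>" using that \<delta> by (intro mult_right_mono) auto
        finally show ?thesis by (simp add: nc_subst_subst)
      qed
      define X where "X i = nc_var i - nc_subst P (Q i)" for i
      have X: "nrm (nc_subst ?p (X i)) < \<epsilon> / 4" if "i \<in> F" for i
      proof -
        have "nrm (?p i - nc_subst ?p (nc_subst P (Q i)))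
            \<le> nrm (?p i - nc_subst ?q (Q i)) + nrm (nc_subst ?q (Q i) - nc_subst ?p (nc_subst P (Q i)))"
          by (rule nrm_triangle_sub)
        also have "\<dots> < \<epsilon> / 8 + \<epsilon> / 8"
        proof (rule add_less_le_mono[OF Q])
          have "nrm (nc_subst ?q (Q i) - nc_subst ?p (nc_subst P (Q i))) \<le> L' * \<delta>"
            by (rule near) (use L(2)[OF that] L'(2) in linarith)
          then show "nrm (nc_subst ?q (Q i) - nc_subst ?p (nc_subst P (Q i))) \<le> \<epsilon> / 8"
            using \<delta>(3) \<epsilon> by linarith
        qed
        finally show ?thesis by (simp add: X_def nc_subst_diff)
      qed
      \<comment> \<open>The first group of conditions puts the law of \<open>P(A)\<close> into \<open>W\<close>, the second one makes
        \<open>Q(P(A))\<close> close to \<open>A\<close>: a square below \<open>(\<epsilon>/4)\<^sup>2\<close> for the law itself stays below \<open>(3\<epsilon>/8)\<^sup>2\<close>.\<close>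
      define V where "V = {m \<in> law_space R. \<forall>T\<in>nc_subst P ` E \<union> (\<lambda>i. nc_star (X i) * X i) ` F.
          cmod (m T - ?lp T) < min (\<kappa> / 2) ((3 * \<epsilon> / 8)\<^sup>2 - (\<epsilon> / 4)\<^sup>2)}"
      have pos: "0 < min (\<kappa> / 2) ((3 * \<epsilon> / 8)\<^sup>2 - (\<epsilon> / 4)\<^sup>2)"
        using E \<epsilon> by (simp add: power2_eq_square)
      have V: "law_open R V" "{?lp} \<subseteq> V"
      proof -
        show "law_open R V"
          unfolding V_def by (rule law_open_finite_conditions) (use E F in auto)
        show "{?lp} \<subseteq> V" unfolding V_def using pos lp by simp
      qed
      define B where "B A N = (\<lambda>j. mat_eval N A (P j))" for A :: "'i \<Rightarrow> complex mat" and N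
      have "K_orb N F \<epsilon> (microstates R N V) \<le> K_orb N G \<eta> (microstates S N W)" if N: "0 < N" for N
      proof (rule K_orb_le)
        let ?\<Gamma> = "microstates R N V" and ?\<Gamma>' = "microstates S N W"
        fix \<Omega>\<^sub>0' assume \<Omega>': "\<Omega>\<^sub>0' \<subseteq> ?\<Gamma>'" "finite \<Omega>\<^sub>0'" "orbit_covers N G \<eta> \<Omega>\<^sub>0' ?\<Gamma>'"
        have Bc: "B A N j \<in> carrier_mat N N" for A j by (simp add: B_def)
        have opn: "vec_norm2 (A *\<^sub>v u) \<le> r * vec_norm2 u"
          if "A \<in> carrier_mat N N" "mat_opnorm A \<le> r" "u \<in> carrier_vec N" for A u and r :: real
          using vec_norm2_mult_le[OF that(1,3)] mult_right_mono[OF that(2) vec_norm2_ge0[of u]] by linarith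
        have tr_close: "cmod (mat_law N (B A N) T - ?lq T) < \<kappa>" if A: "A \<in> ?\<Gamma>" and T: "T \<in> E" for A T
        proof -
          have Ac: "A i \<in> carrier_mat N N" for i using A by (simp add: microstates_def)
          have "mat_law N (B A N) T = mat_law N A (nc_subst P T)"
            unfolding B_def by (simp add: mat_law_eq mat_eval_subst[OF Ac] Ac)
          moreover have "cmod (mat_law N A (nc_subst P T) - ?lp (nc_subst P T)) < \<kappa> / 2"
            using A T by (auto simp: microstates_def V_def)
          moreover have "cmod (?lp (nc_subst P T) - ?lq T) \<le> \<kappa> / 4"
            using \<phi>_le_nrm[of "nc_subst ?p (nc_subst P T) - nc_subst ?q T"] near[OF L'(3)[OF T]] \<delta>(2)
            by (simp add: \<phi>_diff nrm_minus_commute)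
          ultimately show ?thesis
            using norm_triangle_ineq[of "mat_law N A (nc_subst P T) - ?lp (nc_subst P T)" "?lp (nc_subst P T) - ?lq T"] E(2)
            by simp
        qed
        have B_mem: "B A N \<in> ?\<Gamma>'" if A: "A \<in> ?\<Gamma>" for A
        proof -
          have Ac: "A i \<in> carrier_mat N N" "mat_opnorm (A i) \<le> R" for i using A by (auto simp: microstates_def)
          have op: "mat_opnorm (B A N j) \<le> S" for j unfolding B_def by (rule P_opnorm[OF Ac])
          interpret B: tracial_nc_functional "mat_law N (B A N)" by (rule tracial_mat_law[OF Bc N])
          have "B.bdd S (nc_var j)" for j
            by (rule bdd_mat_law[OF Bc N less_imp_le[OF S]]) (rule opn[OF Bc op])
          with B.subst_in_law_space[of S nc_var] have "mat_law N (B A N) \<in> law_space S" by simp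
          then have "mat_law N (B A N) \<in> W" using tr_close[OF A] by (rule EW)
          then show ?thesis using Bc op by (auto simp: microstates_def)
        qed
        have A_close: "mat_norm2 (A i - mat_eval N (B A N) (Q i)) < 3 * \<epsilon> / 8"
          if A: "A \<in> ?\<Gamma>" and i: "i \<in> F" for A i
        proof -
          have Ac: "A i \<in> carrier_mat N N" for i using A by (simp add: microstates_def)
          interpret A: tracial_nc_functional "mat_law N A" by (rule tracial_mat_law[OF Ac N])
          let ?X = "nc_star (X i) * X i"
          have "cmod (mat_law N A ?X - ?lp ?X) < (3 * \<epsilon> / 8)\<^sup>2 - (\<epsilon> / 4)\<^sup>2"
            using A i by (auto simp: microstates_def V_def)
          then have "Re (mat_law N A ?X) < (3 * \<epsilon> / 8)\<^sup>2 - (\<epsilon> / 4)\<^sup>2 + Re (?lp ?X)"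
            using complex_Re_le_cmod[of "mat_law N A ?X - ?lp ?X"] by simp
          also have "Re (?lp ?X) = (nrm (nc_subst ?p (X i)))\<^sup>2"
            by (simp add: nrm_sq nc_subst_mult nc_subst_star)
          also have "\<dots> \<le> (\<epsilon> / 4)\<^sup>2"
            using X[OF i] by (intro power_mono) auto
          finally have "(A.nrm (X i))\<^sup>2 < (3 * \<epsilon> / 8)\<^sup>2" by (simp add: A.nrm_sq)
          then have "A.nrm (X i) < 3 * \<epsilon> / 8"
            by (rule power2_less_imp_less) (use \<epsilon> in simp)
          then show ?thesis
            by (simp add: mat_law_nrm[OF Ac N] X_def mat_eval_diff mat_eval_var[OF Ac] mat_eval_subst[OF Ac] B_def)
        qed
        define near_orb where "near_orb A B' U \<longleftrightarrow> A \<in> ?\<Gamma> \<and> U \<in> unitary_mats N \<and>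
          (\<forall>j\<in>G. mat_norm2 (B A N j - conj_mat U (B' j)) < \<eta>)" for A B' U
        have near_orb: "mat_norm2 (A i - conj_mat U (mat_eval N B' (Q i))) < \<epsilon> / 2"
          if B': "B' \<in> \<Omega>\<^sub>0'" and AU: "near_orb A B' U" and i: "i \<in> F" for A B' U i
        proof -
          have A: "A \<in> ?\<Gamma>" and U: "U \<in> unitary_mats N" using AU by (auto simp: near_orb_def)
          have Ac: "A i \<in> carrier_mat N N" using A by (simp add: microstates_def)
          have B'c: "B' j \<in> carrier_mat N N" "mat_opnorm (B' j) \<le> M" for j
            using B' \<Omega>'(1) M(2) by (auto simp: microstates_def intro: order_trans)
          have BA: "mat_opnorm (B A N j) \<le> M" for j
            using B_mem[OF A] M(2) by (auto simp: microstates_def intro: order_trans)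
          have "mat_norm2 (mat_eval N (B A N) (Q i) - mat_eval N (\<lambda>j. conj_mat U (B' j)) (Q i)) \<le> nc_lip M (Q i) * \<eta>"
          proof (rule mat_eval_lipschitz[OF Bc _ N M(1)])
            show "conj_mat U (B' j) \<in> carrier_mat N N" for j using B'c unitary_matsD(1)[OF U] by simp
            show "vec_norm2 (B A N j *\<^sub>v u) \<le> M * vec_norm2 u" if "u \<in> carrier_vec N" for j u
              by (rule opn[OF Bc BA that])
            show "vec_norm2 (conj_mat U (B' j) *\<^sub>v u) \<le> M * vec_norm2 u" if "u \<in> carrier_vec N" for j u
              by (rule vec_norm2_conj_mat[OF U B'c(1) opn[OF B'c] that])
            show "mat_norm2 (B A N j - conj_mat U (B' j)) \<le> \<eta>" if "j \<in> nc_indets (Q i)" for j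
              using AU i that unfolding near_orb_def G_def by (meson UN_I less_imp_le)
          qed (use \<eta> in simp)
          also have "\<dots> \<le> L * \<eta>" using L(2)[OF i] \<eta> by (intro mult_right_mono) auto
          finally have "mat_norm2 (mat_eval N (B A N) (Q i) - conj_mat U (mat_eval N B' (Q i))) \<le> \<epsilon> / 8"
            using \<eta>(2) by (simp add: mat_eval_conj[OF U B'c(1)])
          moreover have "mat_norm2 (A i - conj_mat U (mat_eval N B' (Q i))) \<le> mat_norm2 (A i - mat_eval N (B A N) (Q i))
              + mat_norm2 (mat_eval N (B A N) (Q i) - conj_mat U (mat_eval N B' (Q i)))"
            by (rule mat_norm2_triangle(1)[OF Ac mat_eval_carrier _ N])
              (rule conj_mat_carrier[OF unitary_matsD(1)[OF U] mat_eval_carrier])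
          ultimately show ?thesis using A_close[OF A i] by linarith
        qed
        \<comment> \<open>A cover consists of elements of the covered set, so each useful center \<open>B'\<close> is replaced by some
          microstate \<open>A\<close> whose image lies near the orbit of \<open>B'\<close>; this doubles the radius \<open>\<epsilon>/2\<close>.\<close>
        define D where "D = {B' \<in> \<Omega>\<^sub>0'. \<exists>A U. near_orb A B' U}"
        have "\<exists>A. \<exists>U. near_orb A B' U" if "B' \<in> D" for B' using that by (auto simp: D_def)
        then obtain sel where sel: "\<And>B'. B' \<in> D \<Longrightarrow> \<exists>U. near_orb (sel B') B' U" by metis
        have fD: "finite D" using \<Omega>'(2) by (simp add: D_def)
        have "orbit_covers N F \<epsilon> (sel ` D) ?\<Gamma>"
          unfolding orbit_covers_def
        proof (intro ballI)
          fix C assume C: "C \<in> ?\<Gamma>"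
          from \<Omega>'(3) B_mem[OF C] obtain B' U1 where B': "B' \<in> \<Omega>\<^sub>0'" and "U1 \<in> unitary_mats N"
            "\<forall>j\<in>G. mat_norm2 (B C N j - U1 * B' j * mat_adjoint U1) < \<eta>"
            unfolding orbit_covers_def by blast
          then have U1: "near_orb C B' U1" using C by (simp add: near_orb_def conj_mat_def)
          then have D: "B' \<in> D" using B' by (auto simp: D_def)
          then obtain U2 where U2: "near_orb (sel B') B' U2" using sel by blast
          have u: "U1 \<in> unitary_mats N" "U2 \<in> unitary_mats N" and sm: "sel B' \<in> ?\<Gamma>"
            using U1 U2 by (auto simp: near_orb_def)
          note u1 = unitary_matsD[OF u(1)] and u2 = unitary_matsD[OF u(2)]
          let ?W = "U1 * mat_adjoint U2"
          have "mat_norm2 (C i - ?W * sel B' i * mat_adjoint ?W) < \<epsilon>" if i: "i \<in> F" for i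
          proof -
            let ?Y = "mat_eval N B' (Q i)" and ?A = "sel B' i"
            have c: "C i \<in> carrier_mat N N" "?A \<in> carrier_mat N N" "?Y \<in> carrier_mat N N"
              "conj_mat U2 ?Y \<in> carrier_mat N N" "conj_mat U1 ?Y \<in> carrier_mat N N"
              "conj_mat (mat_adjoint U2) ?A \<in> carrier_mat N N" "?W \<in> carrier_mat N N"
              "conj_mat ?W ?A \<in> carrier_mat N N"
              using C sm u1(1) u2(1) by (auto simp: microstates_def intro!: mult_carrier_mat[of _ N N] conj_mat_carrier)
            have "conj_mat U2 (conj_mat (mat_adjoint U2) ?A) = ?A"
              using conj_mat_conj_mat[OF u2(1) _ c(2), of "mat_adjoint U2"] u2 c(2)
              by (simp add: conj_mat_def)
            then have "mat_norm2 (conj_mat U2 ?Y - ?A) = mat_norm2 (conj_mat U2 (?Y - conj_mat (mat_adjoint U2) ?A))"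
              by (simp add: conj_mat_diff[OF u2(1) c(3) c(6)])
            also have "\<dots> = mat_norm2 (conj_mat U1 (?Y - conj_mat (mat_adjoint U2) ?A))"
              using mat_norm2_conj[OF u(1) _ N] mat_norm2_conj[OF u(2) _ N] minus_carrier_mat[OF c(6), of ?Y] by simp
            also have "\<dots> = mat_norm2 (conj_mat U1 ?Y - conj_mat ?W ?A)"
              using conj_mat_conj_mat[OF u1(1) _ c(2), of "mat_adjoint U2"] u2(1)
              by (simp add: conj_mat_diff[OF u1(1) c(3) c(6)])
            finally have "mat_norm2 (conj_mat U1 ?Y - conj_mat ?W ?A) < \<epsilon> / 2"
              using near_orb[OF B' U2 i] mat_norm2_triangle(2)[OF c(2) c(4) c(4) N] by simp
            moreover have "mat_norm2 (C i - conj_mat U1 ?Y) < \<epsilon> / 2"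
              by (rule near_orb[OF B' U1 i])
            ultimately show ?thesis
              using mat_norm2_triangle(1)[OF c(1) c(5) c(8) N] unfolding conj_mat_def[of ?W] by linarith
          qed
          moreover have "?W \<in> unitary_mats N" by (rule unitary_mats_mult[OF u(1) u2(4)])
          ultimately show "\<exists>B\<in>sel ` D. \<exists>U\<in>unitary_mats N. \<forall>i\<in>F. mat_norm2 (C i - U * B i * mat_adjoint U) < \<epsilon>"
            using D by blast
        qed
        moreover have "sel ` D \<subseteq> ?\<Gamma>" using sel by (auto simp: near_orb_def)
        moreover have "card (sel ` D) \<le> card \<Omega>\<^sub>0'"
          using card_image_le[OF fD, of sel] card_mono[OF \<Omega>'(2), of D] by (auto simp: D_def)
        ultimately show "\<exists>\<Omega>\<^sub>0. \<Omega>\<^sub>0 \<subseteq> ?\<Gamma> \<and> finite \<Omega>\<^sub>0 \<and> orbit_covers N F \<epsilon> \<Omega>\<^sub>0 ?\<Gamma> \<and> card \<Omega>\<^sub>0 \<le> card \<Omega>\<^sub>0'"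
          using fD by blast
      qed
      then have "growth R F \<epsilon> V \<le> growth S G \<eta> W" by (rule growth_mono)
      then show "\<exists>V\<in>{V. law_open R V \<and> {?lp} \<subseteq> V}. growth R F \<epsilon> V \<le> growth S G \<eta> W"
        using V by blast
    qed
    also have "\<dots> \<le> (SUP (F, \<epsilon>)\<in>{(F, \<epsilon>). finite F \<and> 0 < \<epsilon>}.
        INF V\<in>{V. law_open S V \<and> {?lq} \<subseteq> V}. growth S F \<epsilon> V)"
      using G \<eta>(1) by (intro SUP_upper2[of "(G, \<eta>)"]) auto
    finally show "(INF V\<in>{V. law_open R V \<and> {?lp} \<subseteq> V}. growth R F \<epsilon> V) \<le> \<dots>" .
  qed
qed


section \<open>Entropy of a compact set of laws\<close>

lemma microstates_UN: "microstates R N (\<Union>i\<in>I. V i) = (\<Union>i\<in>I. microstates R N (V i))"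
  by (auto simp: microstates_def)

lemma entropy1_mono: "K \<subseteq> L \<Longrightarrow> entropy1 R K \<le> entropy1 R L"
  unfolding entropy1_def
  by (intro SUP_mono) (auto intro!: INF_superset_mono)

lemma K_orb_witness:
  assumes "log_enat (K_orb N F \<epsilon> \<Omega>) / ereal ((real N)\<^sup>2) < ereal \<beta>" and N: "0 < N"
  shows "\<exists>\<Omega>\<^sub>0. \<Omega>\<^sub>0 \<subseteq> \<Omega> \<and> finite \<Omega>\<^sub>0 \<and> orbit_covers N F \<epsilon> \<Omega>\<^sub>0 \<Omega> \<and> real (card \<Omega>\<^sub>0) \<le> exp (\<beta> * (real N)\<^sup>2)"
proof -
  obtain n where n: "K_orb N F \<epsilon> \<Omega> = enat n"
    using assms by (cases "K_orb N F \<epsilon> \<Omega>") (auto simp: log_enat_def)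
  then have "K_orb N F \<epsilon> \<Omega> < enat (Suc n)" by simp
  then obtain \<Omega>\<^sub>0 where \<Omega>: "\<Omega>\<^sub>0 \<subseteq> \<Omega>" "finite \<Omega>\<^sub>0" "orbit_covers N F \<epsilon> \<Omega>\<^sub>0 \<Omega>" "card \<Omega>\<^sub>0 < Suc n"
    unfolding K_orb_def INF_less_iff by auto
  have "real n \<le> exp (\<beta> * (real N)\<^sup>2)"
  proof (cases "n = 0")
    case False
    then have "ln (real n) / (real N)\<^sup>2 < \<beta>"
      using assms n by (simp add: log_enat_def)
    then have "ln (real n) < \<beta> * (real N)\<^sup>2" using N by (simp add: divide_less_eq)
    then show ?thesis using False by (metis exp_ln_iff exp_less_cancel_iff less_imp_le of_nat_0_less_iff neq0_conv)
  qed simp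
  then have "real (card \<Omega>\<^sub>0) \<le> exp (\<beta> * (real N)\<^sup>2)" using \<Omega>(4) by linarith
  with \<Omega> show ?thesis by blast
qed

text \<open>The union of covers is a cover of the union. With \<open>m\<close> sets, each having a cover of at most
\<open>exp (\<beta> N\<^sup>2)\<close> elements, the factor \<open>m\<close> contributes \<open>ln m / N\<^sup>2\<close>, which tends to \<open>0\<close>.\<close>

lemma growth_UN_le:
  assumes I: "finite I" "I \<noteq> {}" and gr: "\<And>i. i \<in> I \<Longrightarrow> growth R F \<epsilon> (V i) < ereal \<beta>"
  shows "growth R F \<epsilon> (\<Union>i\<in>I. V i) \<le> ereal \<beta>"
proof -
  define m where "m = card I"
  have m: "0 < m" using I by (simp add: m_def card_gt_0_iff)
  have "\<forall>\<^sub>F N in sequentially. \<forall>i\<in>I. log_enat (K_orb N F \<epsilon> (microstates R N (V i))) / ereal ((real N)\<^sup>2) < ereal \<beta>"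
    using I(1) Limsup_lessD[OF gr] by (simp add: eventually_ball_finite_distrib)
  then have "\<forall>\<^sub>F N in sequentially. log_enat (K_orb N F \<epsilon> (microstates R N (\<Union>i\<in>I. V i))) / ereal ((real N)\<^sup>2)
      \<le> ereal (\<beta> + ln (real m) / real N)"
    using eventually_gt_at_top[of "0::nat"]
  proof eventually_elim
    fix N :: nat
    assume *: "\<forall>i\<in>I. log_enat (K_orb N F \<epsilon> (microstates R N (V i))) / ereal ((real N)\<^sup>2) < ereal \<beta>" and N: "0 < N"
    have "\<forall>i\<in>I. \<exists>W. W \<subseteq> microstates R N (V i) \<and> finite W \<and>
        orbit_covers N F \<epsilon> W (microstates R N (V i)) \<and> real (card W) \<le> exp (\<beta> * (real N)\<^sup>2)"
      using * K_orb_witness[OF _ N] by blast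
    then obtain W where W: "\<And>i. i \<in> I \<Longrightarrow> W i \<subseteq> microstates R N (V i)" "\<And>i. i \<in> I \<Longrightarrow> finite (W i)"
      "\<And>i. i \<in> I \<Longrightarrow> orbit_covers N F \<epsilon> (W i) (microstates R N (V i))"
      "\<And>i. i \<in> I \<Longrightarrow> real (card (W i)) \<le> exp (\<beta> * (real N)\<^sup>2)"
      by metis
    let ?W = "\<Union>i\<in>I. W i"
    have "real (card ?W) \<le> (\<Sum>i\<in>I. real (card (W i)))"
      using card_UN_le[OF I(1), of W] by (metis of_nat_le_iff of_nat_sum)
    also have "\<dots> \<le> (\<Sum>i\<in>I. exp (\<beta> * (real N)\<^sup>2))" by (intro sum_mono W)
    also have "\<dots> = real m * exp (\<beta> * (real N)\<^sup>2)" by (simp add: m_def)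
    finally have card: "real (card ?W) \<le> real m * exp (\<beta> * (real N)\<^sup>2)" .
    have "K_orb N F \<epsilon> (microstates R N (\<Union>i\<in>I. V i)) \<le> enat (card ?W)"
      unfolding K_orb_def microstates_UN
    proof (rule INF_lower, safe)
      show "finite ?W" using I W by auto
      show "orbit_covers N F \<epsilon> ?W (\<Union>i\<in>I. microstates R N (V i))"
        using W(3) unfolding orbit_covers_def by blast
    qed (use W(1) in auto)
    then have "log_enat (K_orb N F \<epsilon> (microstates R N (\<Union>i\<in>I. V i))) \<le> log_enat (enat (card ?W))"
      by (rule log_enat_mono)
    also have "\<dots> \<le> ereal (ln (real m) + \<beta> * (real N)\<^sup>2)"
    proof (cases "card ?W = 0")
      case False
      then have "ln (real (card ?W)) \<le> ln (real m * exp (\<beta> * (real N)\<^sup>2))"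
        using card by (intro ln_mono) auto
      then show ?thesis using False m by (simp add: log_enat_def ln_mult)
    qed (simp add: log_enat_def)
    finally have "log_enat (K_orb N F \<epsilon> (microstates R N (\<Union>i\<in>I. V i))) / ereal ((real N)\<^sup>2)
        \<le> ereal (ln (real m) + \<beta> * (real N)\<^sup>2) / ereal ((real N)\<^sup>2)"
      using N by (intro ereal_divide_right_mono) auto
    also have "\<dots> = ereal (\<beta> + ln (real m) / (real N)\<^sup>2)"
      using N by (simp add: field_simps)
    also have "\<dots> \<le> ereal (\<beta> + ln (real m) / real N)"
    proof -
      have "real N \<le> (real N)\<^sup>2" using N by (simp add: power2_eq_square)
      then have "ln (real m) / (real N)\<^sup>2 \<le> ln (real m) / real N"
        using m N by (intro divide_left_mono) auto
      then show ?thesis by simp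
    qed
    finally show "log_enat (K_orb N F \<epsilon> (microstates R N (\<Union>i\<in>I. V i))) / ereal ((real N)\<^sup>2)
        \<le> ereal (\<beta> + ln (real m) / real N)" .
  qed
  then have "growth R F \<epsilon> (\<Union>i\<in>I. V i) \<le> limsup (\<lambda>N. ereal (\<beta> + ln (real m) / real N))"
    by (rule Limsup_mono)
  also have "\<dots> = ereal \<beta>"
  proof (rule lim_imp_Limsup)
    have "(\<lambda>N. \<beta> + ln (real m) / real N) \<longlonglongrightarrow> \<beta> + 0"
      by (intro tendsto_intros lim_const_over_n)
    then show "(\<lambda>N. ereal (\<beta> + ln (real m) / real N)) \<longlonglongrightarrow> ereal \<beta>" by simp
  qed simp
  finally show ?thesis .
qed

text \<open>The supremum over \<open>F\<close> and \<open>\<epsilon>\<close> stands outside the infimum over neighbourhoods, so the covering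
argument is carried out for fixed \<open>F\<close> and \<open>\<epsilon>\<close>, for which each point of \<open>K\<close> has a good
neighbourhood.\<close>

theorem entropy1_compact:
  assumes K: "compact K" "K \<subseteq> law_space R" "K \<noteq> {}"
  shows "entropy1 R K = (SUP m\<in>K. entropy1 R {m})"
proof (rule antisym)
  show "(SUP m\<in>K. entropy1 R {m}) \<le> entropy1 R K"
    by (rule SUP_least) (auto intro: entropy1_mono)
  show "entropy1 R K \<le> (SUP m\<in>K. entropy1 R {m})"
  proof (subst entropy1_def, rule SUP_least, clarify)
    fix F :: "'a set" and \<epsilon> :: real assume F: "finite F" and \<epsilon>: "0 < \<epsilon>"
    show "(INF V\<in>{V. law_open R V \<and> K \<subseteq> V}. growth R F \<epsilon> V) \<le> (SUP m\<in>K. entropy1 R {m})"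
    proof (rule dense_ge)
      fix x assume x: "(SUP m\<in>K. entropy1 R {m}) < x"
      show "(INF V\<in>{V. law_open R V \<and> K \<subseteq> V}. growth R F \<epsilon> V) \<le> x"
      proof (cases x)
        case (real \<beta>)
        have "\<exists>T. open T \<and> m \<in> T \<and> growth R F \<epsilon> (law_space R \<inter> T) < ereal \<beta>" if m: "m \<in> K" for m
        proof -
          have "(INF V\<in>{V. law_open R V \<and> {m} \<subseteq> V}. growth R F \<epsilon> V) \<le> entropy1 R {m}"
            unfolding entropy1_def using F \<epsilon> by (intro SUP_upper2[of "(F, \<epsilon>)"]) auto
          also have "\<dots> \<le> (SUP m\<in>K. entropy1 R {m})" using m by (rule SUP_upper)
          also have "\<dots> < ereal \<beta>" using x real by simp
          finally obtain V where V: "law_open R V" "m \<in> V" "growth R F \<epsilon> V < ereal \<beta>"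
            by (auto simp: INF_less_iff)
          then obtain T where T: "open T" "V = law_space R \<inter> T"
            by (auto simp: law_open_def openin_open)
          with V show ?thesis by auto
        qed
        then have "\<forall>m\<in>K. \<exists>T. open T \<and> m \<in> T \<and> growth R F \<epsilon> (law_space R \<inter> T) < ereal \<beta>" ..
        from bchoice[OF this] obtain T where "\<forall>m\<in>K. open (T m) \<and> m \<in> T m \<and> growth R F \<epsilon> (law_space R \<inter> T m) < ereal \<beta>" ..
        then have T: "\<And>m. m \<in> K \<Longrightarrow> open (T m)" "\<And>m. m \<in> K \<Longrightarrow> m \<in> T m"
          "\<And>m. m \<in> K \<Longrightarrow> growth R F \<epsilon> (law_space R \<inter> T m) < ereal \<beta>" by auto
        obtain I where I: "I \<subseteq> K" "finite I" "K \<subseteq> (\<Union>m\<in>I. T m)"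
          by (rule compactE_image[OF K(1), of K T]) (use T in auto)
        then have "I \<noteq> {}" using K(3) by auto
        let ?V = "\<Union>m\<in>I. law_space R \<inter> T m"
        have "law_open R ?V"
          unfolding law_open_def using I(1) T(1) by (intro openin_Union) (auto simp: openin_open)
        moreover have "K \<subseteq> ?V" using I(3) K(2) by auto
        moreover have "growth R F \<epsilon> ?V \<le> ereal \<beta>"
          by (rule growth_UN_le[OF I(2) \<open>I \<noteq> {}\<close>]) (use I(1) T(3) in auto)
        ultimately show ?thesis unfolding real by (intro INF_lower2[of ?V]) auto
      qed (use x in auto)
    qed
  qed
qed


section \<open>Traces of C*-algebras\<close>

interpretation cs: star_algebra "star :: 'a::cstar_algebra \<Rightarrow> 'a" "\<lambda>c. c *\<^sub>C 1"
proof
  fix c d :: complex and x :: 'a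
  have 1: "1 *\<^sub>C x = x" for x :: 'a using scaleR_scaleC[of 1 x] by simp
  have "star (star (1 :: 'a) * 1) = star 1 * star (star 1)" by (rule star_mult)
  then have s1: "star (1 :: 'a) = 1" by (simp add: star_star)
  show "star (star x) = x" by (rule star_star)
  show "star (c *\<^sub>C 1 :: 'a) = cnj c *\<^sub>C 1" by (simp add: star_scaleC s1)
  show "(c * d) *\<^sub>C 1 = c *\<^sub>C 1 * d *\<^sub>C (1 :: 'a)" by (simp add: mult_scaleC_left scaleC_scaleC)
  show "1 *\<^sub>C 1 = (1 :: 'a)" by (rule 1)
  show "x * c *\<^sub>C 1 = c *\<^sub>C 1 * x" by (simp add: mult_scaleC_left mult_scaleC_right)
qed (simp_all add: star_add star_mult scaleC_add_left)

lemma scaleC_eq_mult: "c *\<^sub>C x = (c *\<^sub>C 1) * (x :: 'a::cstar_algebra)"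
  by (simp add: mult_scaleC_left)

lemma tracial_trace:
  assumes "is_trace (\<tau> :: 'a::cstar_algebra \<Rightarrow> complex)"
  shows "tracial_functional star (\<lambda>c. c *\<^sub>C 1) \<tau>"
  using assms unfolding is_trace_def
  by unfold_locales (auto simp flip: scaleC_eq_mult)

lemma norm_star [simp]: "norm (star x) = norm (x :: 'a::cstar_algebra)"
proof -
  have le: "norm x \<le> norm (star x)" for x :: 'a
  proof (cases "x = 0")
    case False
    have "norm x * norm x \<le> norm (star x) * norm x"
      using norm_star_mult[of x] norm_mult_ineq[of "star x" x] by (simp add: power2_eq_square)
    then show ?thesis using False by simp
  qed simp
  show ?thesis using le[of x] le[of "star x"] by (simp add: star_star)
qed

lemma continuous_on_star: "continuous_on S (star :: 'a::cstar_algebra \<Rightarrow> 'a)"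
  unfolding continuous_on_iff
  by (auto simp: dist_norm simp flip: cs.st_diff)

text \<open>The square root of \<open>1 - h\<close> is \<open>1 - s\<close>, with \<open>s\<close> the fixed point of \<open>s \<mapsto> (h + s\<^sup>2) / 2\<close>.\<close>

lemma sqrt_one_minus:
  fixes h :: "'a::cstar_algebra"
  assumes h: "star h = h" "norm h < 1"
  shows "\<exists>y. star y = y \<and> y * y = 1 - h"
proof -
  define r where "r = norm h"
  have r: "0 \<le> r" "r < 1" using h by (auto simp: r_def)
  define D where "D = {s :: 'a. norm s \<le> r \<and> star s = s}"
  define f where "f s = (1 / 2) *\<^sub>R (h + s * s)" for s
  have "closed D" unfolding D_def
    by (intro closed_Collect_conj closed_Collect_le closed_Collect_eq continuous_intros continuous_on_star)
  have rs: "norm (s * s) \<le> r" if "norm s \<le> r" for s :: 'a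
  proof -
    have "norm (s * s) \<le> norm s * norm s" by (rule norm_mult_ineq)
    also have "\<dots> \<le> r * 1" using that r by (intro mult_mono) auto
    finally show ?thesis by simp
  qed
  have "\<exists>!s\<in>D. f s = s"
  proof (rule Banach_fix)
    show "complete D" using \<open>closed D\<close> by (simp add: complete_eq_closed)
    show "D \<noteq> {}" using r by (auto simp: D_def intro!: exI[of _ 0])
    show "f ` D \<subseteq> D"
    proof safe
      fix s assume s: "s \<in> D"
      then have "norm (h + s * s) \<le> r + r"
        using rs by (intro order_trans[OF norm_triangle_ineq]) (auto simp: D_def r_def intro: add_mono)
      then have "norm (f s) \<le> r" by (simp add: f_def)
      moreover have "star (f s) = f s"
        using s h by (simp add: f_def D_def scaleR_scaleC star_scaleC star_add star_mult)
      ultimately show "f s \<in> D" by (simp add: D_def)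
    qed
    show "dist (f s) (f t) \<le> r * dist s t" if "s \<in> D" "t \<in> D" for s t
    proof -
      have "norm (s * s - t * t) \<le> norm (s * (s - t)) + norm ((s - t) * t)"
        using norm_triangle_ineq[of "s * (s - t)" "(s - t) * t"] by (simp add: algebra_simps)
      also have "\<dots> \<le> r * norm (s - t) + norm (s - t) * r"
        using that r by (intro add_mono order_trans[OF norm_mult_ineq] mult_mono) (auto simp: D_def)
      finally have "norm (s * s - t * t) \<le> 2 * (r * norm (s - t))" by simp
      then show ?thesis by (simp add: f_def dist_norm flip: scaleR_diff_right)
    qed
  qed (use r in auto)
  then obtain s where s: "star s = s" "f s = s" unfolding D_def by blast
  have "2 *\<^sub>R f s = h + s * s" by (simp add: f_def)
  then have "s + s = h + s * s" unfolding s(2) by (simp add: scaleR_2)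
  then have "(1 - s) * (1 - s) = 1 - h" by (simp add: algebra_simps)
  moreover have "star (1 - s) = 1 - s" using s by (simp add: cs.st_diff)
  ultimately show ?thesis by blast
qed

text \<open>If \<open>\<parallel>x\<parallel> < 1\<close>, then \<open>1 - x\<^sup>*x = y\<^sup>2\<close> with \<open>y\<close> self-adjoint, and positivity of \<open>\<tau>\<close> at \<open>yq\<close> gives the
estimate. The general case follows by scaling \<open>x\<close> to norm slightly below \<open>1\<close>.\<close>

lemma trace_bdd_norm:
  assumes \<tau>: "is_trace (\<tau> :: 'a::cstar_algebra \<Rightarrow> complex)"
  shows "positive_functional.bdd star \<tau> (norm x) x"
proof -
  interpret tracial_functional star "\<lambda>c. c *\<^sub>C 1" \<tau> by (rule tracial_trace[OF \<tau>])
  have small: "nrm (x * q) \<le> nrm q" if x: "norm x < 1" for x q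
  proof -
    have "norm (star x * x) < 1" unfolding norm_star_mult using x by (simp add: power_less_one_iff abs_square_less_1)
    then obtain y where y: "star y = y" "y * y = 1 - star x * x"
      using sqrt_one_minus[of "star x * x"] by (auto simp: star_mult star_star)
    have "star (y * q) * (y * q) = star q * ((y * y) * q)"
      by (simp add: star_mult y(1) mult.assoc)
    also have "\<dots> = star q * q - star (x * q) * (x * q)"
      unfolding y(2) by (simp add: algebra_simps star_mult)
    finally have "(nrm (y * q))\<^sup>2 = (nrm q)\<^sup>2 - (nrm (x * q))\<^sup>2"
      unfolding nrm_sq by (simp add: \<phi>_diff)
    then have "(nrm (x * q))\<^sup>2 \<le> (nrm q)\<^sup>2" using zero_le_power2[of "nrm (y * q)"] by linarith
    then show ?thesis by (rule power2_le_imp_le) simp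
  qed
  have large: "nrm (x * q) \<le> c * nrm q" if c: "norm x < c" for c q
  proof -
    have c0: "0 < c" using c norm_ge_zero[of x] by linarith
    let ?d = "complex_of_real (1 / c)"
    have d: "cmod ?d = 1 / c" unfolding norm_of_real using c0 by simp
    have "norm (?d *\<^sub>C x) < 1" unfolding norm_scaleC d using c c0 by simp
    then have "nrm ((?d *\<^sub>C x) * q) \<le> nrm q" by (rule small)
    also have "(?d *\<^sub>C x) * q = (?d *\<^sub>C 1) * (x * q)" by (simp add: mult_scaleC_left)
    finally show ?thesis unfolding nrm_sc d using c0 by (simp add: field_simps)
  qed
  show ?thesis
  proof (rule bddI)
    fix q
    show "nrm (x * q) \<le> norm x * nrm q"
    proof (rule field_le_epsilon)
      fix e :: real assume e: "0 < e"
      have "nrm (x * q) \<le> (norm x + e / (nrm q + 1)) * nrm q"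
        using e by (intro large) (simp add: add_nonneg_pos)
      also have "\<dots> = norm x * nrm q + e * (nrm q / (nrm q + 1))" by (simp add: algebra_simps)
      also have "\<dots> \<le> norm x * nrm q + e * 1"
        using e by (intro add_left_mono mult_left_mono) (simp_all add: add_nonneg_pos)
      finally show "nrm (x * q) \<le> norm x * nrm q + e" by simp
    qed
  qed simp
qed

lemma trace_norm_le:
  assumes \<tau>: "is_trace (\<tau> :: 'a::cstar_algebra \<Rightarrow> complex)"
  shows "cmod (\<tau> x) \<le> norm x"
proof -
  interpret tracial_functional star "\<lambda>c. c *\<^sub>C 1" \<tau> by (rule tracial_trace[OF \<tau>])
  show ?thesis using \<phi>_le_nrm[of x] bdd_nrm_le[OF trace_bdd_norm[OF \<tau>], of x] by linarith
qed

lemma compact_complex_disc: "compact {z :: complex. cmod z \<le> r}"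
proof -
  let ?f = "\<lambda>p. complex_of_real (fst p) + \<i> * complex_of_real (snd p)"
  have "compact (?f ` ({- r..r} \<times> {- r..r}))"
    by (intro compact_continuous_image compact_Times compact_Icc continuous_intros)
  moreover have "closed {z :: complex. cmod z \<le> r}"
    by (intro closed_Collect_le continuous_intros)
  ultimately have "compact (?f ` ({- r..r} \<times> {- r..r}) \<inter> {z. cmod z \<le> r})"
    by (rule compact_Int_closed)
  moreover have "{z. cmod z \<le> r} \<subseteq> ?f ` ({- r..r} \<times> {- r..r})"
  proof
    fix z assume "z \<in> {z. cmod z \<le> r}"
    then have "\<bar>Re z\<bar> \<le> r" "\<bar>Im z\<bar> \<le> r"
      using abs_Re_le_cmod[of z] abs_Im_le_cmod[of z] by auto
    then show "z \<in> ?f ` ({- r..r} \<times> {- r..r})"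
      by (intro image_eqI[of _ _ "(Re z, Im z)"]) (auto simp: complex_eq_iff)
  qed
  ultimately show ?thesis by (simp add: Int_absorb1)
qed

text \<open>By the bound \<open>\<bar>\<tau>(x)\<bar> \<le> \<parallel>x\<parallel>\<close> the traces form a closed subset of a product of discs, which is compact by
Tychonoff's theorem.\<close>

lemma compact_traces: "compact (traces :: ('a::cstar_algebra \<Rightarrow> complex) set)"
proof -
  let ?B = "Pi\<^sub>E UNIV (\<lambda>x::'a. {z. cmod z \<le> norm x})"
  have "compactin (product_topology (\<lambda>_. euclidean) UNIV) ?B"
    unfolding compactin_PiE by (simp add: compact_complex_disc)
  then have B: "compact ?B" by (simp add: euclidean_product_topology)
  have "closed (traces :: ('a \<Rightarrow> complex) set)"
  proof -
    have "traces = {\<tau> :: 'a \<Rightarrow> complex.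
        (\<forall>x y. \<tau> (x + y) = \<tau> x + \<tau> y) \<and> (\<forall>c x. \<tau> (c *\<^sub>C x) = c * \<tau> x) \<and>
        (\<forall>x. 0 \<le> Re (\<tau> (star x * x)) \<and> Im (\<tau> (star x * x)) = 0) \<and> \<tau> 1 = 1 \<and>
        (\<forall>x y. \<tau> (x * y) = \<tau> (y * x))}"
      by (simp add: traces_def is_trace_def complex_nonneg_Reals_iff)
    also have "closed \<dots>"
      by (intro closed_Collect_conj closed_Collect_all closed_Collect_eq closed_Collect_le
          continuous_intros continuous_on_product_coordinates)
    finally show ?thesis .
  qed
  moreover have "traces \<subseteq> ?B" by (auto simp: traces_def trace_norm_le)
  ultimately show ?thesis using compact_Int_closed[OF B, of traces] by (simp add: Int_absorb1)
qed

lemma compact_trace_laws: "compact (trace_laws a)"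
  unfolding trace_laws_def
proof (rule compact_continuous_image[OF _ compact_traces])
  have "continuous_on UNIV (\<lambda>\<tau>. trace_law \<tau> a)"
    unfolding trace_law_def nc_law_def
    by (intro continuous_on_coordinatewise_then_product continuous_intros continuous_on_product_coordinates)
  then show "continuous_on traces (\<lambda>\<tau>. trace_law \<tau> a)" by (rule continuous_on_subset) simp
qed


section \<open>Hilbert spaces on a carrier set\<close>

lemma tendsto_0_of_norm_le:
  assumes "\<forall>\<^sub>F n in F. norm (f n) \<le> g n" "(g \<longlongrightarrow> (0::real)) F"
  shows "(f \<longlongrightarrow> 0) F"
  by (rule tendsto_0_le[OF assms(2), of f 1], rule eventually_mono[OF assms(1)]) simp

text \<open>Vectors are separated by their inner products (\<open>hvec_eqI\<close>), so every linear identity between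
vectors, the laws of a vector space among them, reduces to one between complex numbers.\<close>

locale hilbert_space =
  fixes H :: "'h hilbert"
  assumes hadd_closed [simp]: "\<xi> \<in> hcarrier H \<Longrightarrow> \<eta> \<in> hcarrier H \<Longrightarrow> hadd H \<xi> \<eta> \<in> hcarrier H"
    and hscale_closed [simp]: "\<xi> \<in> hcarrier H \<Longrightarrow> hscale H c \<xi> \<in> hcarrier H"
    and hcarrier_nonempty: "hcarrier H \<noteq> {}"
    and hinner_add [simp]: "\<xi> \<in> hcarrier H \<Longrightarrow> \<eta> \<in> hcarrier H \<Longrightarrow> \<zeta> \<in> hcarrier H \<Longrightarrow>
      hinner H (hadd H \<xi> \<eta>) \<zeta> = hinner H \<xi> \<zeta> + hinner H \<eta> \<zeta>"
    and hinner_scale [simp]: "\<xi> \<in> hcarrier H \<Longrightarrow> \<zeta> \<in> hcarrier H \<Longrightarrow>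
      hinner H (hscale H c \<xi>) \<zeta> = c * hinner H \<xi> \<zeta>"
    and hinner_cnj: "\<xi> \<in> hcarrier H \<Longrightarrow> \<eta> \<in> hcarrier H \<Longrightarrow> hinner H \<xi> \<eta> = cnj (hinner H \<eta> \<xi>)"
    and hinner_ge0: "\<xi> \<in> hcarrier H \<Longrightarrow> 0 \<le> Re (hinner H \<xi> \<xi>)"
    and hvec_eqI: "\<xi> \<in> hcarrier H \<Longrightarrow> \<eta> \<in> hcarrier H \<Longrightarrow>
      (\<And>\<zeta>. \<zeta> \<in> hcarrier H \<Longrightarrow> hinner H \<xi> \<zeta> = hinner H \<eta> \<zeta>) \<Longrightarrow> \<xi> = \<eta>"
    and hcomplete: "(\<And>n. s n \<in> hcarrier H) \<Longrightarrow>
      (\<And>e. 0 < e \<Longrightarrow> \<exists>M. \<forall>m\<ge>M. \<forall>n\<ge>M. hnorm H (hadd H (s m) (hscale H (-1) (s n))) < e) \<Longrightarrow>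
      \<exists>l\<in>hcarrier H. (\<lambda>n. hnorm H (hadd H (s n) (hscale H (-1) l))) \<longlonglongrightarrow> 0"
begin

abbreviation C where "C \<equiv> hcarrier H"
abbreviation ip where "ip \<equiv> hinner H"
abbreviation hn where "hn \<equiv> hnorm H"

definition hsub :: "'h \<Rightarrow> 'h \<Rightarrow> 'h" where
  "hsub \<xi> \<eta> = hadd H \<xi> (hscale H (-1) \<eta>)"

lemma hsub_closed [simp]: "\<xi> \<in> C \<Longrightarrow> \<eta> \<in> C \<Longrightarrow> hsub \<xi> \<eta> \<in> C"
  by (simp add: hsub_def)

lemma ip_sub [simp]: "\<xi> \<in> C \<Longrightarrow> \<eta> \<in> C \<Longrightarrow> \<zeta> \<in> C \<Longrightarrow> ip (hsub \<xi> \<eta>) \<zeta> = ip \<xi> \<zeta> - ip \<eta> \<zeta>"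
  by (simp add: hsub_def)

lemma ip_add_right [simp]: "\<xi> \<in> C \<Longrightarrow> \<eta> \<in> C \<Longrightarrow> \<zeta> \<in> C \<Longrightarrow> ip \<zeta> (hadd H \<xi> \<eta>) = ip \<zeta> \<xi> + ip \<zeta> \<eta>"
  using hinner_cnj[of \<zeta> "hadd H \<xi> \<eta>"] hinner_cnj[of \<zeta> \<xi>] hinner_cnj[of \<zeta> \<eta>] by simp

lemma ip_scale_right [simp]: "\<xi> \<in> C \<Longrightarrow> \<zeta> \<in> C \<Longrightarrow> ip \<zeta> (hscale H c \<xi>) = cnj c * ip \<zeta> \<xi>"
  using hinner_cnj[of \<zeta> "hscale H c \<xi>"] hinner_cnj[of \<zeta> \<xi>] by simp

lemma ip_sub_right [simp]: "\<xi> \<in> C \<Longrightarrow> \<eta> \<in> C \<Longrightarrow> \<zeta> \<in> C \<Longrightarrow> ip \<zeta> (hsub \<xi> \<eta>) = ip \<zeta> \<xi> - ip \<zeta> \<eta>"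
  by (simp add: hsub_def)

lemma ip_self: "\<xi> \<in> C \<Longrightarrow> ip \<xi> \<xi> = complex_of_real ((hn \<xi>)\<^sup>2)"
  using hinner_cnj[of \<xi> \<xi>] hinner_ge0[of \<xi>] by (simp add: hnorm_def complex_eq_iff)

lemma hn_sq: "\<xi> \<in> C \<Longrightarrow> (hn \<xi>)\<^sup>2 = Re (ip \<xi> \<xi>)"
  by (simp add: ip_self)

lemma hn_ge0 [simp]: "\<xi> \<in> C \<Longrightarrow> 0 \<le> hn \<xi>"
  by (simp add: hnorm_def hinner_ge0)

lemma hn_add_sq:
  "\<xi> \<in> C \<Longrightarrow> \<eta> \<in> C \<Longrightarrow> (hn (hadd H \<xi> \<eta>))\<^sup>2 = (hn \<xi>)\<^sup>2 + (hn \<eta>)\<^sup>2 + 2 * Re (ip \<xi> \<eta>)"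
  using hinner_cnj[of \<eta> \<xi>] by (simp add: hn_sq)

lemma hn_scale: "\<xi> \<in> C \<Longrightarrow> hn (hscale H c \<xi>) = cmod c * hn \<xi>"
proof -
  assume \<xi>: "\<xi> \<in> C"
  have "ip (hscale H c \<xi>) (hscale H c \<xi>) = (c * cnj c) * ip \<xi> \<xi>" using \<xi> by simp
  also have "\<dots> = complex_of_real ((cmod c * hn \<xi>)\<^sup>2)"
    unfolding ip_self[OF \<xi>] complex_norm_square[symmetric] power_mult_distrib of_real_mult ..
  finally have "ip (hscale H c \<xi>) (hscale H c \<xi>) = complex_of_real ((cmod c * hn \<xi>)\<^sup>2)" .
  then have "(hn (hscale H c \<xi>))\<^sup>2 = (cmod c * hn \<xi>)\<^sup>2"
    using \<xi> by (simp only: hn_sq hscale_closed Re_complex_of_real)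
  then show ?thesis using \<xi> by (simp add: power2_eq_iff_nonneg)
qed

lemma hn_sub_sq:
  "\<xi> \<in> C \<Longrightarrow> \<eta> \<in> C \<Longrightarrow> (hn (hsub \<xi> \<eta>))\<^sup>2 = (hn \<xi>)\<^sup>2 + (hn \<eta>)\<^sup>2 - 2 * Re (ip \<xi> \<eta>)"
  unfolding hsub_def by (simp add: hn_add_sq hn_scale)

lemma hCauchy_Schwarz:
  assumes \<xi>: "\<xi> \<in> C" and \<eta>: "\<eta> \<in> C"
  shows "cmod (ip \<xi> \<eta>) \<le> hn \<xi> * hn \<eta>"
proof -
  define b where "b = ip \<xi> \<eta>"
  have "0 \<le> (hn \<xi>)\<^sup>2 - 2 * t * (cmod b)\<^sup>2 + t\<^sup>2 * (cmod b)\<^sup>2 * (hn \<eta>)\<^sup>2" for t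
  proof -
    have "Re (ip \<xi> (hscale H (complex_of_real t * b) \<eta>)) = t * (cmod b)\<^sup>2"
    proof -
      have "ip \<xi> (hscale H (complex_of_real t * b) \<eta>) = complex_of_real t * (b * cnj b)"
        using \<xi> \<eta> by (simp add: b_def)
      also have "\<dots> = complex_of_real (t * (cmod b)\<^sup>2)"
        unfolding complex_norm_square[symmetric] of_real_mult ..
      finally show ?thesis by (simp only: Re_complex_of_real)
    qed
    then have "(hn (hsub \<xi> (hscale H (complex_of_real t * b) \<eta>)))\<^sup>2
        = (hn \<xi>)\<^sup>2 - 2 * t * (cmod b)\<^sup>2 + t\<^sup>2 * (cmod b)\<^sup>2 * (hn \<eta>)\<^sup>2"
      using \<xi> \<eta> by (simp add: hn_sub_sq hn_scale norm_mult power_mult_distrib)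
    then show ?thesis by (metis zero_le_power2)
  qed
  then have "(cmod b)\<^sup>2 \<le> (hn \<xi>)\<^sup>2 * (hn \<eta>)\<^sup>2" by (rule quadratic_nonneg_bound) simp
  then show ?thesis
    unfolding b_def using \<xi> \<eta> by (metis power_mult_distrib power2_le_imp_le mult_nonneg_nonneg hn_ge0)
qed

lemma hn_triangle:
  assumes "\<xi> \<in> C" "\<eta> \<in> C"
  shows "hn (hadd H \<xi> \<eta>) \<le> hn \<xi> + hn \<eta>"
proof -
  have "(hn (hadd H \<xi> \<eta>))\<^sup>2 \<le> (hn \<xi> + hn \<eta>)\<^sup>2"
    using assms hCauchy_Schwarz[of \<xi> \<eta>] complex_Re_le_cmod[of "ip \<xi> \<eta>"]
    by (simp add: hn_add_sq power2_sum)
  then show ?thesis by (rule power2_le_imp_le) (use assms in simp)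
qed

lemma hn_eq_0:
  assumes "\<xi> \<in> C" "\<eta> \<in> C" "hn (hsub \<xi> \<eta>) = 0"
  shows "\<xi> = \<eta>"
proof (rule hvec_eqI[OF assms(1,2)])
  fix \<zeta> assume \<zeta>: "\<zeta> \<in> C"
  have "cmod (ip (hsub \<xi> \<eta>) \<zeta>) \<le> 0"
    using hCauchy_Schwarz[of "hsub \<xi> \<eta>" \<zeta>] assms \<zeta> by simp
  then show "ip \<xi> \<zeta> = ip \<eta> \<zeta>" using assms \<zeta> by simp
qed

lemma hsub_hadd: "a \<in> C \<Longrightarrow> b \<in> C \<Longrightarrow> c \<in> C \<Longrightarrow> hadd H (hsub a b) (hsub b c) = hsub a c"
  by (rule hvec_eqI) auto

lemma hn_sub_triangle: "a \<in> C \<Longrightarrow> b \<in> C \<Longrightarrow> c \<in> C \<Longrightarrow> hn (hsub a c) \<le> hn (hsub a b) + hn (hsub b c)"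
  using hn_triangle[of "hsub a b" "hsub b c"] by (simp add: hsub_hadd)

lemma hn_sub_commute: "a \<in> C \<Longrightarrow> b \<in> C \<Longrightarrow> hn (hsub a b) = hn (hsub b a)"
proof -
  assume ab: "a \<in> C" "b \<in> C"
  then have "hsub a b = hscale H (-1) (hsub b a)" by (intro hvec_eqI) auto
  then show ?thesis using ab by (simp add: hn_scale)
qed

lemma abs_hn_diff: "a \<in> C \<Longrightarrow> b \<in> C \<Longrightarrow> \<bar>hn a - hn b\<bar> \<le> hn (hsub a b)"
proof -
  assume ab: "a \<in> C" "b \<in> C"
  have "hadd H (hsub a b) b = a" "hadd H (hsub b a) a = b" using ab by (auto intro!: hvec_eqI)
  then show ?thesis
    using hn_triangle[of "hsub a b" b] hn_triangle[of "hsub b a" a] ab hn_sub_commute[of a b] by simp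
qed


subsection \<open>Closed subspaces and the representation theorem\<close>

definition hsubspace :: "'h set \<Rightarrow> bool" where
  "hsubspace K \<longleftrightarrow> K \<subseteq> C \<and> K \<noteq> {} \<and> (\<forall>\<xi>\<in>K. \<forall>\<eta>\<in>K. hadd H \<xi> \<eta> \<in> K) \<and> (\<forall>c. \<forall>\<xi>\<in>K. hscale H c \<xi> \<in> K)"

definition hclosure :: "'h set \<Rightarrow> 'h set" where
  "hclosure D = {l \<in> C. \<forall>e>0. \<exists>d\<in>D. hn (hsub l d) < e}"

lemma hsubspace_carrier: "hsubspace C"
  using hcarrier_nonempty by (simp add: hsubspace_def)

lemma hsubspace_sub: "hsubspace K \<Longrightarrow> \<xi> \<in> K \<Longrightarrow> \<eta> \<in> K \<Longrightarrow> hsub \<xi> \<eta> \<in> K"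
  by (simp add: hsubspace_def hsub_def)

lemma hclosure_carrier: "hclosure C = C"
proof -
  have "hn (hsub l l) = 0" if "l \<in> C" for l using that hn_sub_sq[of l l] by (simp add: ip_self)
  then show ?thesis unfolding hclosure_def by force
qed

text \<open>The function \<open>J(\<xi>) = \<parallel>\<xi>\<parallel>\<^sup>2 - 2 Re f(\<xi>)\<close> has a minimum on \<open>K\<close>, because minimizing sequences are Cauchy by
the parallelogram law, and the variation of \<open>J\<close> at a minimum \<open>k\<close> vanishes only if \<open>f = \<langle>\<cdot>, k\<rangle>\<close>. For the
whole space this yields adjoints, and for \<open>f = \<langle>\<cdot>, \<eta>\<rangle>\<close> the orthogonal projection of \<open>\<eta>\<close> onto \<open>K\<close>.\<close>

lemma riesz:
  assumes K: "hsubspace K" "hclosure K = K"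
    and f_add: "\<And>\<xi> \<eta>. \<xi> \<in> K \<Longrightarrow> \<eta> \<in> K \<Longrightarrow> f (hadd H \<xi> \<eta>) = f \<xi> + f \<eta>"
    and f_scale: "\<And>c \<xi>. \<xi> \<in> K \<Longrightarrow> f (hscale H c \<xi>) = c * f \<xi>"
    and f_bound: "\<And>\<xi>. \<xi> \<in> K \<Longrightarrow> cmod (f \<xi>) \<le> B * hn \<xi>"
  shows "\<exists>k\<in>K. \<forall>\<xi>\<in>K. f \<xi> = ip \<xi> k"
proof -
  have KC: "\<xi> \<in> C" if "\<xi> \<in> K" for \<xi> using that K(1) by (auto simp: hsubspace_def)
  have Kadd: "hadd H \<xi> \<eta> \<in> K" if "\<xi> \<in> K" "\<eta> \<in> K" for \<xi> \<eta> using that K(1) by (auto simp: hsubspace_def)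
  have Kscale: "hscale H c \<xi> \<in> K" if "\<xi> \<in> K" for c \<xi> using that K(1) by (auto simp: hsubspace_def)
  have Kne: "K \<noteq> {}" using K(1) by (auto simp: hsubspace_def)
  define J where "J \<xi> = (hn \<xi>)\<^sup>2 - 2 * Re (f \<xi>)" for \<xi>
  have J_lower: "- (B\<^sup>2) \<le> J \<xi>" if "\<xi> \<in> K" for \<xi>
  proof -
    have "2 * Re (f \<xi>) \<le> 2 * (B * hn \<xi>)"
      using f_bound[OF that] complex_Re_le_cmod[of "f \<xi>"] by simp
    moreover have "0 \<le> (hn \<xi> - B)\<^sup>2" by simp
    ultimately show ?thesis unfolding J_def power2_diff by (simp add: mult.commute mult.assoc)
  qed
  define d where "d = Inf (J ` K)"
  have bddJ: "bdd_below (J ` K)" using J_lower by (auto simp: bdd_below_def)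
  have d: "d \<le> J \<xi>" if "\<xi> \<in> K" for \<xi> unfolding d_def using that bddJ by (intro cInf_lower) auto
  have "\<exists>\<xi>\<in>K. J \<xi> < d + 1 / real (Suc n)" for n
    using cInf_lessD[of "J ` K" "d + 1 / real (Suc n)"] Kne unfolding d_def by auto
  then obtain s where s: "\<And>n. s n \<in> K" "\<And>n. J (s n) < d + 1 / real (Suc n)" by metis
  have par: "(hn (hsub \<xi> \<eta>))\<^sup>2 \<le> 2 * (J \<xi> - d) + 2 * (J \<eta> - d)" if "\<xi> \<in> K" "\<eta> \<in> K" for \<xi> \<eta>
  proof -
    define m where "m = hscale H (1 / 2) (hadd H \<xi> \<eta>)"
    have "m \<in> K" using that by (simp add: m_def Kadd Kscale)
    then have "d \<le> J m" by (rule d)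
    moreover have "(hn m)\<^sup>2 = (hn (hadd H \<xi> \<eta>))\<^sup>2 / 4"
      using that KC by (simp add: m_def hn_scale power_mult_distrib power2_eq_square)
    moreover have "Re (f m) = (Re (f \<xi>) + Re (f \<eta>)) / 2"
      using that by (simp add: m_def f_scale f_add Kadd)
    moreover have "(hn (hsub \<xi> \<eta>))\<^sup>2 + (hn (hadd H \<xi> \<eta>))\<^sup>2 = 2 * (hn \<xi>)\<^sup>2 + 2 * (hn \<eta>)\<^sup>2"
      using that KC by (simp add: hn_sub_sq hn_add_sq)
    ultimately show ?thesis unfolding J_def by argo
  qed
  have "\<exists>M. \<forall>m\<ge>M. \<forall>n\<ge>M. hn (hadd H (s m) (hscale H (-1) (s n))) < e" if e: "0 < e" for e
  proof -
    obtain M where M: "4 / e\<^sup>2 < real M" using reals_Archimedean2 by blast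
    have "hn (hsub (s m) (s n)) < e" if "m \<ge> M" "n \<ge> M" for m n
    proof -
      have "J (s k) < d + e\<^sup>2 / 4" if "M \<le> k" for k
      proof -
        have "4 / e\<^sup>2 < real (Suc k)" using M that by linarith
        then have "1 / real (Suc k) < e\<^sup>2 / 4" using e by (simp add: field_simps)
        then have "d + 1 / real (Suc k) < d + e\<^sup>2 / 4" by simp
        with s(2)[of k] show ?thesis by (rule less_trans)
      qed
      from this[OF \<open>m \<ge> M\<close>] this[OF \<open>n \<ge> M\<close>]
      have "2 * (J (s m) - d) + 2 * (J (s n) - d) < 2 * (e\<^sup>2 / 4) + 2 * (e\<^sup>2 / 4)"
        by (intro add_strict_mono mult_strict_left_mono) auto
      then have "2 * (J (s m) - d) + 2 * (J (s n) - d) < e\<^sup>2" by simp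
      with par[OF s(1)[of m] s(1)[of n]] have "(hn (hsub (s m) (s n)))\<^sup>2 < e\<^sup>2" by linarith
      then show ?thesis by (rule power2_less_imp_less) (use e in simp)
    qed
    then show ?thesis unfolding hsub_def by blast
  qed
  then obtain k where k: "k \<in> C" "(\<lambda>n. hn (hsub (s n) k)) \<longlonglongrightarrow> 0"
    using hcomplete[of s] KC s(1) unfolding hsub_def by metis
  have "k \<in> hclosure K"
  proof -
    have "\<exists>d\<in>K. hn (hsub k d) < e" if "0 < e" for e
    proof -
      have "\<forall>\<^sub>F n in sequentially. hn (hsub (s n) k) < e" using order_tendstoD(2)[OF k(2) that] .
      then obtain n where "hn (hsub (s n) k) < e" by (auto simp: eventually_sequentially)
      then show ?thesis
        by (intro bexI[OF _ s(1)[of n]]) (simp only: hn_sub_commute[OF k(1) KC[OF s(1)]])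
    qed
    then show ?thesis using k(1) by (simp add: hclosure_def)
  qed
  then have kK: "k \<in> K" using K(2) by simp
  have "(\<lambda>n. J (s n)) \<longlonglongrightarrow> J k"
  proof -
    have "(\<lambda>n. hn (s n)) \<longlonglongrightarrow> hn k"
      by (rule LIM_zero_cancel, rule tendsto_0_of_norm_le[OF always_eventually k(2)])
        (use abs_hn_diff[OF KC[OF s(1)] k(1)] in auto)
    moreover have "(\<lambda>n. f (s n)) \<longlonglongrightarrow> f k"
    proof (rule LIM_zero_cancel, rule tendsto_0_of_norm_le)
      show "\<forall>\<^sub>F n in sequentially. norm (f (s n) - f k) \<le> B * hn (hsub (s n) k)"
      proof (rule always_eventually, rule allI)
        fix n
        have "f (hsub (s n) k) = f (s n) - f k"
          using s(1) kK by (simp add: hsub_def f_add f_scale Kscale)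
        then show "norm (f (s n) - f k) \<le> B * hn (hsub (s n) k)"
          using f_bound[OF hsubspace_sub[OF K(1) s(1) kK]] by metis
      qed
      show "(\<lambda>n. B * hn (hsub (s n) k)) \<longlonglongrightarrow> 0"
        using tendsto_mult[OF tendsto_const[of B] k(2)] by simp
    qed
    ultimately show ?thesis unfolding J_def by (intro tendsto_intros)
  qed
  moreover have "(\<lambda>n. d + 1 / real (Suc n)) \<longlonglongrightarrow> d + 0"
    by (intro tendsto_intros LIMSEQ_Suc[OF lim_const_over_n])
  ultimately have "J k \<le> d + 0"
    by (rule LIMSEQ_le) (use s(2) in \<open>auto intro!: exI[of _ 0] less_imp_le\<close>)
  then have Jk: "J k \<le> J \<xi>" if "\<xi> \<in> K" for \<xi> using d[OF that] by simp
  show ?thesis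
  proof (intro bexI[OF _ kK] ballI)
    fix \<xi> assume \<xi>: "\<xi> \<in> K"
    define g where "g = ip k \<xi> - cnj (f \<xi>)"
    have "0 \<le> 0 - 2 * t * (cmod g)\<^sup>2 + t\<^sup>2 * (cmod g)\<^sup>2 * (hn \<xi>)\<^sup>2" for t
    proof -
      let ?c = "- (complex_of_real t * g)"
      have "J k \<le> J (hadd H k (hscale H ?c \<xi>))" by (intro Jk Kadd Kscale kK \<xi>)
      also have "\<dots> = J k + t\<^sup>2 * (cmod g)\<^sup>2 * (hn \<xi>)\<^sup>2 + 2 * Re (cnj ?c * ip k \<xi>) - 2 * Re (?c * f \<xi>)"
        using KC[OF kK] KC[OF \<xi>] kK \<xi>
        by (simp add: J_def hn_add_sq f_add f_scale Kscale hn_scale norm_mult power_mult_distrib)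
      also have "Re (?c * f \<xi>) = Re (cnj ?c * cnj (f \<xi>))"
        by (metis complex_cnj_mult complex_cnj(1) cnj.sel(1))
      also have "J k + t\<^sup>2 * (cmod g)\<^sup>2 * (hn \<xi>)\<^sup>2 + 2 * Re (cnj ?c * ip k \<xi>) - 2 * Re (cnj ?c * cnj (f \<xi>))
          = J k + t\<^sup>2 * (cmod g)\<^sup>2 * (hn \<xi>)\<^sup>2 + 2 * Re (cnj ?c * g)"
        by (simp add: g_def algebra_simps)
      also have "Re (cnj ?c * g) = - t * (cmod g)\<^sup>2"
      proof -
        have "cnj ?c * g = - (complex_of_real t * (g * cnj g))" by (simp add: mult.commute mult.left_commute)
        also have "\<dots> = complex_of_real (- t * (cmod g)\<^sup>2)"
          unfolding complex_norm_square[symmetric] by simp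
        finally show ?thesis by (simp only: Re_complex_of_real)
      qed
      finally show ?thesis by simp
    qed
    then have "(cmod g)\<^sup>2 \<le> 0 * (hn \<xi>)\<^sup>2" by (rule quadratic_nonneg_bound) simp
    then have "ip k \<xi> = cnj (f \<xi>)" by (simp add: g_def)
    then show "f \<xi> = ip \<xi> k" using hinner_cnj[OF KC[OF \<xi>] KC[OF kK]] by simp
  qed
qed

end


section \<open>Bounded operators and commutants\<close>

context hilbert_space
begin

lemma bounded_opsD:
  assumes "T \<in> bounded_ops H"
  shows "\<xi> \<in> C \<Longrightarrow> T \<xi> \<in> C"
    and "\<xi> \<in> C \<Longrightarrow> \<eta> \<in> C \<Longrightarrow> T (hadd H \<xi> \<eta>) = hadd H (T \<xi>) (T \<eta>)"
    and "\<xi> \<in> C \<Longrightarrow> T (hscale H c \<xi>) = hscale H c (T \<xi>)"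
    and "T \<in> extensional C"
  using assms by (auto simp: bounded_ops_def PiE_iff)

lemma bounded_ops_bound:
  assumes "T \<in> bounded_ops H"
  shows "\<exists>B\<ge>0. \<forall>\<xi>\<in>C. hn (T \<xi>) \<le> B * hn \<xi>"
proof -
  obtain B where B: "\<forall>\<xi>\<in>C. hn (T \<xi>) \<le> B * hn \<xi>" using assms by (auto simp: bounded_ops_def)
  have "hn (T \<xi>) \<le> max 0 B * hn \<xi>" if "\<xi> \<in> C" for \<xi>
    using B that mult_right_mono[of B "max 0 B" "hn \<xi>"] by fastforce
  then show ?thesis by (intro exI[of _ "max 0 B"]) auto
qed

lemma bounded_opsI:
  assumes "T \<in> extensional C" "\<And>\<xi>. \<xi> \<in> C \<Longrightarrow> T \<xi> \<in> C"
    "\<And>\<xi> \<eta>. \<xi> \<in> C \<Longrightarrow> \<eta> \<in> C \<Longrightarrow> T (hadd H \<xi> \<eta>) = hadd H (T \<xi>) (T \<eta>)"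
    "\<And>c \<xi>. \<xi> \<in> C \<Longrightarrow> T (hscale H c \<xi>) = hscale H c (T \<xi>)"
    "\<And>\<xi>. \<xi> \<in> C \<Longrightarrow> hn (T \<xi>) \<le> B * hn \<xi>"
  shows "T \<in> bounded_ops H"
  unfolding bounded_ops_def using assms by (auto simp: PiE_iff intro!: exI[of _ B])

lemma op_eqI:
  assumes "T \<in> extensional C" "S \<in> extensional C" "\<And>\<xi>. \<xi> \<in> C \<Longrightarrow> T \<xi> = S \<xi>"
  shows "T = S"
  using assms by (rule extensionalityI)

lemma bounded_ops_sub:
  "T \<in> bounded_ops H \<Longrightarrow> \<xi> \<in> C \<Longrightarrow> \<eta> \<in> C \<Longrightarrow> T (hsub \<xi> \<eta>) = hsub (T \<xi>) (T \<eta>)"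
  by (simp add: hsub_def bounded_opsD)

lemma hn_op_le_op_norm:
  assumes T: "T \<in> bounded_ops H" and \<xi>: "\<xi> \<in> C"
  shows "hn (T \<xi>) \<le> op_norm H T * hn \<xi>"
proof (cases "hn \<xi> = 0")
  case True
  obtain B where "hn (T \<xi>) \<le> B * hn \<xi>" using bounded_ops_bound[OF T] \<xi> by blast
  then show ?thesis using True by simp
next
  case False
  obtain B where B: "0 \<le> B" "\<And>\<xi>. \<xi> \<in> C \<Longrightarrow> hn (T \<xi>) \<le> B * hn \<xi>"
    using bounded_ops_bound[OF T] by blast
  have bdd: "bdd_above ((\<lambda>\<xi>. hn (T \<xi>)) ` {\<xi> \<in> C. hn \<xi> \<le> 1})"
  proof (rule bdd_aboveI2)
    fix \<eta> assume "\<eta> \<in> {\<xi> \<in> C. hn \<xi> \<le> 1}"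
    then show "hn (T \<eta>) \<le> B" using B(2)[of \<eta>] mult_left_mono[of "hn \<eta>" 1 B] B(1) by auto
  qed
  have pos: "0 < hn \<xi>" using False \<xi> by (simp add: less_le)
  let ?c = "complex_of_real (1 / hn \<xi>)"
  have c: "cmod ?c = 1 / hn \<xi>" unfolding norm_of_real using pos by simp
  have "hn (T (hscale H ?c \<xi>)) \<le> op_norm H T"
    unfolding op_norm_def
    by (rule cSUP_upper[OF _ bdd]) (use \<xi> pos in \<open>auto simp: hn_scale c simp del: of_real_divide\<close>)
  then show ?thesis using \<xi> pos
    by (simp add: bounded_opsD[OF T] hn_scale c field_simps del: of_real_divide)
qed

lemma adjoint_exists:
  assumes T: "T \<in> bounded_ops H"
  shows "\<exists>S\<in>bounded_ops H. \<forall>\<xi>\<in>C. \<forall>\<eta>\<in>C. ip (T \<xi>) \<eta> = ip \<xi> (S \<eta>)"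
proof -
  obtain B where B: "0 \<le> B" "\<And>\<xi>. \<xi> \<in> C \<Longrightarrow> hn (T \<xi>) \<le> B * hn \<xi>"
    using bounded_ops_bound[OF T] by blast
  have "\<exists>k\<in>C. \<forall>\<xi>\<in>C. ip (T \<xi>) \<eta> = ip \<xi> k" if \<eta>: "\<eta> \<in> C" for \<eta>
  proof (rule riesz[OF hsubspace_carrier hclosure_carrier])
    show "cmod (ip (T \<xi>) \<eta>) \<le> (B * hn \<eta>) * hn \<xi>" if "\<xi> \<in> C" for \<xi>
    proof -
      have "cmod (ip (T \<xi>) \<eta>) \<le> hn (T \<xi>) * hn \<eta>"
        by (rule hCauchy_Schwarz) (use that \<eta> in \<open>simp_all add: bounded_opsD[OF T]\<close>)
      also have "\<dots> \<le> (B * hn \<xi>) * hn \<eta>" using B(2)[OF that] \<eta> by (intro mult_right_mono) auto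
      finally show ?thesis by (simp add: mult.assoc mult.commute mult.left_commute)
    qed
  qed (use \<eta> in \<open>simp_all add: bounded_opsD[OF T]\<close>)
  then obtain S0 where S0: "\<And>\<eta>. \<eta> \<in> C \<Longrightarrow> S0 \<eta> \<in> C" "\<And>\<eta> \<xi>. \<eta> \<in> C \<Longrightarrow> \<xi> \<in> C \<Longrightarrow> ip (T \<xi>) \<eta> = ip \<xi> (S0 \<eta>)"
    by metis
  define S where "S = (\<lambda>\<eta>\<in>C. S0 \<eta>)"
  have S: "\<And>\<eta>. \<eta> \<in> C \<Longrightarrow> S \<eta> \<in> C" "\<And>\<eta> \<xi>. \<eta> \<in> C \<Longrightarrow> \<xi> \<in> C \<Longrightarrow> ip \<xi> (S \<eta>) = ip (T \<xi>) \<eta>"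
    using S0 by (simp_all add: S_def)
  have eqI: "a = b" if "a \<in> C" "b \<in> C" "\<And>\<xi>. \<xi> \<in> C \<Longrightarrow> ip \<xi> a = ip \<xi> b" for a b
    using that hinner_cnj by (metis hvec_eqI)
  have "S \<in> bounded_ops H"
  proof (rule bounded_opsI)
    show "S (hadd H \<xi> \<eta>) = hadd H (S \<xi>) (S \<eta>)" if "\<xi> \<in> C" "\<eta> \<in> C" for \<xi> \<eta>
      using that by (intro eqI) (simp_all add: S bounded_opsD[OF T])
    show "S (hscale H c \<xi>) = hscale H c (S \<xi>)" if "\<xi> \<in> C" for c \<xi>
      using that by (intro eqI) (simp_all add: S bounded_opsD[OF T])
    show "hn (S \<eta>) \<le> B * hn \<eta>" if \<eta>: "\<eta> \<in> C" for \<eta>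
    proof (cases "hn (S \<eta>) = 0")
      case False
      have "(hn (S \<eta>))\<^sup>2 = Re (ip (T (S \<eta>)) \<eta>)" using \<eta> by (simp add: hn_sq S)
      also have "\<dots> \<le> hn (T (S \<eta>)) * hn \<eta>"
        using hCauchy_Schwarz[of "T (S \<eta>)" \<eta>] complex_Re_le_cmod[of "ip (T (S \<eta>)) \<eta>"] \<eta>
        by (simp add: S bounded_opsD[OF T])
      also have "\<dots> \<le> (B * hn (S \<eta>)) * hn \<eta>" using \<eta> by (intro mult_right_mono B) (simp_all add: S)
      finally have "hn (S \<eta>) * hn (S \<eta>) \<le> hn (S \<eta>) * (B * hn \<eta>)"
        by (simp add: power2_eq_square mult.assoc mult.left_commute)
      then show ?thesis using False S(1)[OF \<eta>] by (simp add: mult_le_cancel_left less_le)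
    qed (use \<eta> B in simp)
  qed (simp_all add: S, simp add: S_def)
  then show ?thesis using S by (metis (no_types))
qed

lemma adjoint_unique:
  assumes "S \<in> bounded_ops H" "S' \<in> bounded_ops H"
    "\<And>\<xi> \<eta>. \<xi> \<in> C \<Longrightarrow> \<eta> \<in> C \<Longrightarrow> ip \<xi> (S \<eta>) = ip \<xi> (S' \<eta>)"
  shows "S = S'"
proof (rule op_eqI)
  fix \<eta> assume "\<eta> \<in> C"
  then show "S \<eta> = S' \<eta>"
    using assms by (intro hvec_eqI) (auto simp: bounded_opsD hinner_cnj[of "S \<eta>"] hinner_cnj[of "S' \<eta>"])
qed (use assms bounded_opsD in auto)

lemma op_adj:
  assumes T: "T \<in> bounded_ops H"
  shows "op_adj H T \<in> bounded_ops H"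
    and "\<xi> \<in> C \<Longrightarrow> \<eta> \<in> C \<Longrightarrow> ip (T \<xi>) \<eta> = ip \<xi> (op_adj H T \<eta>)"
proof -
  let ?P = "\<lambda>S. S \<in> bounded_ops H \<and> (\<forall>\<xi>\<in>C. \<forall>\<eta>\<in>C. ip (T \<xi>) \<eta> = ip \<xi> (S \<eta>))"
  obtain S where S: "?P S" using adjoint_exists[OF T] by blast
  have "?P (op_adj H T)" unfolding op_adj_def
  proof (rule theI[of ?P, OF S])
    fix S' assume "?P S'"
    with S show "S' = S" by (intro adjoint_unique) auto
  qed
  then show "op_adj H T \<in> bounded_ops H" "\<xi> \<in> C \<Longrightarrow> \<eta> \<in> C \<Longrightarrow> ip (T \<xi>) \<eta> = ip \<xi> (op_adj H T \<eta>)"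
    by auto
qed

lemma op_adj_eqI:
  assumes "T \<in> bounded_ops H" "S \<in> bounded_ops H"
    "\<And>\<xi> \<eta>. \<xi> \<in> C \<Longrightarrow> \<eta> \<in> C \<Longrightarrow> ip (T \<xi>) \<eta> = ip \<xi> (S \<eta>)"
  shows "op_adj H T = S"
  using assms op_adj[OF assms(1)] by (intro adjoint_unique) auto

lemma op_adj':
  assumes T: "T \<in> bounded_ops H" and "\<xi> \<in> C" "\<eta> \<in> C"
  shows "ip (op_adj H T \<xi>) \<eta> = ip \<xi> (T \<eta>)"
  using assms op_adj[OF T] by (metis bounded_opsD(1) hinner_cnj)

lemma op_adj_op_adj [simp]: "T \<in> bounded_ops H \<Longrightarrow> op_adj H (op_adj H T) = T"
  by (rule op_adj_eqI) (simp_all only: op_adj(1) op_adj')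

lemma op_id_bounded: "op_id H \<in> bounded_ops H"
  by (rule bounded_opsI[of _ 1]) (auto simp: op_id_def)

lemma op_id_apply: "\<xi> \<in> C \<Longrightarrow> op_id H \<xi> = \<xi>"
  by (simp add: op_id_def)

lemma op_mult_apply: "\<xi> \<in> C \<Longrightarrow> op_mult H S T \<xi> = S (T \<xi>)"
  by (simp add: op_mult_def compose_def)

lemma op_mult_bounded:
  assumes S: "S \<in> bounded_ops H" and T: "T \<in> bounded_ops H"
  shows "op_mult H S T \<in> bounded_ops H"
proof -
  obtain B where B: "0 \<le> B" "\<And>\<xi>. \<xi> \<in> C \<Longrightarrow> hn (S \<xi>) \<le> B * hn \<xi>" using bounded_ops_bound[OF S] by blast
  obtain D where D: "\<And>\<xi>. \<xi> \<in> C \<Longrightarrow> hn (T \<xi>) \<le> D * hn \<xi>" using bounded_ops_bound[OF T] by blast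
  show ?thesis
  proof (rule bounded_opsI[of _ "B * D"])
    show "hn (op_mult H S T \<xi>) \<le> B * D * hn \<xi>" if "\<xi> \<in> C" for \<xi>
      using B(2)[of "T \<xi>"] mult_left_mono[OF D[OF that] B(1)] that
      by (simp add: op_mult_apply bounded_opsD[OF T] mult.assoc)
  qed (auto simp: op_mult_apply bounded_opsD[OF S] bounded_opsD[OF T], simp add: op_mult_def)
qed

lemma mem_commutant_iff:
  assumes "X \<subseteq> bounded_ops H"
  shows "T \<in> commutant H X \<longleftrightarrow> T \<in> bounded_ops H \<and> (\<forall>S\<in>X. \<forall>\<xi>\<in>C. T (S \<xi>) = S (T \<xi>))"
proof -
  have "op_mult H T S = op_mult H S T \<longleftrightarrow> (\<forall>\<xi>\<in>C. T (S \<xi>) = S (T \<xi>))" for S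
  proof
    assume "op_mult H T S = op_mult H S T"
    then show "\<forall>\<xi>\<in>C. T (S \<xi>) = S (T \<xi>)" by (metis op_mult_apply)
  next
    assume "\<forall>\<xi>\<in>C. T (S \<xi>) = S (T \<xi>)"
    then show "op_mult H T S = op_mult H S T"
      by (intro op_eqI) (auto simp: op_mult_apply, auto simp: op_mult_def)
  qed
  then show ?thesis by (auto simp: commutant_def)
qed

lemma commutant_bounded: "commutant H X \<subseteq> bounded_ops H"
  by (auto simp: commutant_def)

lemma commutant_id: "X \<subseteq> bounded_ops H \<Longrightarrow> op_id H \<in> commutant H X"
  by (auto simp: mem_commutant_iff op_id_bounded op_id_apply bounded_opsD subset_eq)

lemma commutant_mult:
  assumes X: "X \<subseteq> bounded_ops H" and ST: "S \<in> commutant H X" "T \<in> commutant H X"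
  shows "op_mult H S T \<in> commutant H X"
proof -
  have b: "S \<in> bounded_ops H" "T \<in> bounded_ops H" using ST by (auto simp: commutant_def)
  then show ?thesis
    using X ST by (auto simp: mem_commutant_iff[OF X] op_mult_apply op_mult_bounded bounded_opsD subset_eq)
qed

lemma commutant_adj:
  assumes X: "X \<subseteq> bounded_ops H" "\<And>S. S \<in> X \<Longrightarrow> op_adj H S \<in> X" and T: "T \<in> commutant H X"
  shows "op_adj H T \<in> commutant H X"
proof -
  have b: "T \<in> bounded_ops H" using T by (auto simp: commutant_def)
  have "op_adj H T (S \<xi>) = S (op_adj H T \<xi>)" if S: "S \<in> X" and \<xi>: "\<xi> \<in> C" for S \<xi>
  proof (rule hvec_eqI)
    have Sb: "S \<in> bounded_ops H" and S'b: "op_adj H S \<in> bounded_ops H" using S X by auto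
    note D = bounded_opsD(1)[OF b] bounded_opsD(1)[OF Sb] bounded_opsD(1)[OF S'b] bounded_opsD(1)[OF op_adj(1)[OF b]]
    show "op_adj H T (S \<xi>) \<in> C" "S (op_adj H T \<xi>) \<in> C" using \<xi> by (simp_all add: D)
    fix \<eta> assume \<eta>: "\<eta> \<in> C"
    have "ip (op_adj H T (S \<xi>)) \<eta> = ip \<xi> (op_adj H S (T \<eta>))"
      using \<xi> \<eta> by (simp add: op_adj'[OF b] op_adj(2)[OF Sb] D)
    also have "op_adj H S (T \<eta>) = T (op_adj H S \<eta>)"
      using T X(2)[OF S] \<eta> by (simp add: mem_commutant_iff[OF X(1)])
    also have "ip \<xi> (T (op_adj H S \<eta>)) = ip (S (op_adj H T \<xi>)) \<eta>"
      using \<xi> \<eta> by (simp add: op_adj'[OF b] op_adj(2)[OF Sb] D)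
    finally show "ip (op_adj H T (S \<xi>)) \<eta> = ip (S (op_adj H T \<xi>)) \<eta>" .
  qed
  then show ?thesis using b by (simp add: mem_commutant_iff[OF X(1)] op_adj(1))
qed

lemma hsubspace_hclosure:
  assumes D: "hsubspace D"
  shows "hsubspace (hclosure D)" "hclosure (hclosure D) = hclosure D" "D \<subseteq> hclosure D"
proof -
  have DC: "D \<subseteq> C" and ne: "D \<noteq> {}"
    and Dadd: "\<And>\<xi> \<eta>. \<xi> \<in> D \<Longrightarrow> \<eta> \<in> D \<Longrightarrow> hadd H \<xi> \<eta> \<in> D"
    and Dscale: "\<And>c \<xi>. \<xi> \<in> D \<Longrightarrow> hscale H c \<xi> \<in> D"
    using D by (auto simp: hsubspace_def)
  have self: "hn (hsub l l) = 0" if "l \<in> C" for l using that hn_sub_sq[of l l] by (simp add: ip_self)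
  have sub: "E \<subseteq> hclosure E" if "E \<subseteq> C" for E using that self unfolding hclosure_def by force
  show D_sub: "D \<subseteq> hclosure D" by (rule sub[OF DC])
  have cl_C: "hclosure E \<subseteq> C" for E by (auto simp: hclosure_def)
  show "hclosure (hclosure D) = hclosure D"
  proof
    show "hclosure (hclosure D) \<subseteq> hclosure D"
    proof
      fix l assume l: "l \<in> hclosure (hclosure D)"
      then have lC: "l \<in> C" using cl_C by blast
      have "\<exists>d\<in>D. hn (hsub l d) < e" if e: "0 < e" for e
      proof -
        have e2: "0 < e / 2" using e by simp
        then obtain k where k: "k \<in> hclosure D" "hn (hsub l k) < e / 2"
          using l unfolding hclosure_def[of "hclosure D"] by blast
        then obtain d where d: "d \<in> D" "hn (hsub k d) < e / 2"
          using e2 unfolding hclosure_def by blast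
        have "hn (hsub l d) \<le> hn (hsub l k) + hn (hsub k d)"
          using k(1) d(1) lC DC cl_C by (intro hn_sub_triangle) auto
        with k d show ?thesis by (intro bexI[of _ d]) auto
      qed
      then show "l \<in> hclosure D" using lC by (simp add: hclosure_def)
    qed
  qed (rule sub[OF cl_C])
  show "hsubspace (hclosure D)"
    unfolding hsubspace_def
  proof (intro conjI ballI allI)
    show "hclosure D \<subseteq> C" by (rule cl_C)
    show "hclosure D \<noteq> {}" using D_sub ne by blast
    fix \<xi> assume \<xi>: "\<xi> \<in> hclosure D"
    then have \<xi>C: "\<xi> \<in> C" using cl_C by blast
    show "hadd H \<xi> \<eta> \<in> hclosure D" if \<eta>: "\<eta> \<in> hclosure D" for \<eta>
    proof -
      have \<eta>C: "\<eta> \<in> C" using \<eta> cl_C by blast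
      have "\<exists>d\<in>D. hn (hsub (hadd H \<xi> \<eta>) d) < e" if e: "0 < e" for e
      proof -
        have "0 < e / 2" using e by simp
        then obtain a b where ab: "a \<in> D" "hn (hsub \<xi> a) < e / 2" "b \<in> D" "hn (hsub \<eta> b) < e / 2"
          using \<xi> \<eta> unfolding hclosure_def by blast
        have abC: "a \<in> C" "b \<in> C" using ab DC by auto
        have "hsub (hadd H \<xi> \<eta>) (hadd H a b) = hadd H (hsub \<xi> a) (hsub \<eta> b)"
          using \<xi>C \<eta>C abC by (intro hvec_eqI) auto
        then have "hn (hsub (hadd H \<xi> \<eta>) (hadd H a b)) \<le> hn (hsub \<xi> a) + hn (hsub \<eta> b)"
          using hn_triangle[of "hsub \<xi> a" "hsub \<eta> b"] \<xi>C \<eta>C abC by simp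
        with ab show ?thesis by (intro bexI[of _ "hadd H a b"]) (auto intro: Dadd)
      qed
      then show ?thesis using \<xi>C \<eta>C by (simp add: hclosure_def)
    qed
    show "hscale H c \<xi> \<in> hclosure D" for c
    proof -
      have "\<exists>d\<in>D. hn (hsub (hscale H c \<xi>) d) < e" if e: "0 < e" for e
      proof -
        have "0 < e / (cmod c + 1)" using e by (simp add: add_nonneg_pos)
        then obtain a where a: "a \<in> D" "hn (hsub \<xi> a) < e / (cmod c + 1)"
          using \<xi> unfolding hclosure_def by blast
        have aC: "a \<in> C" using a DC by auto
        have "hsub (hscale H c \<xi>) (hscale H c a) = hscale H c (hsub \<xi> a)"
          using \<xi>C aC by (intro hvec_eqI) (auto simp: right_diff_distrib)
        then have "hn (hsub (hscale H c \<xi>) (hscale H c a)) = cmod c * hn (hsub \<xi> a)"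
          using \<xi>C aC by (simp add: hn_scale)
        also have "\<dots> \<le> (cmod c + 1) * hn (hsub \<xi> a)" using \<xi>C aC by (intro mult_right_mono) auto
        also have "\<dots> < e" using a(2) by (simp add: pos_less_divide_eq add_nonneg_pos mult.commute)
        finally show ?thesis using a(1) by (intro bexI[of _ "hscale H c a"]) (auto intro: Dscale)
      qed
      then show ?thesis using \<xi>C by (simp add: hclosure_def)
    qed
  qed
qed

lemma hclosure_invariant:
  assumes D: "D \<subseteq> C" and T: "T \<in> bounded_ops H" and inv: "\<And>\<xi>. \<xi> \<in> D \<Longrightarrow> T \<xi> \<in> D"
    and \<xi>: "\<xi> \<in> hclosure D"
  shows "T \<xi> \<in> hclosure D"
proof -
  obtain B where B: "0 \<le> B" "\<And>\<xi>. \<xi> \<in> C \<Longrightarrow> hn (T \<xi>) \<le> B * hn \<xi>" using bounded_ops_bound[OF T] by blast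
  have \<xi>C: "\<xi> \<in> C" using \<xi> by (auto simp: hclosure_def)
  have "\<exists>d\<in>D. hn (hsub (T \<xi>) d) < e" if e: "0 < e" for e
  proof -
    have "0 < e / (B + 1)" using e B(1) by simp
    then obtain a where a: "a \<in> D" "hn (hsub \<xi> a) < e / (B + 1)"
      using \<xi> unfolding hclosure_def by blast
    have aC: "a \<in> C" using a D by auto
    have "hn (hsub (T \<xi>) (T a)) \<le> B * hn (hsub \<xi> a)"
      using B(2)[of "hsub \<xi> a"] \<xi>C aC by (simp add: bounded_ops_sub[OF T])
    also have "\<dots> \<le> (B + 1) * hn (hsub \<xi> a)" using \<xi>C aC by (intro mult_right_mono) auto
    also have "\<dots> < e" using a(2) B(1) by (simp add: pos_less_divide_eq mult.commute)
    finally show ?thesis using inv[OF a(1)] by blast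
  qed
  then show ?thesis using bounded_opsD(1)[OF T \<xi>C] by (simp add: hclosure_def)
qed

text \<open>The orthogonal projection onto an invariant subspace is in the commutant, hence the double
  commutant preserves the closure of the subspace.\<close>

lemma double_commutant_invariant:
  assumes D: "hsubspace D" and X: "X \<subseteq> bounded_ops H" "\<And>S. S \<in> X \<Longrightarrow> op_adj H S \<in> X"
    and inv: "\<And>S \<xi>. S \<in> X \<Longrightarrow> \<xi> \<in> D \<Longrightarrow> S \<xi> \<in> D"
    and T: "T \<in> commutant H (commutant H X)" and \<zeta>: "\<zeta> \<in> hclosure D"
  shows "T \<zeta> \<in> hclosure D"
proof -
  let ?K = "hclosure D"
  note K = hsubspace_hclosure(1,2)[OF D]
  have KC: "\<xi> \<in> C" if "\<xi> \<in> ?K" for \<xi> using that by (simp add: hclosure_def)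
  have "\<exists>k\<in>?K. \<forall>\<xi>\<in>?K. ip \<xi> \<eta> = ip \<xi> k" if "\<eta> \<in> C" for \<eta>
    by (rule riesz[OF K, where B = "hn \<eta>"])
      (use that hCauchy_Schwarz[of _ \<eta>] in \<open>auto simp: KC mult.commute\<close>)
  then obtain p0 where p0: "\<And>\<eta>. \<eta> \<in> C \<Longrightarrow> p0 \<eta> \<in> ?K" "\<And>\<eta> \<xi>. \<eta> \<in> C \<Longrightarrow> \<xi> \<in> ?K \<Longrightarrow> ip \<xi> \<eta> = ip \<xi> (p0 \<eta>)"
    by metis
  define p where "p = (\<lambda>\<eta>\<in>C. p0 \<eta>)"
  have pK: "p \<eta> \<in> ?K" and pip: "\<And>\<xi>. \<xi> \<in> ?K \<Longrightarrow> ip \<xi> (p \<eta>) = ip \<xi> \<eta>" if "\<eta> \<in> C" for \<eta>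
    using p0 that by (simp_all add: p_def)
  have pC: "p \<eta> \<in> C" if "\<eta> \<in> C" for \<eta> using pK[OF that] by (rule KC)
  have uniq: "a = b" if "a \<in> ?K" "b \<in> ?K" "\<And>\<xi>. \<xi> \<in> ?K \<Longrightarrow> ip \<xi> a = ip \<xi> b" for a b
  proof (rule hn_eq_0)
    have "ip (hsub a b) (hsub a b) = 0"
      using that(3)[OF hsubspace_sub[OF K(1) that(1,2)]] KC that by (simp add: algebra_simps)
    then show "hn (hsub a b) = 0" using KC that by (simp add: hnorm_def)
  qed (use that KC in auto)
  have Kadd: "hadd H a b \<in> ?K" if "a \<in> ?K" "b \<in> ?K" for a b using that K(1) by (simp add: hsubspace_def)
  have Kscale: "hscale H c a \<in> ?K" if "a \<in> ?K" for c a using that K(1) by (simp add: hsubspace_def)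
  have p_fix: "p \<eta> = \<eta>" if "\<eta> \<in> ?K" for \<eta> using that by (intro uniq) (auto simp: pK pip KC)
  have pb: "p \<in> bounded_ops H"
  proof (rule bounded_opsI[of _ 1])
    show "p (hadd H \<xi> \<eta>) = hadd H (p \<xi>) (p \<eta>)" if "\<xi> \<in> C" "\<eta> \<in> C" for \<xi> \<eta>
      using that by (intro uniq) (auto simp: pK pip Kadd KC pC)
    show "p (hscale H c \<xi>) = hscale H c (p \<xi>)" if "\<xi> \<in> C" for c \<xi>
      using that by (intro uniq) (auto simp: pK pip Kscale KC pC)
    show "hn (p \<eta>) \<le> 1 * hn \<eta>" if \<eta>: "\<eta> \<in> C" for \<eta>
    proof (cases "hn (p \<eta>) = 0")
      case False
      have "(hn (p \<eta>))\<^sup>2 = Re (ip (p \<eta>) \<eta>)"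
        using \<eta> pip[OF \<eta> pK[OF \<eta>]] by (simp add: hn_sq pC)
      also have "\<dots> \<le> hn (p \<eta>) * hn \<eta>"
        using hCauchy_Schwarz[OF pC[OF \<eta>] \<eta>] complex_Re_le_cmod[of "ip (p \<eta>) \<eta>"] by simp
      finally have "hn (p \<eta>) * hn (p \<eta>) \<le> hn (p \<eta>) * hn \<eta>" by (simp add: power2_eq_square)
      then show ?thesis using False pC[OF \<eta>] by (simp add: mult_le_cancel_left less_le)
    qed (use \<eta> in simp)
  qed (simp_all add: pC, simp add: p_def)
  have "p (S \<eta>) = S (p \<eta>)" if S: "S \<in> X" and \<eta>: "\<eta> \<in> C" for S \<eta>
  proof -
    have Sb: "S \<in> bounded_ops H" using S X by auto
    have DC: "D \<subseteq> C" using D by (simp add: hsubspace_def)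
    have SK: "S' \<xi> \<in> ?K" if "S' \<in> X" "\<xi> \<in> ?K" for S' \<xi>
      by (rule hclosure_invariant[OF DC _ _ that(2)]) (use that(1) X(1) inv in auto)
    show ?thesis
    proof (rule uniq)
      show "p (S \<eta>) \<in> ?K" using \<eta> by (simp add: pK bounded_opsD[OF Sb])
      show "S (p \<eta>) \<in> ?K" using \<eta> by (simp add: SK[OF S] pK)
      fix \<xi> assume \<xi>: "\<xi> \<in> ?K"
      have "ip \<xi> (p (S \<eta>)) = ip (op_adj H S \<xi>) \<eta>"
        using \<xi> \<eta> by (simp add: pip bounded_opsD[OF Sb] op_adj'[OF Sb] KC)
      also have "\<dots> = ip (op_adj H S \<xi>) (p \<eta>)"
        using \<eta> SK[OF X(2)[OF S] \<xi>] by (simp add: pip)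
      also have "\<dots> = ip \<xi> (S (p \<eta>))" using \<xi> \<eta> by (simp add: op_adj'[OF Sb] KC pC)
      finally show "ip \<xi> (p (S \<eta>)) = ip \<xi> (S (p \<eta>))" .
    qed
  qed
  then have "p \<in> commutant H X" using pb by (simp add: mem_commutant_iff[OF X(1)])
  then have "T (p \<zeta>) = p (T \<zeta>)"
    using T KC[OF \<zeta>] by (simp add: mem_commutant_iff[OF commutant_bounded])
  then show ?thesis
    using pK[of "T \<zeta>"] T KC[OF \<zeta>] p_fix[OF \<zeta>]
    by (simp add: mem_commutant_iff[OF commutant_bounded] bounded_opsD)
qed

end


section \<open>The GNS representation of a trace\<close>

locale gns =
  fixes \<tau> :: "'a::cstar_algebra \<Rightarrow> complex"
  assumes trace: "is_trace \<tau>"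
begin

sublocale tracial_functional star "\<lambda>c. c *\<^sub>C 1" \<tau>
  by (rule tracial_trace[OF trace])

lemma norm2_eq_nrm: "norm2 \<tau> x = nrm x"
  by (simp add: norm2_def nrm_def)

lemma nrm_mult_le: "nrm (x * q) \<le> norm x * nrm q"
  by (rule bddD[OF trace_bdd_norm[OF trace]])

lemma nrm_mult_right_le: "nrm (q * x) \<le> norm x * nrm q"
  by (rule nrm_mult_bdd[OF trace_bdd_norm[OF trace]])

lemma nrm_scaleC: "nrm (c *\<^sub>C x) = cmod c * nrm x"
  using nrm_sc[of c x] by (simp flip: scaleC_eq_mult)

lemma scaleC_diff: "c *\<^sub>C x - c *\<^sub>C y = c *\<^sub>C (x - y :: 'a)"
  by (simp add: scaleC_eq_mult[of c x] scaleC_eq_mult[of c y] scaleC_eq_mult[of c "x - y"] right_diff_distrib)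

lemma Cauchy2_iff: "Cauchy2 \<tau> s \<longleftrightarrow> (\<forall>e>0. \<exists>M. \<forall>m\<ge>M. \<forall>n\<ge>M. nrm (s m - s n) < e)"
  by (simp add: Cauchy2_def norm2_eq_nrm)

lemma Cauchy2_lipschitz:
  assumes s: "Cauchy2 \<tau> s" and F: "\<And>m n. nrm (F m - F n) \<le> B * nrm (s m - s n)"
  shows "Cauchy2 \<tau> F"
  unfolding Cauchy2_iff
proof (intro allI impI)
  fix e :: real assume e: "0 < e"
  then have "0 < e / (\<bar>B\<bar> + 1)" by (simp add: add_nonneg_pos)
  then obtain M where M: "\<forall>m\<ge>M. \<forall>n\<ge>M. nrm (s m - s n) < e / (\<bar>B\<bar> + 1)" using s unfolding Cauchy2_iff by blast
  have "nrm (F m - F n) < e" if "M \<le> m" "M \<le> n" for m n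
  proof -
    have "nrm (F m - F n) \<le> (\<bar>B\<bar> + 1) * nrm (s m - s n)"
      by (rule order_trans[OF F mult_right_mono]) auto
    also have "\<dots> < e" using M that by (simp add: pos_less_divide_eq add_nonneg_pos mult.commute)
    finally show ?thesis .
  qed
  then show "\<exists>M. \<forall>m\<ge>M. \<forall>n\<ge>M. nrm (F m - F n) < e" by blast
qed

lemma Cauchy2_const [simp]: "Cauchy2 \<tau> (\<lambda>_. b)"
  by (simp add: Cauchy2_iff)

lemma Cauchy2_add:
  assumes "Cauchy2 \<tau> s" "Cauchy2 \<tau> t"
  shows "Cauchy2 \<tau> (\<lambda>n. s n + t n)"
  unfolding Cauchy2_iff
proof (intro allI impI)
  fix e :: real assume "0 < e"
  then have "0 < e / 2" by simp
  then obtain M1 M2 where M: "\<forall>m\<ge>M1. \<forall>n\<ge>M1. nrm (s m - s n) < e / 2" "\<forall>m\<ge>M2. \<forall>n\<ge>M2. nrm (t m - t n) < e / 2"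
    using assms unfolding Cauchy2_iff by blast
  have "nrm (s m + t m - (s n + t n)) < e" if "max M1 M2 \<le> m" "max M1 M2 \<le> n" for m n
  proof -
    have "nrm (s m - s n) < e / 2" "nrm (t m - t n) < e / 2" using M that by auto
    moreover have "nrm (s m + t m - (s n + t n)) \<le> nrm (s m - s n) + nrm (t m - t n)"
      using nrm_triangle[of "s m - s n" "t m - t n"] by (simp add: algebra_simps)
    ultimately show ?thesis by linarith
  qed
  then show "\<exists>M. \<forall>m\<ge>M. \<forall>n\<ge>M. nrm (s m + t m - (s n + t n)) < e" by blast
qed

lemma Cauchy2_uminus: "Cauchy2 \<tau> s \<Longrightarrow> Cauchy2 \<tau> (\<lambda>n. - s n)"
  by (rule Cauchy2_lipschitz[of s _ 1]) (simp_all add: nrm_minus_commute)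

lemma Cauchy2_diff: "Cauchy2 \<tau> s \<Longrightarrow> Cauchy2 \<tau> t \<Longrightarrow> Cauchy2 \<tau> (\<lambda>n. s n - t n)"
  using Cauchy2_add[OF _ Cauchy2_uminus] by simp

lemma Cauchy2_scaleC: "Cauchy2 \<tau> s \<Longrightarrow> Cauchy2 \<tau> (\<lambda>n. c *\<^sub>C s n)"
  by (rule Cauchy2_lipschitz[of s _ "cmod c"]) (simp_all add: scaleC_diff nrm_scaleC)

lemma Cauchy2_mult_left: "Cauchy2 \<tau> s \<Longrightarrow> Cauchy2 \<tau> (\<lambda>n. a * s n)"
  by (rule Cauchy2_lipschitz[of s _ "norm a"]) (simp_all add: nrm_mult_le flip: right_diff_distrib)

lemma Cauchy2_mult_right: "Cauchy2 \<tau> s \<Longrightarrow> Cauchy2 \<tau> (\<lambda>n. s n * a)"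
  by (rule Cauchy2_lipschitz[of s _ "norm a"]) (simp_all add: nrm_mult_right_le flip: left_diff_distrib)

lemma Cauchy2_star: "Cauchy2 \<tau> s \<Longrightarrow> Cauchy2 \<tau> (\<lambda>n. star (s n))"
  by (rule Cauchy2_lipschitz[of s _ 1]) (simp_all add: nrm_st flip: cs.st_diff)

lemma Cauchy2_convergent_nrm:
  assumes "Cauchy2 \<tau> s" shows "convergent (\<lambda>n. nrm (s n))"
proof (rule real_Cauchy_convergent, rule metric_CauchyI)
  fix e :: real assume "0 < e"
  then obtain M where "\<forall>m\<ge>M. \<forall>n\<ge>M. nrm (s m - s n) < e" using assms unfolding Cauchy2_iff by blast
  then show "\<exists>M. \<forall>m\<ge>M. \<forall>n\<ge>M. dist (nrm (s m)) (nrm (s n)) < e"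
    by (intro exI[of _ M]) (auto simp: dist_real_def intro: le_less_trans[OF abs_nrm_diff])
qed

lemma Cauchy2_bound:
  assumes "Cauchy2 \<tau> s" shows "\<exists>B. \<forall>n. nrm (s n) \<le> B"
proof -
  have "Bseq (\<lambda>n. nrm (s n))" by (rule convergent_imp_Bseq[OF Cauchy2_convergent_nrm[OF assms]])
  then obtain B where "\<And>n. norm (nrm (s n)) \<le> B" by (auto simp: Bseq_def)
  then show ?thesis by auto
qed

abbreviation null2 :: "(nat \<Rightarrow> 'a) \<Rightarrow> bool" where
  "null2 s \<equiv> (\<lambda>n. nrm (s n)) \<longlonglongrightarrow> 0"

lemma null2_lipschitz:
  assumes "null2 s" "\<And>n. nrm (F n) \<le> B * nrm (s n)"
  shows "null2 F"
proof (rule tendsto_0_of_norm_le)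
  show "\<forall>\<^sub>F n in sequentially. norm (nrm (F n)) \<le> B * nrm (s n)" using assms(2) by simp
  show "(\<lambda>n. B * nrm (s n)) \<longlonglongrightarrow> 0" using tendsto_mult[OF tendsto_const[of B] assms(1)] by simp
qed

lemma null2_add:
  assumes "null2 s" "null2 t" shows "null2 (\<lambda>n. s n + t n)"
proof (rule tendsto_0_of_norm_le)
  show "\<forall>\<^sub>F n in sequentially. norm (nrm (s n + t n)) \<le> nrm (s n) + nrm (t n)" by (simp add: nrm_triangle)
  show "(\<lambda>n. nrm (s n) + nrm (t n)) \<longlonglongrightarrow> 0" using tendsto_add[OF assms] by simp
qed

lemma gns_class_eqI:
  assumes "null2 (\<lambda>n. s n - t n)"
  shows "gns_class \<tau> s = gns_class \<tau> t"
proof -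
  have sub: "gns_class \<tau> s \<subseteq> gns_class \<tau> t" if "null2 (\<lambda>n. s n - t n)" for s t
  proof
    fix u assume u: "u \<in> gns_class \<tau> s"
    then have "null2 (\<lambda>n. u n - s n)" by (simp add: gns_class_def norm2_eq_nrm)
    from null2_add[OF this that] show "u \<in> gns_class \<tau> t"
      using u by (simp add: gns_class_def norm2_eq_nrm)
  qed
  have "null2 (\<lambda>n. t n - s n)" using assms by (simp add: nrm_minus_commute)
  with sub assms show ?thesis by blast
qed

lemma mem_gns_class: "Cauchy2 \<tau> s \<Longrightarrow> s \<in> gns_class \<tau> s"
  by (simp add: gns_class_def norm2_eq_nrm)

lemma gns_classD: "t \<in> gns_class \<tau> s \<Longrightarrow> Cauchy2 \<tau> t" "t \<in> gns_class \<tau> s \<Longrightarrow> null2 (\<lambda>n. t n - s n)"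
  by (simp_all add: gns_class_def norm2_eq_nrm)

text \<open>The operations of the GNS space are unions over all representatives. If the operation respects
equivalence, then all members of the union coincide.\<close>

lemma UN_gns_class:
  assumes "Cauchy2 \<tau> s" and "\<And>t. Cauchy2 \<tau> t \<Longrightarrow> null2 (\<lambda>n. t n - s n) \<Longrightarrow> null2 (\<lambda>n. F t n - F s n)"
  shows "(\<Union>t\<in>gns_class \<tau> s. gns_class \<tau> (F t)) = gns_class \<tau> (F s)"
proof -
  have "gns_class \<tau> (F t) = gns_class \<tau> (F s)" if "t \<in> gns_class \<tau> s" for t
    using gns_classD[OF that] by (intro gns_class_eqI assms(2))
  then show ?thesis using mem_gns_class[OF assms(1)] by blast
qed

abbreviation H where "H \<equiv> gns_space \<tau>"

abbreviation cls where "cls \<equiv> gns_class \<tau>"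

lemma carrier_iff: "\<xi> \<in> hcarrier H \<longleftrightarrow> (\<exists>s. Cauchy2 \<tau> s \<and> \<xi> = cls s)"
  by (auto simp: gns_space_def)

lemma cls_carrier [simp]: "Cauchy2 \<tau> s \<Longrightarrow> cls s \<in> hcarrier H"
  by (auto simp: carrier_iff)

lemma hadd_cls:
  assumes s: "Cauchy2 \<tau> s" and t: "Cauchy2 \<tau> t"
  shows "hadd H (cls s) (cls t) = cls (\<lambda>n. s n + t n)"
proof -
  have "(\<Union>v\<in>cls t. cls (\<lambda>n. u n + v n)) = cls (\<lambda>n. u n + t n)" for u
    by (rule UN_gns_class[OF t]) simp
  then have "hadd H (cls s) (cls t) = (\<Union>u\<in>cls s. cls (\<lambda>n. u n + t n))"
    by (simp add: gns_space_def)
  also have "\<dots> = cls (\<lambda>n. s n + t n)" by (rule UN_gns_class[OF s]) simp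
  finally show ?thesis .
qed

lemma hscale_cls:
  assumes s: "Cauchy2 \<tau> s"
  shows "hscale H c (cls s) = cls (\<lambda>n. c *\<^sub>C s n)"
proof -
  have "(\<Union>u\<in>cls s. cls (\<lambda>n. c *\<^sub>C u n)) = cls (\<lambda>n. c *\<^sub>C s n)"
    by (rule UN_gns_class[OF s])
      (simp add: scaleC_diff nrm_scaleC tendsto_mult_right_zero)
  then show ?thesis by (simp add: gns_space_def)
qed

lemma ip_diff_null:
  assumes "Cauchy2 \<tau> s" "Cauchy2 \<tau> t'" and n: "null2 (\<lambda>n. s' n - s n)" "null2 (\<lambda>n. t' n - t n)"
  shows "(\<lambda>n. \<tau> (star (t' n) * s' n) - \<tau> (star (t n) * s n)) \<longlonglongrightarrow> 0"
proof -
  obtain B B' where B: "\<And>n. nrm (s n) \<le> B" "\<And>n. nrm (t' n) \<le> B'"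
    using Cauchy2_bound assms(1,2) by metis
  show ?thesis
  proof (rule tendsto_0_of_norm_le)
    show "\<forall>\<^sub>F n in sequentially. norm (\<tau> (star (t' n) * s' n) - \<tau> (star (t n) * s n))
        \<le> B' * nrm (s' n - s n) + B * nrm (t' n - t n)"
    proof (rule always_eventually, rule allI)
      fix n
      have "\<tau> (star (t' n) * s' n) - \<tau> (star (t n) * s n)
          = \<tau> (star (t' n) * (s' n - s n)) + \<tau> (star (t' n - t n) * s n)"
        by (simp add: cs.st_diff algebra_simps \<phi>_diff)
      also have "norm \<dots> \<le> nrm (s' n - s n) * nrm (t' n) + nrm (s n) * nrm (t' n - t n)"
        by (intro order_trans[OF norm_triangle_ineq] add_mono Cauchy_Schwarz)
      also have "\<dots> \<le> nrm (s' n - s n) * B' + B * nrm (t' n - t n)"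
        using B by (intro add_mono mult_left_mono mult_right_mono) auto
      finally show "norm (\<tau> (star (t' n) * s' n) - \<tau> (star (t n) * s n))
          \<le> B' * nrm (s' n - s n) + B * nrm (t' n - t n)" by (simp add: mult.commute)
    qed
    show "(\<lambda>n. B' * nrm (s' n - s n) + B * nrm (t' n - t n)) \<longlonglongrightarrow> 0"
      using tendsto_add[OF tendsto_mult[OF tendsto_const[of B'] n(1)] tendsto_mult[OF tendsto_const[of B] n(2)]]
      by simp
  qed
qed

lemma ip_convergent:
  assumes s: "Cauchy2 \<tau> s" and t: "Cauchy2 \<tau> t"
  shows "convergent (\<lambda>n. \<tau> (star (t n) * s n))"
proof -
  obtain B B' where B: "\<And>n. nrm (s n) \<le> B" "\<And>n. nrm (t n) \<le> B'"
    using Cauchy2_bound s t by metis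
  have B0: "0 \<le> B" "0 \<le> B'" using B(1)[of 0] B(2)[of 0] nrm_ge0 order_trans by blast+
  have "Cauchy (\<lambda>n. \<tau> (star (t n) * s n))"
  proof (rule metric_CauchyI)
    fix e :: real assume e: "0 < e"
    define d where "d = e / (B + B' + 1)"
    have d: "0 < d" "(B + B' + 1) * d = e" using e B0 by (auto simp: d_def)
    obtain M1 M2 where M: "\<forall>m\<ge>M1. \<forall>n\<ge>M1. nrm (s m - s n) < d" "\<forall>m\<ge>M2. \<forall>n\<ge>M2. nrm (t m - t n) < d"
      using s t d(1) unfolding Cauchy2_iff by blast
    have "dist (\<tau> (star (t m) * s m)) (\<tau> (star (t n) * s n)) < e" if "max M1 M2 \<le> m" "max M1 M2 \<le> n" for m n
    proof -
      have "\<tau> (star (t m) * s m) - \<tau> (star (t n) * s n)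
          = \<tau> (star (t m) * (s m - s n)) + \<tau> (star (t m - t n) * s n)"
        by (simp add: cs.st_diff algebra_simps \<phi>_diff)
      also have "norm \<dots> \<le> nrm (s m - s n) * nrm (t m) + nrm (s n) * nrm (t m - t n)"
        by (intro order_trans[OF norm_triangle_ineq] add_mono Cauchy_Schwarz)
      also have "\<dots> \<le> d * B' + B * d"
        using B B0 M that d by (intro add_mono mult_mono) (auto intro: less_imp_le)
      also have "\<dots> < e" using d by (simp add: algebra_simps)
      finally show ?thesis by (simp add: dist_norm)
    qed
    then show "\<exists>M. \<forall>m\<ge>M. \<forall>n\<ge>M. dist (\<tau> (star (t m) * s m)) (\<tau> (star (t n) * s n)) < e" by blast
  qed
  then show ?thesis by (simp add: Cauchy_convergent_iff)
qed

lemma hinner_cls: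
  assumes s: "Cauchy2 \<tau> s" and t: "Cauchy2 \<tau> t"
  shows "(\<lambda>n. \<tau> (star (t n) * s n)) \<longlonglongrightarrow> hinner H (cls s) (cls t)"
proof -
  obtain z where z: "(\<lambda>n. \<tau> (star (t n) * s n)) \<longlonglongrightarrow> z"
    using ip_convergent[OF s t] by (auto simp: convergent_def)
  have "z' = z" if st: "s' \<in> cls s" "t' \<in> cls t" "(\<lambda>n. \<tau> (star (t' n) * s' n)) \<longlonglongrightarrow> z'" for z' s' t'
  proof -
    have "(\<lambda>n. \<tau> (star (t' n) * s' n) - \<tau> (star (t n) * s n)) \<longlonglongrightarrow> 0"
      by (rule ip_diff_null[OF s gns_classD(1)[OF st(2)] gns_classD(2)[OF st(1)] gns_classD(2)[OF st(2)]])
    moreover have "(\<lambda>n. \<tau> (star (t' n) * s' n) - \<tau> (star (t n) * s n)) \<longlonglongrightarrow> z' - z"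
      by (rule tendsto_diff[OF st(3) z])
    ultimately have "z' - z = 0" using LIMSEQ_unique by blast
    then show ?thesis by simp
  qed
  then have "hinner H (cls s) (cls t) = z"
    unfolding gns_space_def hilbert.simps
    by (intro the_equality) (use mem_gns_class[OF s] mem_gns_class[OF t] z in blast)+
  with z show ?thesis by simp
qed

lemma hinner_cls_eqI:
  "Cauchy2 \<tau> s \<Longrightarrow> Cauchy2 \<tau> t \<Longrightarrow> (\<lambda>n. \<tau> (star (t n) * s n)) \<longlonglongrightarrow> z \<Longrightarrow> hinner H (cls s) (cls t) = z"
  using hinner_cls LIMSEQ_unique by blast

lemma hnorm_cls:
  assumes s: "Cauchy2 \<tau> s"
  shows "(\<lambda>n. nrm (s n)) \<longlonglongrightarrow> hnorm H (cls s)"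
  unfolding hnorm_def nrm_def by (intro tendsto_real_sqrt tendsto_Re hinner_cls s)

lemma hinner_cls_const:
  "hinner H (cls (\<lambda>_. a)) (cls (\<lambda>_. b)) = \<tau> (star b * a)"
  by (rule hinner_cls_eqI) auto

lemma hsub_cls:
  assumes s: "Cauchy2 \<tau> s" and t: "Cauchy2 \<tau> t"
  shows "hadd H (cls s) (hscale H (-1) (cls t)) = cls (\<lambda>n. s n - t n)"
proof -
  have "(-1) *\<^sub>C t n = - t n" for n
    using scaleR_scaleC[of "-1" "t n"] by simp
  then show ?thesis by (simp add: hscale_cls[OF t] hadd_cls[OF s Cauchy2_uminus[OF t]])
qed

text \<open>For completeness a diagonal sequence is chosen from representatives of the vectors.\<close>

lemma gns_complete:
  assumes s: "\<And>n. s n \<in> hcarrier H"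
    and c: "\<And>e. 0 < e \<Longrightarrow> \<exists>M. \<forall>m\<ge>M. \<forall>n\<ge>M. hnorm H (hadd H (s m) (hscale H (-1) (s n))) < e"
  shows "\<exists>l\<in>hcarrier H. (\<lambda>n. hnorm H (hadd H (s n) (hscale H (-1) l))) \<longlonglongrightarrow> 0"
proof -
  obtain r where r: "\<And>n. Cauchy2 \<tau> (r n)" "\<And>n. s n = cls (r n)"
    using s unfolding carrier_iff by metis
  define \<delta> where "\<delta> n = 1 / real (Suc n)" for n
  have \<delta>: "0 < \<delta> n" "\<delta> \<longlonglongrightarrow> 0" for n
    unfolding \<delta>_def using LIMSEQ_Suc[OF lim_1_over_n] by auto
  have "\<exists>k. \<forall>m\<ge>k. nrm (r n k - r n m) < \<delta> n" for n
    using r(1)[of n] \<delta>(1)[of n] unfolding Cauchy2_iff by blast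
  then obtain k where k: "\<And>n m. k n \<le> m \<Longrightarrow> nrm (r n (k n) - r n m) < \<delta> n" by metis
  define x where "x n = r n (k n)" for n
  have dist_lim: "(\<lambda>j. nrm (r m j - r n j)) \<longlonglongrightarrow> hnorm H (hadd H (s m) (hscale H (-1) (s n)))" for m n
    unfolding r(2) hsub_cls[OF r(1) r(1)] by (rule hnorm_cls[OF Cauchy2_diff[OF r(1) r(1)]])
  have x_dist: "nrm (x m - x n) \<le> \<delta> m + \<delta> n + hnorm H (hadd H (s m) (hscale H (-1) (s n)))" for m n
  proof (rule tendsto_lowerbound[OF tendsto_add[OF tendsto_const dist_lim]])
    show "\<forall>\<^sub>F j in sequentially. nrm (x m - x n) \<le> \<delta> m + \<delta> n + nrm (r m j - r n j)"
      using eventually_ge_at_top[of "max (k m) (k n)"]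
    proof eventually_elim
      case (elim j)
      have "nrm (x m - r m j) < \<delta> m" "nrm (x n - r n j) < \<delta> n" using k elim by (auto simp: x_def)
      moreover have "nrm (x m - x n) \<le> nrm (x m - r m j) + (nrm (r m j - r n j) + nrm (r n j - x n))"
        by (meson add_left_mono nrm_triangle_sub order_trans)
      ultimately show ?case using nrm_minus_commute[of "x n" "r n j"] by linarith
    qed
  qed simp
  have x: "Cauchy2 \<tau> x"
    unfolding Cauchy2_iff
  proof (intro allI impI)
    fix e :: real assume e: "0 < e"
    then obtain M1 where M1: "\<forall>m\<ge>M1. \<forall>n\<ge>M1. hnorm H (hadd H (s m) (hscale H (-1) (s n))) < e / 3"
      using c[of "e / 3"] by auto
    obtain M2 where M2: "\<forall>n\<ge>M2. \<delta> n < e / 3"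
      using order_tendstoD(2)[OF \<delta>(2), of "e / 3"] e by (auto simp: eventually_sequentially)
    have "nrm (x m - x n) < e" if "max M1 M2 \<le> m" "max M1 M2 \<le> n" for m n
    proof -
      have "hnorm H (hadd H (s m) (hscale H (-1) (s n))) < e / 3" "\<delta> m < e / 3" "\<delta> n < e / 3"
        using M1 M2 that by auto
      with x_dist[of m n] show ?thesis by linarith
    qed
    then show "\<exists>M. \<forall>m\<ge>M. \<forall>n\<ge>M. nrm (x m - x n) < e" by blast
  qed
  have "(\<lambda>n. hnorm H (hadd H (s n) (hscale H (-1) (cls x)))) \<longlonglongrightarrow> 0"
  proof (rule LIMSEQ_I)
    fix e :: real assume e: "0 < e"
    then obtain M1 where M1: "\<forall>m\<ge>M1. \<forall>n\<ge>M1. nrm (x m - x n) < e / 3"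
      using x unfolding Cauchy2_iff by (meson divide_pos_pos zero_less_numeral)
    obtain M2 where M2: "\<forall>n\<ge>M2. \<delta> n < e / 3"
      using order_tendstoD(2)[OF \<delta>(2), of "e / 3"] e by (auto simp: eventually_sequentially)
    have "norm (hnorm H (hadd H (s n) (hscale H (-1) (cls x))) - 0) < e" if n: "max M1 M2 \<le> n" for n
    proof -
      have lim: "(\<lambda>j. nrm (r n j - x j)) \<longlonglongrightarrow> hnorm H (hadd H (s n) (hscale H (-1) (cls x)))"
        unfolding r(2) hsub_cls[OF r(1) x] by (rule hnorm_cls[OF Cauchy2_diff[OF r(1) x]])
      have "hnorm H (hadd H (s n) (hscale H (-1) (cls x))) \<le> 2 * (e / 3)"
      proof (rule tendsto_upperbound[OF lim])
        show "\<forall>\<^sub>F j in sequentially. nrm (r n j - x j) \<le> 2 * (e / 3)"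
          using eventually_ge_at_top[of "max (k n) M1"]
        proof eventually_elim
          case (elim j)
          have "nrm (x n - r n j) < \<delta> n" using k elim by (auto simp: x_def)
          moreover have "\<delta> n < e / 3" using M2 n by auto
          moreover have "nrm (x n - x j) < e / 3" using M1 n elim by auto
          ultimately show ?case
            using nrm_triangle_sub[of "r n j" "x j" "x n"] nrm_minus_commute[of "x n" "r n j"] by linarith
        qed
      qed simp
      moreover have "0 \<le> hnorm H (hadd H (s n) (hscale H (-1) (cls x)))"
        by (rule tendsto_lowerbound[OF lim]) simp_all
      ultimately show ?thesis using e by simp
    qed
    then show "\<exists>no. \<forall>n\<ge>no. norm (hnorm H (hadd H (s n) (hscale H (-1) (cls x))) - 0) < e" by blast
  qed
  with x show ?thesis by (intro bexI[of _ "cls x"]) auto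
qed

sublocale hs: hilbert_space H
proof
  fix \<xi> \<eta> \<zeta> c
  show "hcarrier H \<noteq> {}" using cls_carrier[OF Cauchy2_const] by blast
  show "\<exists>l\<in>hcarrier H. (\<lambda>n. hnorm H (hadd H (s n) (hscale H (-1) l))) \<longlonglongrightarrow> 0"
    if "\<And>n. s n \<in> hcarrier H"
      "\<And>e. 0 < e \<Longrightarrow> \<exists>M. \<forall>m\<ge>M. \<forall>n\<ge>M. hnorm H (hadd H (s m) (hscale H (-1) (s n))) < e" for s
    using gns_complete[OF that] .
  assume "\<xi> \<in> hcarrier H"
  then obtain s where s: "Cauchy2 \<tau> s" "\<xi> = cls s" by (auto simp: carrier_iff)
  show "hscale H c \<xi> \<in> hcarrier H" using s by (simp add: hscale_cls Cauchy2_scaleC)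
  show "0 \<le> Re (hinner H \<xi> \<xi>)"
    unfolding s(2) by (rule tendsto_lowerbound[OF tendsto_Re[OF hinner_cls[OF s(1) s(1)]]])
      (simp_all add: Re_\<phi>_ge0)
  assume "\<eta> \<in> hcarrier H"
  then obtain t where t: "Cauchy2 \<tau> t" "\<eta> = cls t" by (auto simp: carrier_iff)
  show "hadd H \<xi> \<eta> \<in> hcarrier H" using s t by (simp add: hadd_cls Cauchy2_add)
  show "hinner H \<xi> \<eta> = cnj (hinner H \<eta> \<xi>)"
  proof -
    have "(\<lambda>n. cnj (\<tau> (star (s n) * t n))) \<longlonglongrightarrow> cnj (hinner H \<eta> \<xi>)"
      unfolding s(2) t(2) by (intro tendsto_cnj hinner_cls s t)
    then have "(\<lambda>n. \<tau> (star (t n) * s n)) \<longlonglongrightarrow> cnj (hinner H \<eta> \<xi>)"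
      by (simp add: \<phi>_hermitian[symmetric])
    then show ?thesis unfolding s(2) t(2) by (intro hinner_cls_eqI s t)
  qed
  show "\<xi> = \<eta>" if eq: "\<And>\<zeta>. \<zeta> \<in> hcarrier H \<Longrightarrow> hinner H \<xi> \<zeta> = hinner H \<eta> \<zeta>"
  proof -
    let ?u = "\<lambda>n. s n - t n"
    have u: "Cauchy2 \<tau> ?u" by (rule Cauchy2_diff[OF s(1) t(1)])
    have "(\<lambda>n. \<tau> (star (?u n) * s n) - \<tau> (star (?u n) * t n)) \<longlonglongrightarrow> hinner H \<xi> (cls ?u) - hinner H \<eta> (cls ?u)"
      unfolding s(2) t(2) by (intro tendsto_diff hinner_cls s t u)
    also have "hinner H \<xi> (cls ?u) - hinner H \<eta> (cls ?u) = 0" using eq[of "cls ?u"] u by simp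
    finally have "(\<lambda>n. \<tau> (star (?u n) * ?u n)) \<longlonglongrightarrow> 0"
      by (simp add: right_diff_distrib \<phi>_diff)
    then have "(\<lambda>n. sqrt (Re (\<tau> (star (?u n) * ?u n)))) \<longlonglongrightarrow> sqrt (Re 0)"
      by (intro tendsto_real_sqrt tendsto_Re)
    then have "null2 ?u" by (simp add: nrm_def)
    then show ?thesis unfolding s(2) t(2) by (rule gns_class_eqI)
  qed
  assume "\<zeta> \<in> hcarrier H"
  then obtain u where u: "Cauchy2 \<tau> u" "\<zeta> = cls u" by (auto simp: carrier_iff)
  show "hinner H (hadd H \<xi> \<eta>) \<zeta> = hinner H \<xi> \<zeta> + hinner H \<eta> \<zeta>"
    unfolding s(2) t(2) u(2) hadd_cls[OF s(1) t(1)]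
    by (rule hinner_cls_eqI[OF Cauchy2_add[OF s(1) t(1)] u(1)])
      (simp add: distrib_left \<phi>_add tendsto_add[OF hinner_cls[OF s(1) u(1)] hinner_cls[OF t(1) u(1)]])
next
  fix \<xi> \<zeta> c assume "\<xi> \<in> hcarrier H" "\<zeta> \<in> hcarrier H"
  then obtain s u where s: "Cauchy2 \<tau> s" "\<xi> = cls s" and u: "Cauchy2 \<tau> u" "\<zeta> = cls u" by (auto simp: carrier_iff)
  have "\<tau> (star (u n) * c *\<^sub>C s n) = c * \<tau> (star (u n) * s n)" for n
    using \<phi>_scale_right[of "u n" c "s n"] by (simp flip: scaleC_eq_mult)
  then show "hinner H (hscale H c \<xi>) \<zeta> = c * hinner H \<xi> \<zeta>"
    unfolding s(2) u(2) hscale_cls[OF s(1)]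
    by (intro hinner_cls_eqI[OF Cauchy2_scaleC[OF s(1)] u(1)])
      (simp add: tendsto_mult[OF tendsto_const hinner_cls[OF s(1) u(1)]])
qed

end


section \<open>The trace on the von Neumann algebra of the GNS representation\<close>

context gns
begin

lemma rep_cls:
  assumes s: "Cauchy2 \<tau> s"
  shows "gns_rep \<tau> a (cls s) = cls (\<lambda>n. a * s n)"
proof -
  have "(\<Union>u\<in>cls s. cls (\<lambda>n. a * u n)) = cls (\<lambda>n. a * s n)"
    by (rule UN_gns_class[OF s])
      (auto intro: null2_lipschitz[where B = "norm a"] nrm_mult_le simp flip: right_diff_distrib)
  then show ?thesis using s by (simp add: gns_rep_def)
qed

lemma rep_hn_le:
  assumes "\<xi> \<in> hcarrier H"
  shows "hnorm H (gns_rep \<tau> a \<xi>) \<le> norm a * hnorm H \<xi>"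
proof -
  obtain s where s: "Cauchy2 \<tau> s" "\<xi> = cls s" using assms by (auto simp: carrier_iff)
  show ?thesis
    unfolding s(2) rep_cls[OF s(1)]
    by (rule LIMSEQ_le[OF hnorm_cls[OF Cauchy2_mult_left[OF s(1)]] tendsto_mult[OF tendsto_const hnorm_cls[OF s(1)]]])
      (auto intro: nrm_mult_le)
qed

lemma rep_bounded: "gns_rep \<tau> a \<in> bounded_ops H"
proof (rule hs.bounded_opsI[of _ "norm a"])
  show "gns_rep \<tau> a \<in> extensional (hcarrier H)" by (simp add: gns_rep_def)
  fix \<xi> assume "\<xi> \<in> hcarrier H"
  then obtain s where s: "Cauchy2 \<tau> s" "\<xi> = cls s" by (auto simp: carrier_iff)
  show "gns_rep \<tau> a \<xi> \<in> hcarrier H" unfolding s(2) rep_cls[OF s(1)] by (simp add: Cauchy2_mult_left s)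
  show "hnorm H (gns_rep \<tau> a \<xi>) \<le> norm a * hnorm H \<xi>" by (rule rep_hn_le) fact
  show "gns_rep \<tau> a (hscale H c \<xi>) = hscale H c (gns_rep \<tau> a \<xi>)" for c
    unfolding s(2)
    by (simp add: rep_cls hscale_cls s(1) Cauchy2_scaleC Cauchy2_mult_left mult_scaleC_right)
  fix \<eta> assume "\<eta> \<in> hcarrier H"
  then obtain t where t: "Cauchy2 \<tau> t" "\<eta> = cls t" by (auto simp: carrier_iff)
  show "gns_rep \<tau> a (hadd H \<xi> \<eta>) = hadd H (gns_rep \<tau> a \<xi>) (gns_rep \<tau> a \<eta>)"
    unfolding s(2) t(2)
    by (simp add: rep_cls hadd_cls s(1) t(1) Cauchy2_add Cauchy2_mult_left distrib_left)
qed

lemma rep_adj: "op_adj H (gns_rep \<tau> a) = gns_rep \<tau> (star a)"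
proof (rule hs.op_adj_eqI[OF rep_bounded rep_bounded])
  fix \<xi> \<eta> assume "\<xi> \<in> hcarrier H" "\<eta> \<in> hcarrier H"
  then obtain s t where s: "Cauchy2 \<tau> s" "\<xi> = cls s" and t: "Cauchy2 \<tau> t" "\<eta> = cls t" by (auto simp: carrier_iff)
  have "(\<lambda>n. \<tau> (star (star a * t n) * s n)) \<longlonglongrightarrow> hinner H \<xi> (gns_rep \<tau> (star a) \<eta>)"
    unfolding s(2) t(2) rep_cls[OF t(1)] by (rule hinner_cls[OF s(1) Cauchy2_mult_left[OF t(1)]])
  then have "(\<lambda>n. \<tau> (star (t n) * (a * s n))) \<longlonglongrightarrow> hinner H \<xi> (gns_rep \<tau> (star a) \<eta>)"
    by (simp add: star_mult star_star mult.assoc)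
  then show "hinner H (gns_rep \<tau> a \<xi>) \<eta> = hinner H \<xi> (gns_rep \<tau> (star a) \<eta>)"
    unfolding s(2) t(2) rep_cls[OF s(1)]
    by (rule hinner_cls_eqI[OF Cauchy2_mult_left[OF s(1)] t(1)])
qed

lemma rep_mult: "op_mult H (gns_rep \<tau> a) (gns_rep \<tau> b) = gns_rep \<tau> (a * b)"
proof (rule hs.op_eqI)
  show "op_mult H (gns_rep \<tau> a) (gns_rep \<tau> b) \<in> extensional (hcarrier H)" by (simp add: op_mult_def)
  show "gns_rep \<tau> (a * b) \<in> extensional (hcarrier H)" by (simp add: gns_rep_def)
  fix \<xi> assume "\<xi> \<in> hcarrier H"
  then obtain s where s: "Cauchy2 \<tau> s" "\<xi> = cls s" by (auto simp: carrier_iff)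
  then show "op_mult H (gns_rep \<tau> a) (gns_rep \<tau> b) \<xi> = gns_rep \<tau> (a * b) \<xi>"
    by (simp add: hs.op_mult_apply rep_cls Cauchy2_mult_left mult.assoc)
qed

lemma rep_one: "gns_rep \<tau> 1 = op_id H"
proof (rule hs.op_eqI)
  fix \<xi> assume "\<xi> \<in> hcarrier H"
  then obtain s where s: "Cauchy2 \<tau> s" "\<xi> = cls s" by (auto simp: carrier_iff)
  then show "gns_rep \<tau> 1 \<xi> = op_id H \<xi>" by (simp add: hs.op_id_apply rep_cls)
qed (simp_all add: gns_rep_def op_id_def)

lemma range_rep: "range (gns_rep \<tau>) \<subseteq> bounded_ops H" "S \<in> range (gns_rep \<tau>) \<Longrightarrow> op_adj H S \<in> range (gns_rep \<tau>)"
  using rep_bounded rep_adj by auto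

abbreviation vac where "vac \<equiv> gns_vacuum \<tau>"

lemma vac_carrier [simp]: "vac \<in> hcarrier H"
  by (simp add: gns_vacuum_def)

lemma rep_vac: "gns_rep \<tau> a vac = cls (\<lambda>_. a)"
  by (simp add: gns_vacuum_def rep_cls)

lemma gns_trace_rep: "gns_trace \<tau> (gns_rep \<tau> a) = \<tau> a"
  unfolding gns_trace_def rep_vac by (simp add: gns_vacuum_def hinner_cls_const)

text \<open>The classes of constant sequences are dense: the vector \<open>cls u\<close> is the limit of the constant classes of
the \<open>u k\<close>. A vector orthogonal to all of them is therefore orthogonal to itself.\<close>

lemma vec_eq_by_dense:
  assumes \<xi>: "\<xi> \<in> hcarrier H" and \<eta>: "\<eta> \<in> hcarrier H"
    and eq: "\<And>b. hinner H \<xi> (cls (\<lambda>_. b)) = hinner H \<eta> (cls (\<lambda>_. b))"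
  shows "\<xi> = \<eta>"
proof -
  obtain s t where s: "Cauchy2 \<tau> s" "\<xi> = cls s" and t: "Cauchy2 \<tau> t" "\<eta> = cls t"
    using \<xi> \<eta> by (auto simp: carrier_iff)
  define u where "u n = s n - t n" for n
  have u: "Cauchy2 \<tau> u" unfolding u_def by (rule Cauchy2_diff[OF s(1) t(1)])
  have uv: "cls u = hs.hsub \<xi> \<eta>" unfolding hs.hsub_def s(2) t(2) u_def by (simp add: hsub_cls s t)
  have orth: "hinner H (cls u) (cls (\<lambda>_. b)) = 0" for b
    unfolding uv using \<xi> \<eta> eq[of b] by simp
  have lim: "(\<lambda>k. hinner H (cls u) (cls (\<lambda>_. u k))) \<longlonglongrightarrow> hinner H (cls u) (cls u)"
  proof (rule LIM_zero_cancel, rule tendsto_0_of_norm_le)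
    let ?d = "\<lambda>k. hnorm H (hs.hsub (cls (\<lambda>_. u k)) (cls u))"
    show "\<forall>\<^sub>F k in sequentially. norm (hinner H (cls u) (cls (\<lambda>_. u k)) - hinner H (cls u) (cls u)) \<le> hnorm H (cls u) * ?d k"
    proof (rule always_eventually, rule allI)
      fix k
      show "norm (hinner H (cls u) (cls (\<lambda>_. u k)) - hinner H (cls u) (cls u)) \<le> hnorm H (cls u) * ?d k"
        using hs.hCauchy_Schwarz[of "cls u" "hs.hsub (cls (\<lambda>_. u k)) (cls u)"] u by simp
    qed
    have "?d \<longlonglongrightarrow> 0"
    proof (rule LIMSEQ_I)
      fix e :: real assume e: "0 < e"
      then obtain M where M: "\<forall>m\<ge>M. \<forall>n\<ge>M. nrm (u m - u n) < e / 2"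
        using u unfolding Cauchy2_iff by (meson half_gt_zero)
      have "norm (?d k - 0) < e" if k: "M \<le> k" for k
      proof -
        have "(\<lambda>n. nrm (u k - u n)) \<longlonglongrightarrow> ?d k"
          unfolding hs.hsub_def hsub_cls[OF Cauchy2_const u] by (rule hnorm_cls[OF Cauchy2_diff[OF Cauchy2_const u]])
        then have "?d k \<le> e / 2"
        proof (rule tendsto_upperbound)
          show "\<forall>\<^sub>F n in sequentially. nrm (u k - u n) \<le> e / 2"
            using eventually_ge_at_top[of M] by eventually_elim (use M k in \<open>auto intro: less_imp_le\<close>)
        qed simp
        moreover have "0 \<le> ?d k" using u by simp
        ultimately show ?thesis using e by simp
      qed
      then show "\<exists>no. \<forall>n\<ge>no. norm (?d n - 0) < e" by blast
    qed
    then show "(\<lambda>k. hnorm H (cls u) * ?d k) \<longlonglongrightarrow> 0" by (rule tendsto_mult_right_zero)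
  qed
  then have "hinner H (cls u) (cls u) = 0"
    unfolding orth using LIMSEQ_unique[OF tendsto_const] by metis
  then show ?thesis
    unfolding uv by (intro hs.hn_eq_0[OF \<xi> \<eta>]) (simp add: hnorm_def)
qed

text \<open>Right multiplications are bounded because \<open>\<tau>\<close> is a trace, and they lie in the commutant of the
representation. Hence an operator \<open>T\<close> of the von Neumann algebra is determined on the dense subspace of
constant classes by its value at the cyclic vector.\<close>

definition right_mult :: "'a \<Rightarrow> 'a gns_vec \<Rightarrow> 'a gns_vec" where
  "right_mult b = (\<lambda>\<xi>\<in>hcarrier H. \<Union>s\<in>\<xi>. cls (\<lambda>n. s n * b))"

lemma right_mult_cls:
  assumes s: "Cauchy2 \<tau> s"
  shows "right_mult b (cls s) = cls (\<lambda>n. s n * b)"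
proof -
  have "(\<Union>u\<in>cls s. cls (\<lambda>n. u n * b)) = cls (\<lambda>n. s n * b)"
    by (rule UN_gns_class[OF s])
      (auto intro: null2_lipschitz[where B = "norm b"] nrm_mult_right_le simp flip: left_diff_distrib)
  then show ?thesis using s by (simp add: right_mult_def)
qed

lemma right_mult_commutant: "right_mult b \<in> commutant H (range (gns_rep \<tau>))"
proof -
  have "right_mult b \<in> bounded_ops H"
  proof (rule hs.bounded_opsI[of _ "norm b"])
    show "right_mult b \<in> extensional (hcarrier H)" by (simp add: right_mult_def)
    fix \<xi> assume "\<xi> \<in> hcarrier H"
    then obtain s where s: "Cauchy2 \<tau> s" "\<xi> = cls s" by (auto simp: carrier_iff)
    show "right_mult b \<xi> \<in> hcarrier H" unfolding s(2) right_mult_cls[OF s(1)] by (simp add: Cauchy2_mult_right s)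
    show "hnorm H (right_mult b \<xi>) \<le> norm b * hnorm H \<xi>"
      unfolding s(2) right_mult_cls[OF s(1)]
      by (rule LIMSEQ_le[OF hnorm_cls[OF Cauchy2_mult_right[OF s(1)]] tendsto_mult[OF tendsto_const hnorm_cls[OF s(1)]]])
        (auto intro: nrm_mult_right_le)
    show "right_mult b (hscale H c \<xi>) = hscale H c (right_mult b \<xi>)" for c
      unfolding s(2)
      by (simp add: right_mult_cls hscale_cls s(1) Cauchy2_scaleC Cauchy2_mult_right mult_scaleC_left)
    fix \<eta> assume "\<eta> \<in> hcarrier H"
    then obtain t where t: "Cauchy2 \<tau> t" "\<eta> = cls t" by (auto simp: carrier_iff)
    show "right_mult b (hadd H \<xi> \<eta>) = hadd H (right_mult b \<xi>) (right_mult b \<eta>)"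
      unfolding s(2) t(2)
      by (simp add: right_mult_cls hadd_cls s(1) t(1) Cauchy2_add Cauchy2_mult_right distrib_right)
  qed
  moreover have "right_mult b (gns_rep \<tau> a \<xi>) = gns_rep \<tau> a (right_mult b \<xi>)" if \<xi>: "\<xi> \<in> hcarrier H" for a \<xi>
  proof -
    obtain s where s: "Cauchy2 \<tau> s" "\<xi> = cls s" using \<xi> by (auto simp: carrier_iff)
    show ?thesis unfolding s(2)
      by (simp add: right_mult_cls rep_cls s(1) Cauchy2_mult_left Cauchy2_mult_right mult.assoc)
  qed
  ultimately show ?thesis by (auto simp: hs.mem_commutant_iff[OF range_rep(1)])
qed

lemma gns_vN_bounded: "T \<in> gns_vN \<tau> \<Longrightarrow> T \<in> bounded_ops H"
  using hs.commutant_bounded by (auto simp: gns_vN_def)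

lemma gns_vN_id: "op_id H \<in> gns_vN \<tau>"
  unfolding gns_vN_def by (rule hs.commutant_id[OF hs.commutant_bounded])

lemma gns_vN_mult: "S \<in> gns_vN \<tau> \<Longrightarrow> T \<in> gns_vN \<tau> \<Longrightarrow> op_mult H S T \<in> gns_vN \<tau>"
  unfolding gns_vN_def by (rule hs.commutant_mult[OF hs.commutant_bounded])

lemma gns_vN_adj: "T \<in> gns_vN \<tau> \<Longrightarrow> op_adj H T \<in> gns_vN \<tau>"
  unfolding gns_vN_def
  by (rule hs.commutant_adj[OF hs.commutant_bounded]) (rule hs.commutant_adj[OF range_rep])

lemma rep_in_gns_vN: "gns_rep \<tau> a \<in> gns_vN \<tau>"
proof -
  have "gns_rep \<tau> a (S \<xi>) = S (gns_rep \<tau> a \<xi>)"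
    if "S \<in> commutant H (range (gns_rep \<tau>))" "\<xi> \<in> hcarrier H" for S \<xi>
    using that by (simp add: hs.mem_commutant_iff[OF range_rep(1)])
  then show ?thesis
    unfolding gns_vN_def hs.mem_commutant_iff[OF hs.commutant_bounded] using rep_bounded by blast
qed

lemma gns_vN_right_mult:
  assumes "T \<in> gns_vN \<tau>" "\<xi> \<in> hcarrier H"
  shows "T (right_mult b \<xi>) = right_mult b (T \<xi>)"
  using assms right_mult_commutant[of b] unfolding gns_vN_def hs.mem_commutant_iff[OF hs.commutant_bounded] by blast

text \<open>Inner products are compared on constant classes. Writing such a class as \<open>R\<^sub>b\<Omega>\<close> with right
multiplication \<open>R\<^sub>b\<close>, one has \<open>T R\<^sub>b\<Omega> = R\<^sub>b T\<Omega>\<close>, so that \<open>T\<close> acts there by right multiplication of the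
sequence \<open>s\<close>.\<close>

lemma adj_vac:
  assumes T: "T \<in> gns_vN \<tau>" and s: "Cauchy2 \<tau> s" "T vac = cls s"
  shows "op_adj H T vac = cls (\<lambda>n. star (s n))"
proof (rule vec_eq_by_dense)
  have Tb: "T \<in> bounded_ops H" by (rule gns_vN_bounded[OF T])
  show "op_adj H T vac \<in> hcarrier H" by (simp add: hs.bounded_opsD(1)[OF hs.op_adj(1)[OF Tb]])
  show "cls (\<lambda>n. star (s n)) \<in> hcarrier H" by (simp add: Cauchy2_star s)
  fix b
  have "T (cls (\<lambda>_. b)) = T (right_mult b vac)" by (simp add: gns_vacuum_def right_mult_cls)
  also have "\<dots> = cls (\<lambda>n. s n * b)"
    by (simp add: gns_vN_right_mult[OF T] s(2) right_mult_cls[OF s(1)])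
  finally have Tb_eq: "T (cls (\<lambda>_. b)) = cls (\<lambda>n. s n * b)" .
  have "(\<lambda>n. \<tau> (star (s n * b) * 1)) \<longlonglongrightarrow> hinner H vac (T (cls (\<lambda>_. b)))"
    unfolding Tb_eq gns_vacuum_def by (rule hinner_cls[OF Cauchy2_const Cauchy2_mult_right[OF s(1)]])
  then have "(\<lambda>n. \<tau> (star b * star (s n))) \<longlonglongrightarrow> hinner H vac (T (cls (\<lambda>_. b)))"
    by (simp add: star_mult)
  then have "hinner H (cls (\<lambda>n. star (s n))) (cls (\<lambda>_. b)) = hinner H vac (T (cls (\<lambda>_. b)))"
    by (rule hinner_cls_eqI[OF Cauchy2_star[OF s(1)] Cauchy2_const])
  then show "hinner H (op_adj H T vac) (cls (\<lambda>_. b)) = hinner H (cls (\<lambda>n. star (s n))) (cls (\<lambda>_. b))"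
    by (simp add: hs.op_adj'[OF Tb])
qed

text \<open>If \<open>S\<Omega> = lim s\<^sub>n\<Omega>\<close> and \<open>T\<Omega> = lim t\<^sub>n\<Omega>\<close>, then \<open>\<langle>ST\<Omega>, \<Omega>\<rangle> = \<langle>T\<Omega>, S\<^sup>*\<Omega>\<rangle>\<close> is the limit of
\<open>\<tau>(s\<^sub>n t\<^sub>n)\<close>, which is symmetric in \<open>S\<close> and \<open>T\<close>.\<close>

theorem gns_trace_comm:
  assumes S: "S \<in> gns_vN \<tau>" and T: "T \<in> gns_vN \<tau>"
  shows "gns_trace \<tau> (op_mult H S T) = gns_trace \<tau> (op_mult H T S)"
proof -
  note Sb = gns_vN_bounded[OF S] and Tb = gns_vN_bounded[OF T]
  obtain s t where s: "Cauchy2 \<tau> s" "S vac = cls s" and t: "Cauchy2 \<tau> t" "T vac = cls t"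
    using hs.bounded_opsD(1)[OF Sb vac_carrier] hs.bounded_opsD(1)[OF Tb vac_carrier] by (auto simp: carrier_iff)
  have st: "(\<lambda>n. \<tau> (s n * t n)) \<longlonglongrightarrow> gns_trace \<tau> (op_mult H S T)"
    if S: "S \<in> gns_vN \<tau>" and T: "T \<in> gns_vN \<tau>" and s: "Cauchy2 \<tau> s" "S vac = cls s" and t: "Cauchy2 \<tau> t" "T vac = cls t"
    for S T s t
  proof -
    have "gns_trace \<tau> (op_mult H S T) = hinner H (T vac) (op_adj H S vac)"
      by (simp add: gns_trace_def hs.op_mult_apply hs.op_adj(2)[OF gns_vN_bounded[OF S]]
          hs.bounded_opsD(1)[OF gns_vN_bounded[OF T]])
    then show ?thesis
      unfolding adj_vac[OF S s] t(2) using hinner_cls[OF t(1) Cauchy2_star[OF s(1)]] by (simp add: star_star)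
  qed
  have "(\<lambda>n. \<tau> (s n * t n)) \<longlonglongrightarrow> gns_trace \<tau> (op_mult H T S)"
    using st[OF T S t s] by (simp add: \<phi>_comm[of "t _"])
  with st[OF S T s t] show ?thesis by (rule LIMSEQ_unique)
qed

end


section \<open>The law of a tuple of operators\<close>

locale operator_tuple = hilbert_space H for H :: "'h hilbert" +
  fixes w :: "'k \<Rightarrow> 'h \<Rightarrow> 'h" and \<Omega> :: 'h
  assumes w: "w k \<in> bounded_ops H" and \<Omega>: "\<Omega> \<in> hcarrier H"
begin

abbreviation op_word :: "'k letter list \<Rightarrow> 'h \<Rightarrow> 'h" where
  "op_word \<equiv> word_value (op_id H) (op_mult H) (op_adj H) w"

definition law :: "'k ncpoly \<Rightarrow> complex" where
  "law = nc_law (\<lambda>T. ip (T \<Omega>) \<Omega>) (op_id H) (op_mult H) (op_adj H) w"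

lemma op_word_bounded: "op_word u \<in> bounded_ops H"
proof (induction u)
  case (Cons l u)
  then show ?case by (cases l) (simp_all add: op_mult_bounded w op_adj(1))
qed (simp add: op_id_bounded)

lemma op_word_closed [simp]: "\<xi> \<in> C \<Longrightarrow> op_word u \<xi> \<in> C"
  by (rule bounded_opsD(1)[OF op_word_bounded])

lemma op_word_append: "\<xi> \<in> C \<Longrightarrow> op_word (u @ v) \<xi> = op_word u (op_word v \<xi>)"
proof (induction u)
  case (Cons l u)
  then show ?case by (cases l) (simp_all add: op_mult_apply)
qed (simp add: op_id_apply)

lemma op_word_star:
  "\<xi> \<in> C \<Longrightarrow> \<eta> \<in> C \<Longrightarrow> ip (op_word u \<xi>) \<eta> = ip \<xi> (op_word (rev (map letter_star u)) \<eta>)"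
proof (induction u arbitrary: \<eta>)
  case (Cons l u)
  then show ?case
    by (cases l) (simp_all add: op_mult_apply op_word_append op_id_apply op_adj(2)[OF w] op_adj'[OF w]
        bounded_opsD(1)[OF w] bounded_opsD(1)[OF op_adj(1)[OF w]])
qed (simp add: op_id_apply)

text \<open>The vector \<open>P(w)\<Omega>\<close> is characterized by its inner products, which are sums of complex numbers,
rather than as a sum over the words of \<open>P\<close> in the carrier.\<close>

lemma pvec_exists:
  "\<exists>\<xi>\<in>C. \<forall>\<eta>\<in>C. ip \<xi> \<eta> = nc_law (\<lambda>T. ip (T \<Omega>) \<eta>) (op_id H) (op_mult H) (op_adj H) w P"
proof (induction P rule: ncpoly_induct)
  case (single u c)
  show ?case by (rule bexI[of _ "hscale H c (op_word (letters u) \<Omega>)"]) (simp_all add: \<Omega>)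
next
  case (add P Q)
  then obtain \<xi> \<eta> where "\<xi> \<in> C" "\<eta> \<in> C"
    "\<forall>\<zeta>\<in>C. ip \<xi> \<zeta> = nc_law (\<lambda>T. ip (T \<Omega>) \<zeta>) (op_id H) (op_mult H) (op_adj H) w P"
    "\<forall>\<zeta>\<in>C. ip \<eta> \<zeta> = nc_law (\<lambda>T. ip (T \<Omega>) \<zeta>) (op_id H) (op_mult H) (op_adj H) w Q" by blast
  then show ?case by (intro bexI[of _ "hadd H \<xi> \<eta>"]) (simp_all add: nc_law_add)
qed

definition pvec :: "'k ncpoly \<Rightarrow> 'h" where
  "pvec P = (SOME \<xi>. \<xi> \<in> C \<and> (\<forall>\<eta>\<in>C. ip \<xi> \<eta> = nc_law (\<lambda>T. ip (T \<Omega>) \<eta>) (op_id H) (op_mult H) (op_adj H) w P))"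

lemma pvec: "pvec P \<in> C"
  "\<eta> \<in> C \<Longrightarrow> ip (pvec P) \<eta> = nc_law (\<lambda>T. ip (T \<Omega>) \<eta>) (op_id H) (op_mult H) (op_adj H) w P"
proof -
  have "\<exists>\<xi>. \<xi> \<in> C \<and> (\<forall>\<eta>\<in>C. ip \<xi> \<eta> = nc_law (\<lambda>T. ip (T \<Omega>) \<eta>) (op_id H) (op_mult H) (op_adj H) w P)"
    using pvec_exists[of P] by blast
  from someI_ex[OF this] show "pvec P \<in> C"
    "\<eta> \<in> C \<Longrightarrow> ip (pvec P) \<eta> = nc_law (\<lambda>T. ip (T \<Omega>) \<eta>) (op_id H) (op_mult H) (op_adj H) w P"
    unfolding pvec_def by blast+
qed

lemma pvec_single: "pvec (Poly_Mapping.single u c) = hscale H c (op_word (letters u) \<Omega>)"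
  by (rule hvec_eqI) (simp_all add: pvec \<Omega>)

lemma pvec_add: "pvec (P + Q) = hadd H (pvec P) (pvec Q)"
  by (rule hvec_eqI) (simp_all add: pvec nc_law_add)

lemma pvec_const_mult: "pvec (nc_const c * P) = hscale H c (pvec P)"
  by (rule hvec_eqI) (simp_all add: pvec nc_law_const_mult)

lemma pvec_diff: "pvec (P - Q) = hsub (pvec P) (pvec Q)"
proof -
  have "P - Q = P + nc_const (- 1) * Q" by (simp add: nc.sc_minus)
  then show ?thesis by (simp only: pvec_add pvec_const_mult hsub_def)
qed

lemma pvec_1: "pvec 1 = \<Omega>"
  using pvec_single[of 0 1] by (simp add: zero_ncword_def op_id_apply \<Omega> flip: single_one)
    (rule hvec_eqI, simp_all add: \<Omega>)

lemma pvec_var_mult: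
  "pvec (nc_var k * P) = w k (pvec P)" "pvec (nc_star (nc_var k) * P) = op_adj H (w k) (pvec P)"
proof (induction P rule: ncpoly_induct)
  case (single u c)
  {
    case 1
    show ?case
      by (simp add: nc_var_def mult_single plus_ncword_def pvec_single op_mult_apply \<Omega> bounded_opsD[OF w])
  next
    case 2
    show ?case
      by (simp add: nc_var_def mult_single plus_ncword_def word_star_def pvec_single op_mult_apply \<Omega>
          bounded_opsD[OF op_adj(1)[OF w]])
  }
next
  case (add P Q)
  {
    case 1
    show ?case using add by (simp add: distrib_left pvec_add bounded_opsD[OF w] pvec)
  next
    case 2
    show ?case using add by (simp add: distrib_left pvec_add bounded_opsD[OF op_adj(1)[OF w]] pvec)
  }
qed

lemma law_star_mult: "law (nc_star Q * P) = ip (pvec P) (pvec Q)"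
proof (induction P rule: ncpoly_induct)
  case (single u c)
  show ?case
  proof (induction Q rule: ncpoly_induct)
    case (single v d)
    have "ip (op_word (rev (map letter_star (letters v)) @ letters u) \<Omega>) \<Omega> = ip (op_word (letters u) \<Omega>) (op_word (letters v) \<Omega>)"
      using op_word_star[of "op_word (letters u) \<Omega>" \<Omega> "rev (map letter_star (letters v))"]
      by (simp add: op_word_append \<Omega> rev_map comp_def)
    then show ?case
      by (simp add: law_def mult_single plus_ncword_def word_star_def pvec_single \<Omega>)
  next
    case (add Q1 Q2)
    then show ?case by (simp add: nc_star_add distrib_right law_def nc_law_add pvec_add pvec)
  qed
next
  case (add P1 P2)
  then show ?case by (simp add: distrib_left law_def nc_law_add pvec_add pvec)
qed

lemma positive_law: "positive_nc_functional law"
proof unfold_locales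
  fix P Q :: "'k ncpoly" and c
  show "law (P + Q) = law P + law Q" "law (nc_const c * P) = c * law P"
    by (simp_all add: law_def nc_law_add nc_law_const_mult)
  show "law (nc_star P * P) \<in> \<real>\<^sub>\<ge>\<^sub>0" by (simp add: law_star_mult ip_self pvec)
qed

lemma law_nrm: "positive_functional.nrm nc_star law P = hn (pvec P)"
proof -
  interpret positive_nc_functional law by (rule positive_law)
  show ?thesis by (simp add: nrm_def hnorm_def law_star_mult)
qed

lemma law_bdd:
  assumes "0 \<le> R" "\<And>\<xi>. \<xi> \<in> C \<Longrightarrow> hn (w k \<xi>) \<le> R * hn \<xi>"
  shows "positive_functional.bdd nc_star law R (nc_var k)"
proof -
  interpret positive_nc_functional law by (rule positive_law)
  show ?thesis by (rule bddI) (use assms in \<open>simp_all add: law_nrm pvec_var_mult pvec\<close>)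
qed

text \<open>The vectors \<open>Q(w)\<Omega>\<close>, with \<open>Q\<close> a polynomial in the variables \<open>p i\<close>, form a subspace that contains \<open>\<Omega>\<close> and is
invariant under the operators \<open>w (p i)\<close> and their adjoints. Its closure is therefore invariant under
the von Neumann algebra generated by them, and contains \<open>w k \<Omega>\<close>.\<close>

lemma law_approx:
  assumes "w k \<in> vN_generated H (range (\<lambda>i. w (p i)))"
  shows "positive_functional.approx nc_star law (range (nc_subst (\<lambda>i. nc_var (p i)))) (nc_var k)"
proof -
  interpret positive_nc_functional law by (rule positive_law)
  let ?s = "nc_subst (\<lambda>i. nc_var (p i))"
  define D where "D = range (\<lambda>Q. pvec (?s Q))"
  let ?X = "range (\<lambda>i. w (p i)) \<union> op_adj H ` range (\<lambda>i. w (p i))"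
  have D: "hsubspace D"
    unfolding hsubspace_def D_def
  proof (intro conjI ballI allI)
    show "range (\<lambda>Q. pvec (?s Q)) \<subseteq> C" by (auto simp: pvec)
    fix \<xi> assume "\<xi> \<in> range (\<lambda>Q. pvec (?s Q))"
    then obtain P where P: "\<xi> = pvec (?s P)" by auto
    show "hscale H c \<xi> \<in> range (\<lambda>Q. pvec (?s Q))" for c
      unfolding P by (rule range_eqI[of _ _ "nc_const c * P"]) (simp add: nc_subst_mult pvec_const_mult)
    fix \<eta> assume "\<eta> \<in> range (\<lambda>Q. pvec (?s Q))"
    then obtain Q where Q: "\<eta> = pvec (?s Q)" by auto
    show "hadd H \<xi> \<eta> \<in> range (\<lambda>Q. pvec (?s Q))"
      unfolding P Q by (rule range_eqI[of _ _ "P + Q"]) (simp add: nc_subst_add pvec_add)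
  qed auto
  have X: "?X \<subseteq> bounded_ops H" using w op_adj(1) by auto
  have X_adj: "op_adj H S \<in> ?X" if "S \<in> ?X" for S using that w by auto
  have inv: "S \<xi> \<in> D" if S: "S \<in> ?X" and \<xi>: "\<xi> \<in> D" for S \<xi>
  proof -
    obtain Q where Q: "\<xi> = pvec (?s Q)" using \<xi> by (auto simp: D_def)
    from S obtain i where "S = w (p i) \<or> S = op_adj H (w (p i))" by auto
    then show ?thesis
    proof
      assume "S = w (p i)"
      then have "S \<xi> = pvec (?s (nc_var i * Q))" by (simp add: Q nc_subst_mult pvec_var_mult)
      then show ?thesis by (auto simp: D_def)
    next
      assume "S = op_adj H (w (p i))"
      then have "S \<xi> = pvec (?s (nc_star (nc_var i) * Q))" by (simp add: Q nc_subst_mult nc_subst_star pvec_var_mult)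
      then show ?thesis by (auto simp: D_def)
    qed
  qed
  have "pvec (?s 1) \<in> D" unfolding D_def by blast
  then have "\<Omega> \<in> hclosure D" using hsubspace_hclosure(3)[OF D] by (auto simp: pvec_1)
  have "w k \<Omega> \<in> hclosure D"
  proof (rule double_commutant_invariant[OF D X, where T = "w k" and \<zeta> = \<Omega>])
    show "w k \<in> commutant H (commutant H ?X)" using assms by (simp add: vN_generated_def)
    show "\<Omega> \<in> hclosure D" by fact
  qed (fact X_adj, fact inv)
  moreover have "w k \<Omega> = pvec (nc_var k)" using pvec_var_mult(1)[of k 1] by (simp add: pvec_1)
  ultimately show ?thesis
    unfolding approx_def hclosure_def D_def by (auto simp: law_nrm pvec_diff)
qed

end


section \<open>Entropy of a C*-algebra and of its traces\<close>

text \<open>The elements of the C*-algebra that commute, together with their adjoints, with a given operator form a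
norm closed *-subalgebra. If it contains the generators, it is everything.\<close>

lemma (in gns) gns_vN_subset_generated:
  assumes a: "cstar_generating_tuple R a"
  shows "gns_vN \<tau> \<subseteq> vN_generated H (range (\<lambda>i. gns_rep \<tau> (a i)))"
proof -
  let ?X = "range (\<lambda>i. gns_rep \<tau> (a i)) \<union> op_adj H ` range (\<lambda>i. gns_rep \<tau> (a i))"
  have X: "?X \<subseteq> bounded_ops H" using rep_bounded rep_adj by auto
  have "commutant H ?X \<subseteq> commutant H (range (gns_rep \<tau>))"
  proof
    fix S assume S: "S \<in> commutant H ?X"
    then have Sb: "S \<in> bounded_ops H" using hs.commutant_bounded by blast
    define B where "B = {b. \<forall>\<xi>\<in>hcarrier H. S (gns_rep \<tau> b \<xi>) = gns_rep \<tau> b (S \<xi>) \<and>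
      S (gns_rep \<tau> (star b) \<xi>) = gns_rep \<tau> (star b) (S \<xi>)}"
    have add: "gns_rep \<tau> (b + c) \<xi> = hadd H (gns_rep \<tau> b \<xi>) (gns_rep \<tau> c \<xi>)" if "\<xi> \<in> hcarrier H" for b c \<xi>
    proof -
      obtain s where s: "Cauchy2 \<tau> s" "\<xi> = cls s" using \<open>\<xi> \<in> hcarrier H\<close> by (auto simp: carrier_iff)
      then show ?thesis by (simp add: rep_cls hadd_cls Cauchy2_mult_left distrib_right)
    qed
    have scale: "gns_rep \<tau> (c *\<^sub>C b) \<xi> = hscale H c (gns_rep \<tau> b \<xi>)" if "\<xi> \<in> hcarrier H" for b c \<xi>
    proof -
      obtain s where s: "Cauchy2 \<tau> s" "\<xi> = cls s" using \<open>\<xi> \<in> hcarrier H\<close> by (auto simp: carrier_iff)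
      then show ?thesis by (simp add: rep_cls hscale_cls Cauchy2_mult_left mult_scaleC_left)
    qed
    have mult: "gns_rep \<tau> (b * c) \<xi> = gns_rep \<tau> b (gns_rep \<tau> c \<xi>)" if "\<xi> \<in> hcarrier H" for b c \<xi>
      using that by (simp flip: rep_mult add: hs.op_mult_apply)
    have diff: "hnorm H (hs.hsub (gns_rep \<tau> b \<xi>) (gns_rep \<tau> c \<xi>)) \<le> norm (b - c) * hnorm H \<xi>"
      if "\<xi> \<in> hcarrier H" for b c \<xi>
    proof -
      obtain s where s: "Cauchy2 \<tau> s" "\<xi> = cls s" using \<open>\<xi> \<in> hcarrier H\<close> by (auto simp: carrier_iff)
      have "hs.hsub (gns_rep \<tau> b \<xi>) (gns_rep \<tau> c \<xi>) = gns_rep \<tau> (b - c) \<xi>"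
        unfolding hs.hsub_def s(2) rep_cls[OF s(1)]
        by (simp add: hsub_cls Cauchy2_mult_left s(1) left_diff_distrib)
      then show ?thesis using rep_hn_le[OF that] by simp
    qed
    note repC = hs.bounded_opsD(1)[OF rep_bounded] and SC = hs.bounded_opsD(1)[OF Sb]
    have "star_subalgebra B"
      unfolding star_subalgebra_def B_def mem_Collect_eq
      by (auto simp: add scale mult star_add star_mult star_scaleC star_star rep_one hs.op_id_apply
          hs.bounded_opsD[OF Sb] hs.bounded_opsD[OF rep_bounded])
    moreover have "closed B"
      unfolding closed_sequential_limits
    proof (intro allI impI, elim conjE)
      fix b l assume b: "\<forall>n. b n \<in> B" and l: "b \<longlonglongrightarrow> l"
      have lim: "S (gns_rep \<tau> l \<xi>) = gns_rep \<tau> l (S \<xi>)"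
        if b: "\<And>n. S (gns_rep \<tau> (b n) \<xi>) = gns_rep \<tau> (b n) (S \<xi>)" and l: "b \<longlonglongrightarrow> l" and \<xi>: "\<xi> \<in> hcarrier H"
        for b l \<xi>
      proof (rule hs.hn_eq_0)
        obtain K where K: "0 \<le> K" "\<And>\<xi>. \<xi> \<in> hcarrier H \<Longrightarrow> hnorm H (S \<xi>) \<le> K * hnorm H \<xi>"
          using hs.bounded_ops_bound[OF Sb] by blast
        let ?d = "hnorm H (hs.hsub (S (gns_rep \<tau> l \<xi>)) (gns_rep \<tau> l (S \<xi>)))"
        have "?d \<le> (K * hnorm H \<xi> + hnorm H (S \<xi>)) * norm (b n - l)" for n
        proof -
          have "?d \<le> hnorm H (hs.hsub (S (gns_rep \<tau> l \<xi>)) (S (gns_rep \<tau> (b n) \<xi>)))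
              + hnorm H (hs.hsub (gns_rep \<tau> (b n) (S \<xi>)) (gns_rep \<tau> l (S \<xi>)))"
            unfolding b[of n] using \<xi> by (intro hs.hn_sub_triangle) (simp_all add: repC SC)
          also have "hs.hsub (S (gns_rep \<tau> l \<xi>)) (S (gns_rep \<tau> (b n) \<xi>)) = S (hs.hsub (gns_rep \<tau> l \<xi>) (gns_rep \<tau> (b n) \<xi>))"
            using \<xi> by (simp add: hs.bounded_ops_sub[OF Sb] repC)
          also have "hnorm H \<dots> \<le> K * hnorm H (hs.hsub (gns_rep \<tau> l \<xi>) (gns_rep \<tau> (b n) \<xi>))"
            using \<xi> by (intro K) (simp add: repC)
          also have "\<dots> \<le> K * (norm (l - b n) * hnorm H \<xi>)" using diff[OF \<xi>] K(1) by (intro mult_left_mono)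
          also have "hnorm H (hs.hsub (gns_rep \<tau> (b n) (S \<xi>)) (gns_rep \<tau> l (S \<xi>))) \<le> norm (b n - l) * hnorm H (S \<xi>)"
            by (rule diff) (simp add: SC \<xi>)
          finally show ?thesis by (simp add: norm_minus_commute[of l] algebra_simps)
        qed
        moreover have "(\<lambda>n. (K * hnorm H \<xi> + hnorm H (S \<xi>)) * norm (b n - l)) \<longlonglongrightarrow> 0"
          using l by (intro tendsto_mult_right_zero) (simp add: LIM_zero tendsto_norm_zero)
        ultimately have "?d \<le> 0" by (intro LIMSEQ_le_const) auto
        then show "?d = 0" using \<xi> by (simp add: repC SC antisym)
      qed (use \<xi> in \<open>simp_all add: repC SC\<close>)
      have star_l: "(\<lambda>n. star (b n)) \<longlonglongrightarrow> star l"
        using continuous_on_tendsto_compose[OF continuous_on_star l, of UNIV] by simp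
      show "l \<in> B"
        using b lim[OF _ l] lim[OF _ star_l] by (auto simp: B_def)
    qed
    moreover have "range a \<subseteq> B"
    proof (clarsimp simp: B_def)
      fix i \<xi> assume "\<xi> \<in> hcarrier H"
      moreover have "gns_rep \<tau> (star (a i)) \<in> ?X" using rep_adj[of "a i"] by (metis UnI2 imageI rangeI)
      ultimately show "S (gns_rep \<tau> (a i) \<xi>) = gns_rep \<tau> (a i) (S \<xi>) \<and>
          S (gns_rep \<tau> (star (a i)) \<xi>) = gns_rep \<tau> (star (a i)) (S \<xi>)"
        using S unfolding hs.mem_commutant_iff[OF X] by blast
    qed
    ultimately have "B = UNIV" using a by (simp add: cstar_generating_tuple_def)
    then show "S \<in> commutant H (range (gns_rep \<tau>))"
      using Sb by (auto simp: hs.mem_commutant_iff[OF range_rep(1)] B_def)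
  qed
  then show ?thesis unfolding gns_vN_def vN_generated_def by (auto simp: commutant_def)
qed

text \<open>The tuples \<open>a\<close> and \<open>x\<close> are joined to one tuple of operators indexed by the sum type. As both
generate the von Neumann algebra, each half approximates the other, and the comparison of entropies
applies in both directions.\<close>

lemma trace_law_entropy:
  fixes a :: "'i \<Rightarrow> 'a::cstar_algebra" and x :: "'j \<Rightarrow> 'a gns_vec \<Rightarrow> 'a gns_vec"
  assumes \<tau>: "\<tau> \<in> traces" and a: "cstar_generating_tuple R a"
    and x: "vN_generating_tuple (gns_space \<tau>) (gns_vN \<tau>) S x"
  shows "trace_law \<tau> a \<in> law_space R"
    and "entropy1 R {trace_law \<tau> a} = vN_entropy (gns_space \<tau>) (gns_trace \<tau>) S x"
proof -
  interpret gns \<tau> using \<tau> by unfold_locales (simp add: traces_def)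
  have RS: "0 < R" "0 < S" and aR: "\<And>i. norm (a i) \<le> R"
    and xM: "\<And>j. x j \<in> gns_vN \<tau>" "\<And>j. op_norm H (x j) \<le> S" "vN_generated H (range x) = gns_vN \<tau>"
    using a x by (auto simp: cstar_generating_tuple_def vN_generating_tuple_def)
  define w :: "'i + 'j \<Rightarrow> 'a gns_vec \<Rightarrow> 'a gns_vec" where "w = case_sum (\<lambda>i. gns_rep \<tau> (a i)) x"
  have w_simps: "w (Inl i) = gns_rep \<tau> (a i)" "w (Inr j) = x j" for i j by (simp_all add: w_def)
  have wM: "w k \<in> gns_vN \<tau>" for k by (cases k) (simp_all add: w_simps rep_in_gns_vN xM)
  interpret ot: operator_tuple H w vac
    by unfold_locales (simp_all add: gns_vN_bounded wM)
  have law: "ot.law = nc_law (gns_trace \<tau>) (op_id H) (op_mult H) (op_adj H) w"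
    unfolding ot.law_def gns_trace_def ..
  have wordM: "ot.op_word u \<in> gns_vN \<tau>" for u
  proof (induction u)
    case (Cons l u)
    then show ?case by (cases l) (simp_all add: gns_vN_mult gns_vN_adj wM)
  qed (simp add: gns_vN_id)
  interpret pl: positive_nc_functional ot.law by (rule ot.positive_law)
  have tracial: "tracial_nc_functional ot.law"
  proof unfold_locales
    show "ot.law 1 = 1"
    proof -
      have "ot.law 1 = hinner H vac vac" using ot.law_star_mult[of 1 1] by (simp add: ot.pvec_1)
      then show ?thesis by (simp add: gns_vacuum_def hinner_cls_const \<phi>_1)
    qed
    show "ot.law (P * Q) = ot.law (Q * P)" for P Q
    proof (induction P rule: ncpoly_induct)
      case (single u c)
      show ?case
      proof (induction Q rule: ncpoly_induct)
        case (single v d)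
        have app: "ot.op_word (u @ v) = op_mult H (ot.op_word u) (ot.op_word v)" for u v
          by (rule hs.op_eqI)
            (use hs.bounded_opsD(4)[OF ot.op_word_bounded] in \<open>simp_all add: ot.op_word_append hs.op_mult_apply\<close>,
              simp add: op_mult_def)
        show ?case
          by (simp add: mult_single plus_ncword_def law app gns_trace_comm[OF wordM wordM, of "letters u"] mult.commute)
      qed (simp_all add: distrib_left distrib_right pl.\<phi>_add)
    qed (simp_all add: distrib_left distrib_right pl.\<phi>_add)
  qed
  have bddL: "pl.bdd R (nc_var (Inl i))" for i
  proof (rule ot.law_bdd)
    show "hnorm H (w (Inl i) \<xi>) \<le> R * hnorm H \<xi>" if "\<xi> \<in> hcarrier H" for \<xi>
      unfolding w_simps using rep_hn_le[OF that, of "a i"] mult_right_mono[OF aR hs.hn_ge0[OF that], of i] by linarith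
  qed (use RS in simp)
  have bddR: "pl.bdd S (nc_var (Inr j))" for j
  proof (rule ot.law_bdd)
    show "hnorm H (w (Inr j) \<xi>) \<le> S * hnorm H \<xi>" if "\<xi> \<in> hcarrier H" for \<xi>
      unfolding w_simps
      using hs.hn_op_le_op_norm[OF gns_vN_bounded[OF xM(1)] that] mult_right_mono[OF xM(2) hs.hn_ge0[OF that]]
      by (rule order_trans)
  qed (use RS in simp)
  have apxL: "pl.approx (range (nc_subst (\<lambda>j. nc_var (Inr j)))) (nc_var (Inl i))" for i
    by (rule ot.law_approx) (simp add: w_simps xM(3) rep_in_gns_vN)
  have apxR: "pl.approx (range (nc_subst (\<lambda>i. nc_var (Inl i)))) (nc_var (Inr j))" for j
    by (rule ot.law_approx) (use gns_vN_subset_generated[OF a] xM(1) in \<open>auto simp: w_simps\<close>)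
  have lawL: "(\<lambda>P. ot.law (nc_subst (\<lambda>i. nc_var (Inl i)) P)) = trace_law \<tau> a"
  proof
    fix P
    have word: "word_value (op_id H) (op_mult H) (op_adj H) (\<lambda>i. gns_rep \<tau> (a i)) u = gns_rep \<tau> (word_value 1 (*) star a u)" for u
    proof (induction u)
      case (Cons l u)
      then show ?case by (cases l) (simp_all add: rep_mult rep_adj)
    qed (simp add: rep_one)
    have "ot.law (nc_subst (\<lambda>i. nc_var (Inl i)) P) =
        nc_law (gns_trace \<tau>) (op_id H) (op_mult H) (op_adj H) (\<lambda>i. gns_rep \<tau> (a i)) P"
      by (simp only: law nc_law_rename w_simps)
    also have "\<dots> = trace_law \<tau> a P"
      by (simp add: trace_law_def nc_law_def word gns_trace_rep)
    finally show "ot.law (nc_subst (\<lambda>i. nc_var (Inl i)) P) = trace_law \<tau> a P" .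
  qed
  have lawR: "(\<lambda>P. ot.law (nc_subst (\<lambda>j. nc_var (Inr j)) P)) = vN_law H (gns_trace \<tau>) x"
    by (rule ext) (simp add: law nc_law_rename w_simps vN_law_def)
  interpret tl: tracial_nc_functional ot.law by (rule tracial)
  show "trace_law \<tau> a \<in> law_space R"
    using tl.subst_in_law_space[of R "\<lambda>i. nc_var (Inl i)", OF bddL] by (simp only: lawL)
  have "entropy1 R {trace_law \<tau> a} \<le> entropy1 S {vN_law H (gns_trace \<tau>) x}"
    using entropy1_mono_of_approx[OF tracial less_imp_le[OF RS(1)] RS(2) bddL bddR apxL apxR] by (simp only: lawL lawR)
  moreover have "entropy1 S {vN_law H (gns_trace \<tau>) x} \<le> entropy1 R {trace_law \<tau> a}"
    using entropy1_mono_of_approx[OF tracial less_imp_le[OF RS(2)] RS(1) bddR bddL apxR apxL] by (simp only: lawL lawR)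
  ultimately show "entropy1 R {trace_law \<tau> a} = vN_entropy H (gns_trace \<tau>) S x"
    unfolding vN_entropy_def by (rule antisym)
qed

theorem theorem6p1:
  fixes R :: real and a :: "'i \<Rightarrow> 'a::cstar_algebra"
    and S :: "('a \<Rightarrow> complex) \<Rightarrow> real"
    and x :: "('a \<Rightarrow> complex) \<Rightarrow> 'j \<Rightarrow> 'a gns_vec \<Rightarrow> 'a gns_vec"
  assumes "(traces :: ('a \<Rightarrow> complex) set) \<noteq> {}"
    and "cstar_generating_tuple R a"
    and "\<And>\<tau>. \<tau> \<in> traces \<Longrightarrow> vN_generating_tuple (gns_space \<tau>) (gns_vN \<tau>) (S \<tau>) (x \<tau>)"
  shows "cstar_entropy R a =
    (SUP \<tau>\<in>traces. vN_entropy (gns_space \<tau>) (gns_trace \<tau>) (S \<tau>) (x \<tau>))"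
proof -
  have "cstar_entropy R a = (SUP m\<in>trace_laws a. entropy1 R {m})"
    unfolding cstar_entropy_def
  proof (rule entropy1_compact[OF compact_trace_laws])
    show "trace_laws a \<subseteq> law_space R"
      using trace_law_entropy(1)[OF _ assms(2,3)] by (auto simp: trace_laws_def)
    show "trace_laws a \<noteq> {}" using assms(1) by (simp add: trace_laws_def)
  qed
  also have "\<dots> = (SUP \<tau>\<in>traces. entropy1 R {trace_law \<tau> a})"
    by (simp add: trace_laws_def image_image)
  also have "\<dots> = (SUP \<tau>\<in>traces. vN_entropy (gns_space \<tau>) (gns_trace \<tau>) (S \<tau>) (x \<tau>))"
    by (rule SUP_cong) (use trace_law_entropy(2)[OF _ assms(2,3)] in auto)
  finally show ?thesis .
qed

end
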